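(* Let $A$ be a finitely generated commutative ring. Then the Cantor-Bendixson rank of $A$ coincides with its reduced length $\ell'(A)$. That is, for every $n$ and every family $(x_1,\dots,x_n)$ of ring generators of $A$, the Cantor-Bendixson rank of the point $(A,(x_1,\dots,x_n))$ in the space $\mathcal{R}_n$ of rings marked on $n$ generators equals $\ell'(A)$.
   Context: All rings are commutative with unity. $\mathcal{R}_n$ is the set of pairs $(A,(x_1,\dots,x_n))$ where $A$ is a ring endowed with a family of ring generators $(x_1,\dots,x_n)$ (i.e. generating $A$ as a $\mathbf{Z}$-algebra), up to marked ring isomorphism. It is a topological space in which a prebasis of neighbourhoods of $(A,(x_1,\dots,x_n))$ is given by the following sets $V_P$, for $P\in\mathbf{Z}[X_1,\dots,X_n]$: if $P=0$ (respectively $P\neq 0$) in $A$ when evaluated at $(x_1,\dots,x_n)$, then $V_P$ is the set of marked rings on $n$ generators in which $P=0$ (respectively $P\neq 0$), where $P$ is evaluated on the $n$-tuple of marked generators. Cantor-Bendixson rank: for a topological space $X$, define by transfinite induction $I_0(X)$ as the set of isolated points of $X$, and $I_\alpha(X)=I_0\big(X-\bigcup_{\beta<\alpha}I_\beta(X)\big)$. A point $x\in X$ has Cantor-Bendixson rank $\alpha$ if $x\in I_\alpha(X)$, and rank $\infty$ if $x\notin\bigcup_\alpha I_\alpha(X)$. The rank of a marked ring in $\mathcal{R}_n$ does not depend on $n$ or on the choice of generators, but only on the isomorphism class of the ring; it is called the Cantor-Bendixson rank of the ring. Reduced length: for a noetherian ring $A$, $\ell'(A)$ is the ordinal defined (by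 noetherian induction) by $\ell'(A)=\sup\{\ell'(B)+1 \mid B \text{ quotient ring of } A \text{ such that the kernel of } A\to B \text{ is non-artinian as an } A\text{-module}\}$, with $\sup\emptyset=0$. (For finitely generated rings, a kernel is non-artinian if and only if it is infinite.) *)

theory Defs
  imports
    "HOL-Analysis.Function_Topology"
    "HOL-Algebra.Algebra"
    "HOL-Library.Poly_Mapping"
    "HOL-Library.Infinite_Typeclass"
begin

section \<open>Ordinals\<close>

text \<open>
  The type \<open>'o ordinal\<close> consists of the order types of all well-orders whose field is a
  subset of \<open>'o\<close>, that is, of all ordinals of cardinality at most that of \<open>'o\<close>. For
  infinite \<open>'o\<close> this contains all countable ordinals, it has no largest element, and each
  of its countable subsets has a supremum in it.
\<close>

quotient_type 'o ordinal = "'o rel" / partial: "\<lambda>r s. r =o s"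
proof (rule part_equivpI)
  have "Well_order ({} :: 'o rel)"
    by simp
  then show "\<exists>r :: 'o rel. r =o r"
    using ordIso_reflexive by blast
qed (auto simp: symp_def transp_def intro: ordIso_symmetric ordIso_transitive)

instantiation ordinal :: (type) linorder
begin

lift_definition less_eq_ordinal :: "'a ordinal \<Rightarrow> 'a ordinal \<Rightarrow> bool" is "\<lambda>r s. r \<le>o s"
  by (meson ordIso_iff_ordLeq ordLeq_transitive)

lift_definition less_ordinal :: "'a ordinal \<Rightarrow> 'a ordinal \<Rightarrow> bool" is "\<lambda>r s. r <o s"
  by (meson ordIso_ordLess_trans ordIso_symmetric ordLess_ordIso_trans)

instance
proof
  fix x y z :: "'a ordinal"
  show "x < y \<longleftrightarrow> x \<le> y \<and> \<not> y \<le> x"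
    by transfer (metis not_ordLeq_ordLess not_ordLess_iff_ordLeq ordIso_Well_order_simp
      ordIso_iff_ordLeq ordLess_imp_ordLeq ordLeq_iff_ordLess_or_ordIso)
  show "x \<le> x"
    by transfer (rule ordIso_imp_ordLeq)
  show "x \<le> z" if "x \<le> y" "y \<le> z"
    using that by transfer (rule ordLeq_transitive)
  show "x = y" if "x \<le> y" "y \<le> x"
    using that by transfer (simp add: ordIso_iff_ordLeq)
  show "x \<le> y \<or> y \<le> x"
    by transfer (metis ordLeq_total ordIso_Well_order_simp)
qed

end

instance ordinal :: (type) wellorder
proof
  fix P :: "'a ordinal \<Rightarrow> bool" and a
  assume step: "\<And>x. (\<And>y. y < x \<Longrightarrow> P y) \<Longrightarrow> P x"
  have "wf {(x, y :: 'a ordinal). x < y}"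
  proof (rule wf_subset)
    show "wf (inv_image ordLess rep_ordinal)"
      by (rule wf_inv_image[OF wf_ordLess])
    show "{(x, y). x < y} \<subseteq> inv_image ordLess rep_ordinal"
      by (auto simp: less_ordinal.rep_eq)
  qed
  then show "P a"
    by induction (use step in auto)
qed

definition ordinal_succ :: "'o :: wellorder \<Rightarrow> 'o"
  where "ordinal_succ \<alpha> = (LEAST \<beta>. \<alpha> < \<beta>)"

definition ordinal_sup :: "'o :: wellorder set \<Rightarrow> 'o"
  where "ordinal_sup S = (LEAST \<beta>. \<forall>\<alpha>\<in>S. \<alpha> \<le> \<beta>)"


section \<open>Cantor-Bendixson rank\<close>

definition isolated_points :: "'x topology \<Rightarrow> 'x set"
  where "isolated_points T = {x \<in> topspace T. openin T {x}}"

function cb_level :: "'x topology \<Rightarrow> 'o :: wellorder \<Rightarrow> 'x set" where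
  "cb_level T \<alpha> =
     isolated_points (subtopology T (topspace T - (\<Union>\<beta>\<in>{..<\<alpha>}. cb_level T \<beta>)))"
  by auto
termination
  by (relation "inv_image {(\<beta>, \<alpha>). \<beta> < \<alpha>} snd") (auto intro: wf)

declare cb_level.simps [simp del]

text \<open>The value \<open>None\<close> stands for the rank \<open>\<infinity>\<close>.\<close>

definition cb_rank :: "'x topology \<Rightarrow> 'x \<Rightarrow> 'o :: wellorder option"
  where "cb_rank T x =
    (if \<exists>\<alpha> :: 'o. x \<in> cb_level T \<alpha> then Some (THE \<alpha>. x \<in> cb_level T \<alpha>) else None)"


section \<open>The space of marked rings\<close>

definition marked_ring :: "nat \<Rightarrow> 'a ring \<Rightarrow> 'a list \<Rightarrow> bool"
  where "marked_ring n A xs \<longleftrightarrow>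
    cring A \<and> length xs = n \<and> set xs \<subseteq> carrier A \<and> generate_ring A (set xs) = carrier A"

definition marked_isomorphic :: "'a ring \<Rightarrow> 'a list \<Rightarrow> 'b ring \<Rightarrow> 'b list \<Rightarrow> bool"
  where "marked_isomorphic A xs B ys \<longleftrightarrow> (\<exists>h \<in> ring_iso A B. map h xs = ys)"

text \<open>
  Finitely generated rings are countable, so each of them has an isomorphic copy whose carrier
  consists of natural numbers. A point of the space of marked rings is an isomorphism class of
  such copies.
\<close>

definition marked_class :: "nat \<Rightarrow> 'a ring \<Rightarrow> 'a list \<Rightarrow> (nat ring \<times> nat list) set"
  where "marked_class n A xs = {(B, ys). marked_ring n B ys \<and> marked_isomorphic A xs B ys}"

definition marked_rings :: "nat \<Rightarrow> (nat ring \<times> nat list) set set"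
  where "marked_rings n = {marked_class n A xs | A xs. marked_ring n (A :: nat ring) xs}"

text \<open>
  A polynomial in the variables \<open>X\<^sub>0, X\<^sub>1, \<dots>\<close> with integer coefficients is a finitely supported
  map from monomials to coefficients, and a monomial is a finitely supported map from
  variable indices to exponents.
\<close>

type_synonym int_mpoly = "(nat \<Rightarrow>\<^sub>0 nat) \<Rightarrow>\<^sub>0 int"

definition int_mpolys :: "nat \<Rightarrow> int_mpoly set"
  where "int_mpolys n = {P. \<forall>m \<in> Poly_Mapping.keys P. Poly_Mapping.keys m \<subseteq> {..<n}}"

definition eval_mpoly :: "'a ring \<Rightarrow> 'a list \<Rightarrow> int_mpoly \<Rightarrow> 'a"
  where "eval_mpoly A xs P =
    (\<Oplus>\<^bsub>A\<^esub>m\<in>Poly_Mapping.keys P. [Poly_Mapping.lookup P m] \<cdot>\<^bsub>A\<^esub>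
      (\<Otimes>\<^bsub>A\<^esub>i\<in>Poly_Mapping.keys m. xs ! i [^]\<^bsub>A\<^esub> Poly_Mapping.lookup m i))"

definition vanishing_locus :: "nat \<Rightarrow> int_mpoly \<Rightarrow> (nat ring \<times> nat list) set set"
  where "vanishing_locus n P =
    {c \<in> marked_rings n. \<forall>(A, xs) \<in> c. eval_mpoly A xs P = \<zero>\<^bsub>A\<^esub>}"

definition nonvanishing_locus :: "nat \<Rightarrow> int_mpoly \<Rightarrow> (nat ring \<times> nat list) set set"
  where "nonvanishing_locus n P =
    {c \<in> marked_rings n. \<forall>(A, xs) \<in> c. eval_mpoly A xs P \<noteq> \<zero>\<^bsub>A\<^esub>}"

definition marked_ring_space :: "nat \<Rightarrow> (nat ring \<times> nat list) set topology"
  where "marked_ring_space n =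
    topology_generated_by (vanishing_locus n ` int_mpolys n \<union> nonvanishing_locus n ` int_mpolys n)"


section \<open>Reduced length\<close>

definition artinian_module :: "('a, 'm) ring_scheme \<Rightarrow> ('a, 'b, 'k) module_scheme \<Rightarrow> bool"
  where "artinian_module A M \<longleftrightarrow>
    \<not> (\<exists>N :: nat \<Rightarrow> 'b set. \<forall>k. submodule (N k) A M \<and> N (Suc k) \<subset> N k)"

definition ideal_module :: "'a ring \<Rightarrow> 'a set \<Rightarrow> ('a, 'a) module"
  where "ideal_module A I =
    \<lparr>carrier = I, monoid.mult = (\<lambda>x y. x \<otimes>\<^bsub>A\<^esub> y), one = \<one>\<^bsub>A\<^esub>,
     ring.zero = \<zero>\<^bsub>A\<^esub>, ring.add = (\<lambda>x y. x \<oplus>\<^bsub>A\<^esub> y), smult = (\<lambda>a x. a \<otimes>\<^bsub>A\<^esub> x)\<rparr>"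

text \<open>
  Every quotient ring of \<open>A\<close> is isomorphic to a ring whose carrier is a subset of the
  carrier of \<open>A\<close>, so that the quotients of \<open>A\<close> can be taken over the same type as \<open>A\<close>.
\<close>

definition nonartinian_quotient :: "'a ring \<Rightarrow> 'a ring \<Rightarrow> bool"
  where "nonartinian_quotient A B \<longleftrightarrow>
    cring B \<and>
    (\<exists>h \<in> ring_hom A B. h ` carrier A = carrier B \<and>
      \<not> artinian_module A (ideal_module A (a_kernel A B h)))"

lemma wf_ideals:
  assumes "noetherian_ring A"
  shows "wf {(J, I). ideal I A \<and> ideal J A \<and> I \<subset> J}"
proof (rule ccontr)
  assume "\<not> ?thesis"
  then obtain f where "\<forall>i. (f (Suc i), f i) \<in> {(J, I). ideal I A \<and> ideal J A \<and> I \<subset> J}"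
    unfolding wf_iff_no_infinite_down_chain by blast
  then have f: "ideal (f i) A" "f i \<subset> f (Suc i)" for i
    by blast+
  have mono: "f i \<subseteq> f j" if "i \<le> j" for i j
    using lift_Suc_mono_le[of f, OF _ that] f(2) by blast
  have "f i \<subseteq> f j \<or> f j \<subseteq> f i" for i j
    using nat_le_linear[of i j] mono by blast
  then have "subset.chain {I. ideal I A} (range f)"
    unfolding pred_on.chain_def using f(1) by blast
  then have "\<Union>(range f) \<in> range f"
    using noetherian_ring.ideal_chain_is_trivial[OF assms] by blast
  then obtain i where "\<Union>(range f) = f i"
    by auto
  then show False
    using f(2)[of i] by blast
qed

lemma nonartinian_kernel_nonzero:
  assumes "cring A" and "\<not> artinian_module A (ideal_module A K)"
  shows "\<not> K \<subseteq> {\<zero>\<^bsub>A\<^esub>}"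
proof
  assume K: "K \<subseteq> {\<zero>\<^bsub>A\<^esub>}"
  obtain N where N: "\<And>k :: nat. submodule (N k) A (ideal_module A K)" "\<And>k. N (Suc k) \<subset> N k"
    using assms(2) unfolding artinian_module_def by blast
  interpret N0: submodule "N 0" A "ideal_module A K" by (rule N)
  interpret N1: submodule "N 1" A "ideal_module A K" by (rule N)
  have "N 0 \<subseteq> {\<zero>\<^bsub>A\<^esub>}"
    using N0.subset K by (auto simp: ideal_module_def)
  moreover have "N 1 \<noteq> {}"
    using N1.one_closed by auto
  ultimately show False
    using N(2)[of 0] by auto
qed

lemma wf_nonartinian_quotient:
  "wf {(B :: 'a ring, A). cring A \<and> noetherian_ring A \<and> nonartinian_quotient A B}" (is "wf ?R")
proof (rule acc_wfI, rule allI)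
  have quotients: "B \<in> Wellfounded.acc ?R"
    if A: "cring A" "noetherian_ring A" and "ideal I A"
      and "cring B" "h \<in> ring_hom A B" "h ` carrier A = carrier B" "a_kernel A B h = I"
    for A B :: "'a ring" and h I
    using that(3-)
  proof (induction I arbitrary: B h rule: wf_induct_rule[OF wf_ideals[OF A(2)]])
    case (1 I)
    show ?case
    proof (rule accI)
      fix C
      assume "(C, B) \<in> ?R"
      then obtain g where C: "cring C" and g: "g \<in> ring_hom B C" "g ` carrier B = carrier C"
          "\<not> artinian_module B (ideal_module B (a_kernel B C g))"
        unfolding nonartinian_quotient_def by blast
      interpret A: cring A by fact
      interpret B: cring B by fact
      interpret C: cring C by fact
      interpret h: ring_hom_cring A B h
        by unfold_locales (rule "1.prems")
      interpret g: ring_hom_cring B C g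
        by unfold_locales (rule g)
      have gh: "g \<circ> h \<in> ring_hom A C"
        using "1.prems"(3) g(1) by (rule ring_hom_trans)
      interpret gh: ring_hom_ring A C "g \<circ> h"
        by (rule ring_hom_ringI2[OF A.ring_axioms C.ring_axioms gh])
      have "\<not> a_kernel B C g \<subseteq> {\<zero>\<^bsub>B\<^esub>}"
        using nonartinian_kernel_nonzero g(3) B.is_cring by blast
      then obtain b where b: "b \<in> carrier B" "g b = \<zero>\<^bsub>C\<^esub>" "b \<noteq> \<zero>\<^bsub>B\<^esub>"
        unfolding a_kernel_def' by blast
      then obtain a where a: "a \<in> carrier A" "b = h a"
        using "1.prems"(4) by blast
      have "a_kernel A B h \<subseteq> a_kernel A C (g \<circ> h)"
        unfolding a_kernel_def' using g.hom_zero by force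
      moreover have "a \<in> a_kernel A C (g \<circ> h)" "a \<notin> a_kernel A B h"
        unfolding a_kernel_def' using a b by force+
      ultimately have "a_kernel A B h \<subset> a_kernel A C (g \<circ> h)"
        by blast
      moreover have "(g \<circ> h) ` carrier A = carrier C"
        unfolding image_comp[symmetric] "1.prems"(4) g(2) ..
      moreover have "ideal (a_kernel A C (g \<circ> h)) A"
        by (rule gh.kernel_is_ideal)
      ultimately show "C \<in> Wellfounded.acc ?R"
        using "1.prems"(1,5) C gh
        by (intro "1.IH"[of "a_kernel A C (g \<circ> h)" C "g \<circ> h"]) blast+
    qed
  qed
  fix A :: "'a ring"
  show "A \<in> Wellfounded.acc ?R"
  proof (cases "cring A \<and> noetherian_ring A")
    case True
    then interpret A: cring A by blast
    interpret id: ring_hom_ring A A "\<lambda>x. x"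
      by (rule ring_hom_ringI2[OF A.ring_axioms A.ring_axioms]) (auto simp: ring_hom_def)
    show ?thesis
      using quotients[OF _ _ id.kernel_is_ideal _ id.homh] True by blast
  next
    case False
    show ?thesis
      by (rule accI) (use False in blast)
  qed
qed

function reduced_length :: "'a ring \<Rightarrow> 'o :: wellorder" where
  "reduced_length A =
     (if cring A \<and> noetherian_ring A
      then ordinal_sup ((\<lambda>B. ordinal_succ (reduced_length B)) ` {B. nonartinian_quotient A B})
      else undefined)"
  by auto
termination
  by (relation "{(B, A). cring A \<and> noetherian_ring A \<and> nonartinian_quotient A B}")
    (rule wf_nonartinian_quotient, simp)

declare reduced_length.simps [simp del]

end

theory Submission
  imports Defs "HOL-Computational_Algebra.Polynomial" "HOL-Computational_Algebra.Primes"
begin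

text \<open>
  The points of the space correspond to the ideals of \<open>T = \<int>[X\<^sub>0, \<dots>, X\<^sub>n\<^sub>-\<^sub>1]\<close>. Since \<open>T\<close> is
  noetherian, the ideals containing a given ideal \<open>I\<close> and avoiding a finite set disjoint from \<open>I\<close>
  form a basis of neighbourhoods of \<open>I\<close>. There is a largest ideal \<open>M\<close> above \<open>I\<close> with \<open>M/I\<close> finite,
  and avoiding representatives of the nonzero classes of \<open>M/I\<close> leaves only ideals \<open>J\<close> with \<open>J = I\<close> or
  \<open>J/I\<close> infinite; this bounds the rank of \<open>I\<close> by the reduced length of \<open>T/I\<close>. Conversely, let \<open>J/I\<close>
  be infinite. As \<open>T/I\<close> is residually finite, every finite set disjoint from \<open>I\<close> is avoided by some
  \<open>K\<close> of finite index above \<open>I\<close>, and \<open>J \<inter> K\<close> is a point near \<open>I\<close>, different from \<open>I\<close>, whose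
  reduced length is at least that of \<open>J\<close>. Residual finiteness also shows that an infinite ideal of \<open>T/I\<close>
  is not artinian; it rests on the fact that the residue fields of \<open>T\<close> are finite.
\<close>

section \<open>Ordinals and Cantor-Bendixson rank\<close>

text \<open>Noetherianity alone does not provide the ideals of finite index: the rationals form a
  noetherian ring without any nonzero finite quotient. So the arithmetic of T has to enter, through
  a Nullstellensatz phrased as inverting a given element in a nonzero finite quotient. In this form
  it passes from a ring S to S[x] for every x, algebraic or not, and it starts with the primes of
  the integers.

  Induction over quotient rings with changing carriers is avoided: an ideal of the fixed ring T
  stands for a marked ring, and its reduced length is recast as \<open>ideal_length\<close>. The
  rank is then recognised from the local behaviour of this function: some neighbourhood of a point
  has only smaller values elsewhere, while every smaller ordinal is reached or exceeded at another
  point of each neighbourhood.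

  Ordinals over an infinite type \<open>'o\<close> suffice because a countable noetherian ring has
  only countably many ideals, so that all suprema in question are taken over countable sets.\<close>

lemma ordinal_less_underS:
  fixes \<alpha> :: "'o ordinal"
  shows "\<exists>h. {\<beta>. \<beta> < \<alpha>} \<subseteq> h ` (UNIV :: 'o set)"
proof -
  define r where "r = rep_ordinal \<alpha>"
  have wr: "Well_order r"
    unfolding r_def by (metis Quotient3_ordinal Quotient3_rep_reflp ordIso_Well_order_simp)
  \<comment> \<open>An ordinal below \<alpha> is the type of a proper initial segment of
    \<open>r\<close>, and such a segment is determined by the element of \<open>'o\<close> that
    bounds it.\<close>
  have "\<beta> \<in> (\<lambda>a. abs_ordinal (Restr r (underS r a))) ` UNIV" if "\<beta> < \<alpha>" for \<beta>
  proof -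
    have less: "rep_ordinal \<beta> <o r"
      using that by (simp add: less_ordinal.rep_eq r_def)
    then have "Well_order (rep_ordinal \<beta>)"
      using ordLess_Well_order_simp by blast
    then obtain a where "rep_ordinal \<beta> =o Restr r (underS r a)"
      using ordLess_iff_ordIso_Restr[OF wr, of "rep_ordinal \<beta>"] less by auto
    then have "abs_ordinal (rep_ordinal \<beta>) = abs_ordinal (Restr r (underS r a))"
      by (rule Quotient3_rel_abs[OF Quotient3_ordinal])
    then have "abs_ordinal (Restr r (underS r a)) = \<beta>"
      unfolding Quotient3_abs_rep[OF Quotient3_ordinal] ..
    then show ?thesis by blast
  qed
  then show ?thesis by blast
qed

text \<open>Otherwise the well-order of all ordinals is represented by a relation \<open>W\<close> on \<open>'o\<close>. The
  type of its initial segment below \<open>\<alpha>\<close> is strictly monotone in \<open>\<alpha>\<close>, hence at least \<open>\<alpha>\<close>, and less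
  than the type of \<open>W\<close>; this is absurd for \<open>\<alpha>\<close> the type of \<open>W\<close>.\<close>

lemma ordinal_no_injection: "\<not> inj (g :: 'o ordinal \<Rightarrow> 'o)"
proof
  assume inj: "inj g"
  define W where "W = {(g x, g y) | x y. x \<le> y}"
  define S where "S = (\<lambda>\<alpha>. {(g x, g y) | x y. x \<le> y \<and> y < \<alpha>})"
  \<comment> \<open>Stated for arbitrary \<open>B\<close>, since \<open>W\<close> arises from all
    ordinals and \<open>S \<alpha>\<close> from those below \<alpha>.\<close>
  have wo: "Well_order {(g x, g y) | x y. x \<le> y \<and> x \<in> B \<and> y \<in> B}" (is "Well_order ?R") for B
  proof -
    have F: "Field ?R = g ` B"
      unfolding Field_def by auto
    have "wf (?R - Id)"
    proof (rule wf_subset)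
      show "wf (inv_image {(x, y). x < y} (inv_into UNIV g))"
        by (intro wf_inv_image wf)
      show "?R - Id \<subseteq> inv_image {(x, y). x < y} (inv_into UNIV g)"
        using inj by (auto simp: order_less_le)
    qed
    moreover have "refl_on (Field ?R) ?R"
      unfolding F refl_on_def by auto
    moreover have "trans ?R"
      using inj by (fastforce simp: trans_def inj_eq)
    moreover have "antisym ?R"
      using inj by (auto simp: antisym_def inj_eq)
    moreover have "total_on (Field ?R) ?R"
      unfolding F total_on_def
    proof (intro ballI impI)
      fix u v assume "u \<in> g ` B" "v \<in> g ` B"
      then obtain x y where "u = g x" "v = g y" "x \<in> B" "y \<in> B" by blast
      then show "(u, v) \<in> ?R \<or> (v, u) \<in> ?R"
        using linear[of x y] by blast
    qed
    ultimately show ?thesis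
      unfolding well_order_on_def linear_order_on_def partial_order_on_def preorder_on_def
      by (auto simp: Field_def)
  qed
  have woW: "Well_order W" and woS: "\<And>\<alpha>. Well_order (S \<alpha>)"
  proof -
    show "Well_order W"
      using wo[of UNIV] by (simp add: W_def)
    fix \<alpha>
    have "S \<alpha> = {(g x, g y) | x y. x \<le> y \<and> x \<in> {..<\<alpha>} \<and> y \<in> {..<\<alpha>}}"
      unfolding S_def by (auto intro: order_le_less_trans)
    then show "Well_order (S \<alpha>)"
      using wo[of "{..<\<alpha>}"] by (simp only:)
  qed
  have FW: "Field W = range g" and FS: "\<And>\<alpha>. Field (S \<alpha>) = g ` {..<\<alpha>}"
    unfolding W_def S_def Field_def by auto
  have SW: "S \<alpha> <o W" for \<alpha>
  proof -
    have "underS W (g \<alpha>) = g ` {..<\<alpha>}"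
      using inj unfolding underS_def W_def by (auto simp: inj_eq order_less_le)
    then have "Restr W (underS W (g \<alpha>)) = S \<alpha>"
      using inj unfolding W_def S_def by (auto simp: inj_eq intro: order_le_less_trans)
    then show ?thesis
      using underS_Restr_ordLess[OF woW, of "g \<alpha>"] FW by auto
  qed
  have SS: "S \<alpha> <o S \<beta>" if "\<alpha> < \<beta>" for \<alpha> \<beta>
  proof -
    have "underS (S \<beta>) (g \<alpha>) = g ` {..<\<alpha>}"
      using inj that unfolding underS_def S_def by (auto simp: inj_eq order_less_le)
    then have "Restr (S \<beta>) (underS (S \<beta>) (g \<alpha>)) = S \<alpha>"
      using inj that unfolding S_def by (auto simp: inj_eq intro: order_le_less_trans less_trans)
    then show ?thesis
      using underS_Restr_ordLess[OF woS, of \<beta> "g \<alpha>"] FS that by auto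
  qed
  have abs_less: "abs_ordinal r < abs_ordinal s" if "r <o s" for r s :: "'o rel"
  proof -
    have "r =o r" "s =o s"
      using ordLess_Well_order_simp[OF that] ordIso_reflexive by blast+
    then have "rep_ordinal (abs_ordinal r) =o r" "rep_ordinal (abs_ordinal s) =o s"
      using rep_abs_rsp_left[OF Quotient3_ordinal] by blast+
    then show ?thesis
      using that unfolding less_ordinal.rep_eq
      by (meson ordIso_ordLess_trans ordIso_symmetric ordLess_ordIso_trans)
  qed
  have le: "\<alpha> \<le> abs_ordinal (S \<alpha>)" for \<alpha>
  proof (induction \<alpha> rule: less_induct)
    case (less \<alpha>)
    show ?case
    proof (rule ccontr)
      assume "\<not> ?case"
      then have "abs_ordinal (S \<alpha>) < \<alpha>" by simp
      with less[OF this] abs_less[OF SS[OF this]] show False by simp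
    qed
  qed
  show False
    using leD[OF le] abs_less[OF SW] by (rule notE)
qed

text \<open>If \<open>S\<close> were cofinal, all ordinals would be enumerated by pairs of an index
  of a member of \<open>S\<close> and a position at or below that member. There are no more such
  pairs than elements of the infinite type \<open>'o\<close>, against
  \<open>ordinal_no_injection\<close>. The bound is what makes the \<open>LEAST\<close> in
  \<open>ordinal_succ\<close> and \<open>ordinal_sup\<close> meaningful.\<close>

lemma countable_ordinals_bounded:
  fixes S :: "'o :: infinite ordinal set"
  assumes "countable S"
  shows "\<exists>\<beta>. \<forall>\<alpha>\<in>S. \<alpha> < \<beta>"
proof (rule ccontr)
  assume "\<not> ?thesis"
  then have cofinal: "\<exists>\<alpha>\<in>S. \<beta> \<le> \<alpha>" for \<beta>
    by (meson not_le)
  have "\<exists>h. \<forall>\<alpha> :: 'o ordinal. {\<beta>. \<beta> < \<alpha>} \<subseteq> h \<alpha> ` (UNIV :: 'o set)"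
    using ordinal_less_underS by metis
  then obtain h where h: "\<And>\<alpha> :: 'o ordinal. {\<beta>. \<beta> < \<alpha>} \<subseteq> h \<alpha> ` (UNIV :: 'o set)"
    by blast
  have "S \<noteq> {}"
    using cofinal by blast
  \<comment> \<open>\<open>None\<close> codes the member of \<open>S\<close> itself,
    \<open>Some y\<close> the ordinals strictly below it.\<close>
  define k where "k = (\<lambda>(i :: nat, x). case x of None \<Rightarrow> from_nat_into S i | Some y \<Rightarrow> h (from_nat_into S i) y)"
  have "\<beta> \<in> range k" for \<beta>
  proof -
    obtain \<alpha> where \<alpha>: "\<alpha> \<in> S" "\<beta> \<le> \<alpha>"
      using cofinal by blast
    then obtain i where i: "from_nat_into S i = \<alpha>"
      using from_nat_into_surj[OF assms] by blast
    show ?thesis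
    proof (cases "\<beta> = \<alpha>")
      case True
      then have "\<beta> = k (i, None)"
        using i by (simp add: k_def)
      then show ?thesis by blast
    next
      case False
      then obtain y where "\<beta> = h \<alpha> y"
        using h[of \<alpha>] \<alpha>(2) by force
      then have "\<beta> = k (i, Some y)"
        using i by (simp add: k_def)
      then show ?thesis by blast
    qed
  qed
  then have inj_k: "inj (inv_into UNIV k)"
    by (metis surj_imp_inj_inv surj_def image_iff)
  have inf: "infinite (UNIV :: 'o set)"
    by (rule infinite_UNIV)
  have "|UNIV :: (nat \<times> 'o option) set| \<le>o |UNIV :: 'o set|"
  proof -
    have opt: "|UNIV :: 'o option set| \<le>o |UNIV :: 'o set|"
    proof -
      have "|insert None (range (Some :: 'o \<Rightarrow> 'o option))| \<le>o |UNIV :: 'o set|"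
      proof (rule ordIso_ordLeq_trans)
        show "|insert None (range (Some :: 'o \<Rightarrow> 'o option))| =o |range (Some :: 'o \<Rightarrow> 'o option)|"
      proof (rule infinite_card_of_insert)
          show "infinite (range (Some :: 'o \<Rightarrow> 'o option))"
            using inf by (simp add: finite_image_iff)
        qed
        show "|range (Some :: 'o \<Rightarrow> 'o option)| \<le>o |UNIV :: 'o set|"
          by (rule card_of_image)
      qed
      then show ?thesis
        by (simp only: UNIV_option_conv)
    qed
    have nat: "|UNIV :: nat set| \<le>o |UNIV :: 'o set|"
      using inf by (simp add: infinite_iff_card_of_nat)
    show ?thesis
      using card_of_Times_ordLeq_infinite[OF inf nat opt] by simp
  qed
  then obtain f :: "nat \<times> 'o option \<Rightarrow> 'o" where "inj f"
    using card_of_ordLeq[of "UNIV :: (nat \<times> 'o option) set" "UNIV :: 'o set"] by blast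
  then have "inj (f \<circ> inv_into UNIV k)"
    using inj_k by (rule inj_compose)
  then show False
    using ordinal_no_injection[of "f \<circ> inv_into UNIV k"] by simp
qed

section \<open>Successors and suprema of ordinals\<close>

lemma less_ordinal_succ: "\<alpha> < ordinal_succ (\<alpha> :: 'o :: infinite ordinal)"
  unfolding ordinal_succ_def using countable_ordinals_bounded[of "{\<alpha>}"]
  by (metis LeastI countable_empty countable_insert insertI1)

lemma ordinal_succ_le: "\<alpha> < \<beta> \<Longrightarrow> ordinal_succ \<alpha> \<le> (\<beta> :: 'o :: wellorder)"
  unfolding ordinal_succ_def by (rule Least_le)

lemma less_ordinal_succ_iff: "\<alpha> < ordinal_succ \<beta> \<longleftrightarrow> \<alpha> \<le> (\<beta> :: 'o :: infinite ordinal)"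
  by (meson leD leI less_ordinal_succ order_le_less_trans ordinal_succ_le)

lemma ordinal_sup_upper:
  "countable S \<Longrightarrow> \<alpha> \<in> S \<Longrightarrow> \<alpha> \<le> ordinal_sup (S :: 'o :: infinite ordinal set)"
  unfolding ordinal_sup_def
  by (rule LeastI2_ex) (use countable_ordinals_bounded[of S] less_imp_le in blast)+

lemma ordinal_sup_least: "(\<And>\<alpha>. \<alpha> \<in> S \<Longrightarrow> \<alpha> \<le> \<beta>) \<Longrightarrow> ordinal_sup S \<le> (\<beta> :: 'o :: wellorder)"
  unfolding ordinal_sup_def by (rule Least_le) blast

lemma less_ordinal_supD: "\<beta> < ordinal_sup S \<Longrightarrow> \<exists>\<alpha>\<in>S. \<beta> < (\<alpha> :: 'o :: wellorder)"
  by (meson leI leD ordinal_sup_least)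

section \<open>Recognising the Cantor-Bendixson rank from a function on the points\<close>

text \<open>By induction, the points left at stage \<alpha> are those with
  \<open>\<rho> x \<ge> \<alpha>\<close>. Among them \<open>upper\<close> isolates the points of
  value \<alpha>, while \<open>lower\<close> makes every point of larger value a limit of other
  remaining points.\<close>

lemma cb_level_eq:
  fixes T :: "'x topology" and \<rho> :: "'x \<Rightarrow> 'o :: wellorder"
  assumes upper: "\<And>x. x \<in> topspace T \<Longrightarrow>
      \<exists>U. openin T U \<and> x \<in> U \<and> (\<forall>y\<in>U. y \<noteq> x \<longrightarrow> \<rho> y < \<rho> x)"
    and lower: "\<And>x U \<alpha>. openin T U \<Longrightarrow> x \<in> U \<Longrightarrow> \<alpha> < \<rho> x \<Longrightarrow> \<exists>y\<in>U. y \<noteq> x \<and> \<alpha> \<le> \<rho> y"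
  shows "cb_level T \<alpha> = {x \<in> topspace T. \<rho> x = \<alpha>}"
proof (induction \<alpha> rule: less_induct)
  case (less \<alpha>)
  have rest: "topspace T - (\<Union>\<beta>\<in>{..<\<alpha>}. cb_level T \<beta>) = {x \<in> topspace T. \<alpha> \<le> \<rho> x}"
    using less.IH by auto
  have "openin (subtopology T {x \<in> topspace T. \<alpha> \<le> \<rho> x}) {x} \<longleftrightarrow> \<rho> x = \<alpha>"
    if x: "x \<in> topspace T" "\<alpha> \<le> \<rho> x" for x
  proof
    assume "openin (subtopology T {x \<in> topspace T. \<alpha> \<le> \<rho> x}) {x}"
    then obtain U where U: "openin T U" "{x} = U \<inter> {x \<in> topspace T. \<alpha> \<le> \<rho> x}"
      unfolding openin_subtopology by blast
    show "\<rho> x = \<alpha>"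
    proof (rule ccontr)
      assume "\<rho> x \<noteq> \<alpha>"
      then have "\<alpha> < \<rho> x"
        using x by simp
      then obtain y where "y \<in> U" "y \<noteq> x" "\<alpha> \<le> \<rho> y"
        using lower[of U x \<alpha>] U by blast
      moreover from this have "y \<in> topspace T"
        using openin_subset[OF U(1)] by auto
      ultimately have "y \<in> {x}"
        unfolding U(2) by auto
      then show False
        using \<open>y \<noteq> x\<close> by simp
    qed
  next
    assume "\<rho> x = \<alpha>"
    then obtain U where "openin T U" "x \<in> U" "\<forall>y\<in>U. y \<noteq> x \<longrightarrow> \<rho> y < \<alpha>"
      using upper[OF x(1)] by blast
    then have "{x} = U \<inter> {x \<in> topspace T. \<alpha> \<le> \<rho> x}"
      using x by force
    then show "openin (subtopology T {x \<in> topspace T. \<alpha> \<le> \<rho> x}) {x}"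
      unfolding openin_subtopology using \<open>openin T U\<close> by blast
  qed
  moreover have "cb_level T \<alpha> = {x \<in> topspace T \<inter> {x \<in> topspace T. \<alpha> \<le> \<rho> x}.
      openin (subtopology T {x \<in> topspace T. \<alpha> \<le> \<rho> x}) {x}}"
    by (subst cb_level.simps) (simp only: rest isolated_points_def topspace_subtopology)
  ultimately show ?case
    by (auto simp only: mem_Collect_eq Int_iff)
qed

lemma cb_rank_eq:
  fixes T :: "'x topology" and \<rho> :: "'x \<Rightarrow> 'o :: wellorder"
  assumes "\<And>x. x \<in> topspace T \<Longrightarrow>
      \<exists>U. openin T U \<and> x \<in> U \<and> (\<forall>y\<in>U. y \<noteq> x \<longrightarrow> \<rho> y < \<rho> x)"
    and "\<And>x U \<alpha>. openin T U \<Longrightarrow> x \<in> U \<Longrightarrow> \<alpha> < \<rho> x \<Longrightarrow> \<exists>y\<in>U. y \<noteq> x \<and> \<alpha> \<le> \<rho> y"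
    and "x \<in> topspace T"
  shows "cb_rank T x = Some (\<rho> x)"
proof -
  have "x \<in> cb_level T \<alpha> \<longleftrightarrow> \<rho> x = \<alpha>" for \<alpha>
    using cb_level_eq[OF assms(1,2)] assms(3) by simp
  then show ?thesis
    unfolding cb_rank_def by simp
qed

section \<open>Subrings and ideals\<close>

abbreviation pcoeff :: "'r::comm_ring_1 poly \<Rightarrow> nat \<Rightarrow> 'r" where "pcoeff \<equiv> Polynomial.coeff"
abbreviation pmonom :: "'r::comm_ring_1 \<Rightarrow> nat \<Rightarrow> 'r poly" where "pmonom \<equiv> Polynomial.monom"

text \<open>Rings are subsets of one type, so that polynomials over \<open>S\<close> are ordinary
  polynomials with restricted coefficients and adjoining an element stays inside the type. This
  permits induction on the number of variables.\<close>

locale subring_set =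
  fixes S :: "'r::comm_ring_1 set"
  assumes one_in [simp, intro]: "1 \<in> S"
    and diff_in [simp, intro]: "a \<in> S \<Longrightarrow> b \<in> S \<Longrightarrow> a - b \<in> S"
    and mult_in [simp, intro]: "a \<in> S \<Longrightarrow> b \<in> S \<Longrightarrow> a * b \<in> S"
begin

lemma zero_in [simp, intro]: "0 \<in> S"
  using diff_in[OF one_in one_in] by simp

lemma uminus_in [simp, intro]: "a \<in> S \<Longrightarrow> - a \<in> S"
  using diff_in[OF zero_in] by fastforce

lemma add_in [simp, intro]: "a \<in> S \<Longrightarrow> b \<in> S \<Longrightarrow> a + b \<in> S"
  using diff_in[of a "- b"] by simp

lemma power_in [simp, intro]: "a \<in> S \<Longrightarrow> a ^ k \<in> S"
  by (induction k) auto

lemma sum_in [intro]: "(\<And>i. i \<in> B \<Longrightarrow> f i \<in> S) \<Longrightarrow> sum f B \<in> S"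
  by (induction B rule: infinite_finite_induct) auto

lemma of_nat_in [simp, intro]: "of_nat k \<in> S"
  by (induction k) auto

lemma of_int_in [simp, intro]: "of_int k \<in> S"
  by (cases k) auto

end

text \<open>The whole of \<open>S\<close> counts as an ideal; it corresponds to the zero ring, which
  is a point of the space.\<close>

locale ideal_set = subring_set S for S :: "'r::comm_ring_1 set" +
  fixes I :: "'r set"
  assumes subset: "I \<subseteq> S"
    and zero_mem [simp, intro]: "0 \<in> I"
    and add_mem [intro]: "a \<in> I \<Longrightarrow> b \<in> I \<Longrightarrow> a + b \<in> I"
    and mult_mem [intro]: "s \<in> S \<Longrightarrow> a \<in> I \<Longrightarrow> s * a \<in> I"
begin

lemma mult_mem' [intro]: "s \<in> S \<Longrightarrow> a \<in> I \<Longrightarrow> a * s \<in> I"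
  using mult_mem[of s a] by (simp add: mult.commute)

lemma uminus_mem [intro]: "a \<in> I \<Longrightarrow> - a \<in> I"
  using mult_mem[of "- 1" a] by auto

lemma diff_mem [intro]: "a \<in> I \<Longrightarrow> b \<in> I \<Longrightarrow> a - b \<in> I"
  using add_mem[of a "- b"] by auto

lemma sum_mem [intro]: "(\<And>i. i \<in> B \<Longrightarrow> f i \<in> I) \<Longrightarrow> sum f B \<in> I"
  by (induction B rule: infinite_finite_induct) auto

lemma in_carrier [dest]: "a \<in> I \<Longrightarrow> a \<in> S"
  using subset by blast

lemma diff_mem_commute: "a - b \<in> I \<longleftrightarrow> b - a \<in> I"
  using uminus_mem[of "a - b"] uminus_mem[of "b - a"] by auto

lemma mem_cong: "a - b \<in> I \<Longrightarrow> a \<in> I \<longleftrightarrow> b \<in> I"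
  using diff_mem[of a "a - b"] add_mem[of "a - b" b] by auto

end

locale prime_set = ideal_set S I for S I :: "'r::comm_ring_1 set" +
  assumes one_not_mem: "1 \<notin> I"
    and prime_mem: "a \<in> S \<Longrightarrow> b \<in> S \<Longrightarrow> a * b \<in> I \<Longrightarrow> a \<in> I \<or> b \<in> I"
begin

lemma power_mem: "a \<in> S \<Longrightarrow> a ^ k \<in> I \<Longrightarrow> a \<in> I"
  by (induction k) (use one_not_mem prime_mem in auto)

end

section \<open>Polynomials over a subring and adjunction of an element\<close>

definition polys_over :: "'r::comm_ring_1 set \<Rightarrow> 'r poly set"
  where "polys_over S = {p. \<forall>i. pcoeff p i \<in> S}"

definition adjoin :: "'r::comm_ring_1 set \<Rightarrow> 'r \<Rightarrow> 'r set"
  where "adjoin S x = (\<lambda>p. poly p x) ` polys_over S"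

text \<open>A strict degree bound that the zero polynomial satisfies for every \<open>n\<close>.
  Arguments that strip off a top coefficient thus need no case distinction when the degree drops
  further.\<close>

abbreviation poly_below :: "nat \<Rightarrow> 'r::comm_ring_1 poly \<Rightarrow> bool"
  where "poly_below n p \<equiv> \<forall>i\<ge>n. pcoeff p i = 0"

lemma ex_poly_below: "\<exists>n. poly_below n p"
  by (meson coeff_eq_0 less_eq_Suc_le)

lemma poly_below_0: "poly_below 0 p \<Longrightarrow> p = 0"
  by (simp add: poly_eq_iff)

lemma pcoeff_monom_mult: "pcoeff (pmonom c k * p) i = (if k \<le> i then c * pcoeff p (i - k) else 0)"
  by (simp add: coeff_monom_mult)

lemma (in subring_set) polys_over_subring: "subring_set (polys_over S)"
  by unfold_locales (auto simp: polys_over_def coeff_mult coeff_1)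

lemma (in subring_set) polys_overI [intro]:
  "a \<in> S \<Longrightarrow> pmonom a k \<in> polys_over S"
  "a \<in> S \<Longrightarrow> [:a:] \<in> polys_over S"
  by (auto simp: polys_over_def coeff_pCons split: nat.split)

lemma (in ideal_set) polys_over_ideal: "ideal_set (polys_over S) (polys_over I)"
proof -
  interpret p: subring_set "polys_over S" by (rule polys_over_subring)
  show ?thesis
    by unfold_locales (use subset in \<open>auto simp: polys_over_def coeff_mult\<close>)
qed

lemma (in subring_set) adjoin_subring: "subring_set (adjoin S x)"
proof -
  interpret p: subring_set "polys_over S" by (rule polys_over_subring)
  show ?thesis
  proof
    show "1 \<in> adjoin S x"
      unfolding adjoin_def by (rule image_eqI[of _ _ 1]) auto
    fix a b assume "a \<in> adjoin S x" "b \<in> adjoin S x"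
    then obtain p q where *: "a = poly p x" "b = poly q x" "p \<in> polys_over S" "q \<in> polys_over S"
      unfolding adjoin_def by blast
    show "a - b \<in> adjoin S x"
      unfolding adjoin_def by (rule image_eqI[of _ _ "p - q"]) (use * in auto)
    show "a * b \<in> adjoin S x"
      unfolding adjoin_def by (rule image_eqI[of _ _ "p * q"]) (use * in auto)
  qed
qed

lemma (in subring_set) subset_adjoin: "S \<subseteq> adjoin S x" "x \<in> adjoin S x"
proof -
  show "S \<subseteq> adjoin S x"
  proof
    fix a assume "a \<in> S"
    then show "a \<in> adjoin S x"
      unfolding adjoin_def by (intro image_eqI[of _ _ "[:a:]"]) auto
  qed
  show "x \<in> adjoin S x"
    unfolding adjoin_def by (intro image_eqI[of _ _ "pmonom 1 1"]) (auto simp: poly_monom)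
qed

section \<open>Hilbert's basis theorem\<close>

definition noetherian_set :: "'r::comm_ring_1 set \<Rightarrow> bool"
  where "noetherian_set S \<longleftrightarrow> wf {(J, I). ideal_set S I \<and> ideal_set S J \<and> I \<subset> J}"

lemma noetherian_set_stable:
  assumes "noetherian_set S" and "\<And>k :: nat. ideal_set S (I k)" and "\<And>k. I k \<subseteq> I (Suc k)"
  shows "\<exists>N. \<forall>k\<ge>N. I k = I N"
proof (rule ccontr)
  assume "\<not> ?thesis"
  then have "\<forall>N. \<exists>k\<ge>N. I k \<noteq> I N" by blast
  then obtain g where g: "\<And>N. g N \<ge> N" "\<And>N. I (g N) \<noteq> I N" by metis
  have mono: "I j \<subseteq> I k" if "j \<le> k" for j k
    using lift_Suc_mono_le[of I, OF assms(3) that] .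
  \<comment> \<open>Iterating \<open>g\<close> extracts a strictly increasing subsequence.\<close>
  have "I ((g ^^ k) 0) \<subset> I ((g ^^ Suc k) 0)" for k
    using g[of "(g ^^ k) 0"] mono[of "(g ^^ k) 0" "g ((g ^^ k) 0)"] by auto
  then show False
    using assms(1,2) unfolding noetherian_set_def wf_iff_no_infinite_down_chain
    by (elim notE) (intro exI[of _ "\<lambda>k. I ((g ^^ k) 0)"], blast)
qed

text \<open>The usual argument with the ideals \<open>L i d\<close> of leading coefficients in degree \<open>d\<close> of the
  \<open>i\<close>th ideal works although an element of \<open>S[x]\<close> need not determine a polynomial.\<close>

lemma (in subring_set) noetherian_adjoin:
  assumes noeth: "noetherian_set S"
  shows "noetherian_set (adjoin S x)"
  unfolding noetherian_set_def wf_iff_no_infinite_down_chain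
proof
  assume "\<exists>f. \<forall>i. (f (Suc i), f i) \<in> {(J, I). ideal_set (adjoin S x) I \<and> ideal_set (adjoin S x) J \<and> I \<subset> J}"
  then obtain f where f: "\<And>i. ideal_set (adjoin S x) (f i)" "\<And>i. f i \<subset> f (Suc i)" by blast
  interpret p: subring_set "polys_over S" by (rule polys_over_subring)
  \<comment> \<open>Degree at most \<open>d\<close> rather than exactly \<open>d\<close>: only then
    does 0 belong to \<open>L i d\<close>, as an ideal requires.\<close>
  define L where "L i d = {pcoeff p d | p. p \<in> polys_over S \<and> poly_below (Suc d) p \<and> poly p x \<in> f i}" for i d
  have in_S: "pcoeff p i \<in> S" if "p \<in> polys_over S" for p i
    using that by (simp add: polys_over_def)
  have L_ideal: "ideal_set S (L i d)" for i d
  proof -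
    interpret T: ideal_set "adjoin S x" "f i" by (rule f(1))
    show ?thesis
    proof
      show "L i d \<subseteq> S" by (auto simp: L_def in_S)
      show "0 \<in> L i d" unfolding L_def by (intro CollectI exI[of _ 0]) auto
      fix a b assume "a \<in> L i d" "b \<in> L i d"
      then obtain p q where "a = pcoeff p d" "b = pcoeff q d" "p \<in> polys_over S" "q \<in> polys_over S"
         "poly_below (Suc d) p" "poly_below (Suc d) q" "poly p x \<in> f i" "poly q x \<in> f i"
        unfolding L_def by auto
      then show "a + b \<in> L i d"
        unfolding L_def by (intro CollectI exI[of _ "p + q"]) auto
    next
      fix s a assume s: "s \<in> S" and "a \<in> L i d"
      then obtain p where p: "a = pcoeff p d" "p \<in> polys_over S" "poly_below (Suc d) p" "poly p x \<in> f i"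
        unfolding L_def by auto
      have "s * poly p x \<in> f i"
        using s subset_adjoin p by blast
      then show "s * a \<in> L i d"
        unfolding L_def using p s by (intro CollectI exI[of _ "[:s:] * p"]) (auto simp: polys_over_def)
    qed
  qed
  have fmono: "f i \<subseteq> f j" if "i \<le> j" for i j
    using lift_Suc_mono_le[of f, OF _ that] f(2) by blast
  have Lmono1: "L i d \<subseteq> L j d" if "i \<le> j" for i j d
    using fmono[OF that] unfolding L_def by blast
  have "L i d \<subseteq> L i (Suc d)" for i d
  proof
    interpret T: ideal_set "adjoin S x" "f i" by (rule f(1))
    fix a assume "a \<in> L i d"
    then obtain p where p: "a = pcoeff p d" "p \<in> polys_over S" "poly_below (Suc d) p" "poly p x \<in> f i"
      unfolding L_def by auto
    moreover have "x * poly p x \<in> f i"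
      using subset_adjoin p by blast
    moreover have "pCons 0 p \<in> polys_over S"
      using p(2) unfolding polys_over_def by (auto simp: coeff_pCons split: nat.split)
    moreover have "poly_below (Suc (Suc d)) (pCons 0 p)"
      using p(3) by (auto simp: coeff_pCons split: nat.split)
    ultimately show "a \<in> L i (Suc d)"
      unfolding L_def by (intro CollectI exI[of _ "pCons 0 p"]) auto
  qed
  then have Lmono2: "L i d \<subseteq> L i e" if "d \<le> e" for i d e
    using lift_Suc_mono_le[of "L i", OF _ that] by blast
  \<comment> \<open>Once the diagonal \<open>L k k\<close> is constant, all entries with both
    indices at least \<open>N\<close> agree. Only the finitely many degrees below \<open>N\<close>
    remain, and each of them stabilises on its own at stage \<open>m d\<close>.\<close>
  obtain N where N: "\<And>k. k \<ge> N \<Longrightarrow> L k k = L N N"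
    using noetherian_set_stable[OF noeth, of "\<lambda>k. L k k"] L_ideal Lmono1 Lmono2
    by (metis (no_types, lifting) le_add2 plus_1_eq_Suc subset_trans)
  have "\<forall>d. \<exists>M. \<forall>k\<ge>M. L k d = L M d"
    using noetherian_set_stable[OF noeth, of "\<lambda>k. L k d" for d] L_ideal Lmono1 by simp
  then obtain m where m: "\<And>d k. k \<ge> m d \<Longrightarrow> L k d = L (m d) d" by metis
  define M where "M = Max (insert N (m ` {..<N}))"
  have "M \<ge> N" and mM: "\<And>d. d < N \<Longrightarrow> m d \<le> M"
    unfolding M_def by auto
  have stable: "L (Suc M) d \<subseteq> L M d" for d
  proof (cases "d < N")
    case True
    then show ?thesis using m[of d M] m[of d "Suc M"] mM[of d] by auto
  next
    case False
    let ?k = "max (Suc M) d"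
    have "L (Suc M) d \<subseteq> L ?k ?k"
      using Lmono1[of "Suc M" ?k d] Lmono2[of d ?k ?k] by auto
    also have "\<dots> = L N N" using N[of ?k] False by auto
    also have "\<dots> \<subseteq> L M d" using Lmono1[OF \<open>M \<ge> N\<close>, of N] Lmono2[of N d M] False by auto
    finally show ?thesis .
  qed
  interpret T: ideal_set "adjoin S x" "f M" by (rule f(1))
  interpret T': ideal_set "adjoin S x" "f (Suc M)" by (rule f(1))
  have "poly p x \<in> f M" if "p \<in> polys_over S" "poly_below n p" "poly p x \<in> f (Suc M)" for n p
    using that
  proof (induction n arbitrary: p)
    case 0
    then show ?case using poly_below_0[of p] by simp
  next
    case (Suc n)
    then have "pcoeff p n \<in> L M n"
      using stable[of n] unfolding L_def by blast
    then obtain q where q: "pcoeff q n = pcoeff p n" "q \<in> polys_over S" "poly_below (Suc n) q" "poly q x \<in> f M"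
      unfolding L_def by auto
    have "poly_below n (p - q)"
    proof (intro allI impI)
      fix i assume "n \<le> i"
      show "pcoeff (p - q) i = 0"
        using q(1,3) Suc.prems(2) \<open>n \<le> i\<close> by (cases "i = n") auto
    qed
    moreover have "poly (p - q) x \<in> f (Suc M)"
      using q(4) Suc.prems(3) f(2)[of M] by auto
    ultimately have "poly (p - q) x \<in> f M"
      using Suc.IH[of "p - q"] Suc.prems(1) q(2) by blast
    then have "poly (p - q) x + poly q x \<in> f M"
      using q(4) by blast
    then show ?case by simp
  qed
  then have "f (Suc M) \<subseteq> f M"
    using T'.subset ex_poly_below unfolding adjoin_def by blast
  then show False using f(2)[of M] by blast
qed

section \<open>Finite quotients\<close>

text \<open>For ideals this says that J/(J \<inter> I) is finite. Leaving out the condition that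
  \<open>I\<close> lies in \<open>J\<close> gives monotonicity in both arguments without side
  conditions.\<close>

definition finite_mod :: "'r::ab_group_add set \<Rightarrow> 'r set \<Rightarrow> bool"
  where "finite_mod J I \<longleftrightarrow> (\<exists>F. finite F \<and> (\<forall>s\<in>J. \<exists>f\<in>F. s - f \<in> I))"

lemma finite_mod_mono: "finite_mod J I \<Longrightarrow> J' \<subseteq> J \<Longrightarrow> I \<subseteq> I' \<Longrightarrow> finite_mod J' I'"
  unfolding finite_mod_def by (meson subsetD)

lemma finite_mod_trans:
  assumes "finite_mod L J" and "finite_mod J I"
  shows "finite_mod L I"
proof -
  obtain F G where F: "finite F" "\<And>s. s \<in> L \<Longrightarrow> \<exists>f\<in>F. s - f \<in> J"
      and G: "finite G" "\<And>s. s \<in> J \<Longrightarrow> \<exists>f\<in>G. s - f \<in> I"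
    using assms unfolding finite_mod_def by metis
  have "\<exists>h\<in>(\<lambda>(f, g). f + g) ` (F \<times> G). s - h \<in> I" if s: "s \<in> L" for s
  proof -
    obtain f g where "f \<in> F" "g \<in> G" "s - f - g \<in> I"
      using F(2)[OF s] G(2) by metis
    then show ?thesis
      by (intro bexI[of _ "f + g"]) (auto simp: algebra_simps)
  qed
  then show ?thesis
    unfolding finite_mod_def using F(1) G(1)
    by (intro exI[of _ "(\<lambda>(f, g). f + g) ` (F \<times> G)"]) auto
qed

text \<open>The representatives in the definition of \<open>finite_mod\<close> may lie outside of \<open>J\<close>;
  they can be moved into \<open>J\<close>.\<close>

lemma finite_mod_representatives:
  fixes J :: "'r::ab_group_add set"
  assumes "finite_mod J I" and diff: "\<And>a b. a \<in> I \<Longrightarrow> b \<in> I \<Longrightarrow> a - b \<in> I"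
  shows "\<exists>F\<subseteq>J. finite F \<and> (\<forall>s\<in>J. \<exists>f\<in>F. s - f \<in> I)"
proof -
  obtain F where F: "finite F" "\<And>s. s \<in> J \<Longrightarrow> \<exists>f\<in>F. s - f \<in> I"
    using assms(1) unfolding finite_mod_def by blast
  define G where "G = {f \<in> F. \<exists>s\<in>J. s - f \<in> I}"
  then have "\<forall>f\<in>G. \<exists>y. y \<in> J \<and> y - f \<in> I"
    by blast
  then obtain h where h: "\<And>f. f \<in> G \<Longrightarrow> h f \<in> J \<and> h f - f \<in> I"
    using bchoice[of G "\<lambda>f y. y \<in> J \<and> y - f \<in> I"] by blast
  have "\<exists>g\<in>h ` G. s - g \<in> I" if s: "s \<in> J" for s
  proof -
    obtain f where f: "f \<in> F" "s - f \<in> I"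
      using F(2)[OF s] by blast
    then have "f \<in> G"
      using s G_def by blast
    then show ?thesis
      using diff[OF f(2), of "h f - f"] h[of f] by auto
  qed
  moreover have "finite (h ` G)" "h ` G \<subseteq> J"
    using F(1) h by (auto simp: G_def)
  ultimately show ?thesis
    by blast
qed

section \<open>The general Nullstellensatz\<close>

text \<open>A combination of the Jacobson property with finiteness of residue fields, in the style
  of Rabinowitsch: \<open>t\<close> becomes a unit in a nonzero finite quotient of S/P. As
  \<open>Q\<close> is not asked to be maximal, no field has to be constructed in the step from
  \<open>S\<close> to S[x].\<close>

definition jacobson_set :: "'r::comm_ring_1 set \<Rightarrow> bool"
  where "jacobson_set S \<longleftrightarrow> (\<forall>P t. prime_set S P \<longrightarrow> t \<in> S \<longrightarrow> t \<notin> P \<longrightarrow>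
    (\<exists>Q. \<exists>u\<in>S. ideal_set S Q \<and> P \<subseteq> Q \<and> finite_mod S Q \<and> 1 \<notin> Q \<and> t * u - 1 \<in> Q))"

text \<open>The leading coefficient of \<open>h\<close> is no unit, so \<open>p\<close> is
  multiplied by a power of it. The degree bound on the quotient \<open>q\<close> matters later,
  where \<open>q\<close> itself is recognised as a relation of too small degree.\<close>

lemma (in subring_set) pseudo_division:
  assumes h: "h \<in> polys_over S" "poly_below (Suc e) h"
    and p: "p \<in> polys_over S" "poly_below n p"
  shows "\<exists>N. \<exists>q\<in>polys_over S. \<exists>r\<in>polys_over S.
    [:pcoeff h e:] ^ N * p = q * h + r \<and> (\<forall>i. n \<le> i + e \<longrightarrow> pcoeff q i = 0) \<and> poly_below e r"
  using p
proof (induction n arbitrary: p)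
  interpret p: subring_set "polys_over S" by (rule polys_over_subring)
  case 0
  then have "p = 0" using poly_below_0 by blast
  then show ?case
    by (intro exI[of _ 0] bexI[of _ 0]) auto
next
  interpret p: subring_set "polys_over S" by (rule polys_over_subring)
  case (Suc n)
  have hS: "pcoeff h i \<in> S" "pcoeff p i \<in> S" for i
    using h(1) Suc.prems(1) by (auto simp: polys_over_def)
  show ?case
  proof (cases "n < e")
    case True
    then show ?thesis
      using Suc.prems by (intro exI[of _ 0] bexI[of _ 0] bexI[of _ p]) auto
  next
    case False
    define m where "m = pmonom (pcoeff p n) (n - e)"
    define p1 where "p1 = [:pcoeff h e:] * p - m * h"
    have m: "m \<in> polys_over S"
      using hS by (auto simp: m_def)
    have p1: "p1 \<in> polys_over S"
      unfolding p1_def using hS m h(1) Suc.prems(1) by blast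
    have "poly_below n p1"
    proof (intro allI impI)
      fix i assume "n \<le> i"
      then show "pcoeff p1 i = 0"
        using False h(2) Suc.prems(2)
        by (cases "i = n") (auto simp: p1_def m_def pcoeff_monom_mult Suc_le_eq)
    qed
    from Suc.IH[OF p1 this] obtain N q r where IH: "q \<in> polys_over S" "r \<in> polys_over S"
        "[:pcoeff h e:] ^ N * p1 = q * h + r" "\<And>i. n \<le> i + e \<Longrightarrow> pcoeff q i = 0" "poly_below e r"
      by (elim exE bexE conjE) blast
    have "[:pcoeff h e:] ^ Suc N * p = [:pcoeff h e:] ^ N * p1 + [:pcoeff h e:] ^ N * m * h"
      unfolding p1_def power_Suc right_diff_distrib by (simp only: algebra_simps diff_add_cancel)
    also have "\<dots> = (q + [:pcoeff h e:] ^ N * m) * h + r"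
      unfolding IH(3) by (simp add: algebra_simps)
    finally have eq: "[:pcoeff h e:] ^ Suc N * p = (q + [:pcoeff h e:] ^ N * m) * h + r" .
    have "pcoeff (q + [:pcoeff h e:] ^ N * m) i = 0" if "Suc n \<le> i + e" for i
    proof -
      have "pcoeff ([:pcoeff h e:] ^ N * m) i = pcoeff h e ^ N * pcoeff m i"
        by (simp add: poly_const_pow)
      then show ?thesis
        using that False IH(4)[of i] by (auto simp: m_def)
    qed
    moreover have "q + [:pcoeff h e:] ^ N * m \<in> polys_over S"
      using IH(1) m hS by blast
    ultimately show ?thesis
      using IH(2,5) eq
      by (intro exI[of _ "Suc N"] bexI[of _ "q + [:pcoeff h e:] ^ N * m"] bexI[of _ r] conjI) auto
  qed
qed

text \<open>For a polynomial \<open>f\<close> of positive degree whose leading coefficient is invertible modulo \<open>I\<close>,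
  the quotient of \<open>S[X]\<close> by \<open>(I, f)\<close> is a nonzero free module of finite rank over \<open>S/I\<close>.\<close>

context ideal_set
begin

definition poly_extension :: "'r poly \<Rightarrow> 'r poly set"
  where "poly_extension f = {q * f + r | q r. q \<in> polys_over S \<and> r \<in> polys_over I}"

lemma poly_extension_ideal:
  assumes "f \<in> polys_over S"
  shows "ideal_set (polys_over S) (poly_extension f)"
proof -
  interpret p: ideal_set "polys_over S" "polys_over I" by (rule polys_over_ideal)
  show ?thesis
  proof
    show "poly_extension f \<subseteq> polys_over S"
      using assms by (auto simp: poly_extension_def)
    show "0 \<in> poly_extension f"
      unfolding poly_extension_def by (intro CollectI exI[of _ 0]) auto
    fix a b assume "a \<in> poly_extension f" "b \<in> poly_extension f"
    then obtain q r q' r' where "a = q * f + r" "b = q' * f + r'"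
      "q \<in> polys_over S" "r \<in> polys_over I" "q' \<in> polys_over S" "r' \<in> polys_over I"
      by (auto simp: poly_extension_def)
    then show "a + b \<in> poly_extension f"
      unfolding poly_extension_def
      by (intro CollectI exI[of _ "q + q'"] exI[of _ "r + r'"]) (auto simp: algebra_simps)
  next
    fix s a assume s: "s \<in> polys_over S" and "a \<in> poly_extension f"
    then obtain q r where "a = q * f + r" "q \<in> polys_over S" "r \<in> polys_over I"
      by (auto simp: poly_extension_def)
    then show "s * a \<in> poly_extension f"
      unfolding poly_extension_def using s
      by (intro CollectI exI[of _ "s * q"] exI[of _ "s * r"]) (auto simp: algebra_simps)
  qed
qed

lemma poly_extension_intros:
  "r \<in> polys_over I \<Longrightarrow> r \<in> poly_extension f"
  "q \<in> polys_over S \<Longrightarrow> q * f \<in> poly_extension f"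
proof -
  interpret p: ideal_set "polys_over S" "polys_over I" by (rule polys_over_ideal)
  show "r \<in> polys_over I \<Longrightarrow> r \<in> poly_extension f"
    unfolding poly_extension_def by (intro CollectI exI[of _ 0] exI[of _ r]) auto
  show "q \<in> polys_over S \<Longrightarrow> q * f \<in> poly_extension f"
    unfolding poly_extension_def by (intro CollectI exI[of _ q] exI[of _ 0]) auto
qed

text \<open>If \<open>q * f\<close> is 1 modulo \<open>I\<close>, its top coefficient lies in
  \<open>I\<close>; it is the top coefficient of \<open>q\<close> times a unit modulo
  \<open>I\<close>, so the former can be stripped off. In the end \<open>q\<close> vanishes modulo
  \<open>I\<close>, and 1 would lie in \<open>I\<close>.\<close>

lemma poly_extension_proper:
  assumes f: "f \<in> polys_over S" "poly_below (Suc d) f" "0 < d"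
    and v: "v \<in> S" "pcoeff f d * v - 1 \<in> I" and "1 \<notin> I"
  shows "1 \<notin> poly_extension f"
proof
  interpret p: ideal_set "polys_over S" "polys_over I" by (rule polys_over_ideal)
  have in_S: "pcoeff p i \<in> S" if "p \<in> polys_over S" for p i
    using that by (simp add: polys_over_def)
  assume "1 \<in> poly_extension f"
  then obtain q r where qr: "1 = q * f + r" "q \<in> polys_over S" "r \<in> polys_over I"
    by (auto simp: poly_extension_def)
  have "q \<in> polys_over I" if "q \<in> polys_over S" "poly_below n q" "1 - q * f \<in> polys_over I" for n q
    using that
  proof (induction n arbitrary: q)
    case 0
    then show ?case using poly_below_0[of q] by auto
  next
    case (Suc n)
    have "pcoeff (q * f) (n + d) = (\<Sum>i\<le>n + d. pcoeff q i * pcoeff f (n + d - i))"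
      by (simp add: coeff_mult)
    also have "\<dots> = (\<Sum>i\<in>{n}. pcoeff q i * pcoeff f (n + d - i))"
    proof (rule sum.mono_neutral_right)
      show "\<forall>i\<in>{..n + d} - {n}. pcoeff q i * pcoeff f (n + d - i) = 0"
      proof
        fix i assume "i \<in> {..n + d} - {n}"
        then consider "i < n" | "Suc n \<le> i" by fastforce
        then show "pcoeff q i * pcoeff f (n + d - i) = 0"
          using f(2) Suc.prems(2) by cases auto
      qed
    qed auto
    finally have "pcoeff (q * f) (n + d) = pcoeff q n * pcoeff f d" by simp
    moreover have "pcoeff (1 - q * f) (n + d) \<in> I"
      using Suc.prems(3) unfolding polys_over_def by blast
    \<comment> \<open>Here \<open>0 < d\<close> matters: the constant 1 has no coefficient in degree
      \<open>n + d\<close>.\<close>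
    moreover have "pcoeff (1 - q * f) (n + d) = - pcoeff (q * f) (n + d)"
      using f(3) by (simp add: coeff_1)
    ultimately have "- (pcoeff q n * pcoeff f d) \<in> I"
      by (simp only:)
    from uminus_mem[OF this] have "pcoeff q n * pcoeff f d \<in> I"
      by (simp only: minus_minus)
    then have "pcoeff q n * pcoeff f d * v - pcoeff q n * (pcoeff f d * v - 1) \<in> I"
      using v in_S[OF Suc.prems(1)] by blast
    then have qn: "pcoeff q n \<in> I" by (simp add: algebra_simps)
    define m where "m = pmonom (pcoeff q n) n"
    have m: "m \<in> polys_over I"
      using qn by (auto simp: m_def polys_over_def)
    have "q - m \<in> polys_over I"
    proof (rule Suc.IH)
      show "q - m \<in> polys_over S"
        using Suc.prems(1) m by blast
      show "poly_below n (q - m)"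
      proof (intro allI impI)
        fix i assume "n \<le> i"
        then show "pcoeff (q - m) i = 0"
          using Suc.prems(2) by (cases "i = n") (auto simp: m_def)
      qed
      have "1 - q * f + m * f \<in> polys_over I"
        using Suc.prems(3) m f(1) by blast
      then show "1 - (q - m) * f \<in> polys_over I"
        by (simp add: algebra_simps)
    qed
    then have "q - m + m \<in> polys_over I" using m by blast
    then show ?case by simp
  qed
  moreover have "1 - q * f = r"
    using qr(1) by (simp add: algebra_simps)
  ultimately have "q \<in> polys_over I"
    using qr(2,3) ex_poly_below by metis
  then have "1 \<in> polys_over I"
    unfolding qr(1) using qr(3) f(1) by blast
  then have "pcoeff 1 0 \<in> I" unfolding polys_over_def by blast
  then show False using assms(6) by simp
qed

lemma poly_extension_finite:
  assumes f: "f \<in> polys_over S" "poly_below (Suc d) f"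
    and v: "v \<in> S" "pcoeff f d * v - 1 \<in> I" and fin: "finite_mod S I"
  shows "finite_mod (polys_over S) (poly_extension f)"
proof -
  interpret p: ideal_set "polys_over S" "polys_over I" by (rule polys_over_ideal)
  interpret e: ideal_set "polys_over S" "poly_extension f" by (rule poly_extension_ideal[OF f(1)])
  have in_S: "pcoeff p i \<in> S" if "p \<in> polys_over S" for p i
    using that by (simp add: polys_over_def)
  have reduce: "\<exists>r\<in>polys_over S. poly_below d r \<and> p - r \<in> poly_extension f"
    if "p \<in> polys_over S" "poly_below n p" for n p
    using that
  proof (induction n arbitrary: p)
    case 0
    then show ?case using poly_below_0[of p] by (intro bexI[of _ 0]) auto
  next
    case (Suc n)
    show ?case
    proof (cases "n < d")
      case True
      then show ?thesis using Suc.prems by (intro bexI[of _ p]) auto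
    next
      case False
      \<comment> \<open>Since \<open>v\<close> inverts the leading coefficient only modulo
        \<open>I\<close>, the multiple \<open>m\<close> of \<open>f\<close> cancels the top
        coefficient of \<open>p\<close> up to an error in \<open>I\<close>, which \<open>l\<close>
        absorbs.\<close>
      define m where "m = pmonom (pcoeff p n * v) (n - d) * f"
      define l where "l = pmonom (pcoeff p n * (1 - pcoeff f d * v)) n"
      have "1 - pcoeff f d * v \<in> I"
        using v(2) diff_mem_commute by blast
      then have l: "l \<in> polys_over I"
        unfolding l_def polys_over_def using in_S[OF Suc.prems(1)] by auto
      have m: "m \<in> poly_extension f"
        unfolding m_def using in_S[OF Suc.prems(1)] v(1) by (intro poly_extension_intros) auto
      have ml: "m + l \<in> poly_extension f"
        using m l poly_extension_intros by blast
      have "poly_below n (p - (m + l))"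
      proof (intro allI impI)
        fix i assume i: "n \<le> i"
        have "pcoeff m i = (if n - d \<le> i then pcoeff p n * v * pcoeff f (i - (n - d)) else 0)"
          unfolding m_def by (rule pcoeff_monom_mult)
        moreover have "pcoeff l i = (if n = i then pcoeff p n * (1 - pcoeff f d * v) else 0)"
          unfolding l_def by simp
        ultimately show "pcoeff (p - (m + l)) i = 0"
          using Suc.prems(2) f(2) False i by (cases "i = n") (auto simp: algebra_simps)
      qed
      then obtain r where "r \<in> polys_over S" "poly_below d r" "p - (m + l) - r \<in> poly_extension f"
        using Suc.IH[of "p - (m + l)"] Suc.prems(1) ml by blast
      then show ?thesis
        using ml e.add_mem[of "p - (m + l) - r" "m + l"] by (intro bexI[of _ r]) (auto simp: algebra_simps)
    qed
  qed
  obtain F where F: "finite F" "F \<subseteq> S" "\<And>s. s \<in> S \<Longrightarrow> \<exists>f\<in>F. s - f \<in> I"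
    using finite_mod_representatives[OF fin] by blast
  define G where "G = (\<lambda>\<phi>. \<Sum>i<d. pmonom (\<phi> i) i) ` ({..<d} \<rightarrow>\<^sub>E F)"
  have "finite G"
    unfolding G_def using F(1) by (intro finite_imageI finite_PiE) auto
  moreover have "\<exists>g\<in>G. p - g \<in> poly_extension f" if p: "p \<in> polys_over S" for p
  proof -
    obtain n where n: "poly_below n p"
      using ex_poly_below by blast
    obtain r where r: "r \<in> polys_over S" "poly_below d r" "p - r \<in> poly_extension f"
      using reduce[OF p n] by blast
    have "\<exists>a\<in>F. pcoeff r i - a \<in> I" for i
      using F(3) in_S[OF r(1)] by blast
    then obtain \<psi> where \<psi>: "\<And>i. \<psi> i \<in> F \<and> pcoeff r i - \<psi> i \<in> I" by metis
    define g where "g = (\<Sum>i<d. pmonom (\<psi> i) i)"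
    have "g \<in> G"
      unfolding G_def g_def using \<psi>
      by (intro image_eqI[of _ _ "restrict \<psi> {..<d}"]) auto
    moreover have "r - g \<in> polys_over I"
      unfolding polys_over_def
    proof (intro CollectI allI)
      fix i
      have "pcoeff g i = (if i < d then \<psi> i else 0)"
        unfolding g_def by (simp add: coeff_sum)
      then show "pcoeff (r - g) i \<in> I"
        using r(2) \<psi>[of i] by auto
    qed
    ultimately have "p - r + (r - g) \<in> poly_extension f"
      using r(3) poly_extension_intros by blast
    then show ?thesis using \<open>g \<in> G\<close> by (intro bexI[of _ g]) auto
  qed
  ultimately show ?thesis unfolding finite_mod_def by blast
qed

end

text \<open>Top terms with coefficients in \<open>I\<close> are discarded until the leading
  coefficient survives modulo \<open>I\<close>; for a prime \<open>I\<close> it can then be inverted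
  in a finite quotient.\<close>

lemma (in ideal_set) poly_cut:
  assumes g: "g \<in> polys_over S" "g \<notin> polys_over I"
  shows "\<exists>m. \<exists>g'\<in>polys_over S. g - g' \<in> polys_over I \<and> poly_below (Suc m) g' \<and> pcoeff g' m \<notin> I"
proof -
  have cut: "\<exists>m. \<exists>g'\<in>polys_over S. g - g' \<in> polys_over I \<and> poly_below (Suc m) g' \<and> pcoeff g' m \<notin> I"
    if "g \<in> polys_over S" "g \<notin> polys_over I" "poly_below n g" for n
    using that
  proof (induction n arbitrary: g)
    interpret p: ideal_set "polys_over S" "polys_over I" by (rule polys_over_ideal)
    case 0
    then show ?case using poly_below_0[of g] by auto
  next
    interpret p: ideal_set "polys_over S" "polys_over I" by (rule polys_over_ideal)
    case (Suc n)
    show ?case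
    proof (cases "pcoeff g n \<in> I")
      case False
      then show ?thesis
        using Suc.prems by (intro exI[of _ n] bexI[of _ g]) auto
    next
      case True
      define l where "l = pmonom (pcoeff g n) n"
      have l: "l \<in> polys_over I"
        using True by (auto simp: l_def polys_over_def)
      have 1: "g - l \<in> polys_over S"
        using Suc.prems(1) l by blast
      have 2: "g - l \<notin> polys_over I"
      proof
        assume "g - l \<in> polys_over I"
        from p.add_mem[OF this l] show False
          using Suc.prems(2) by simp
      qed
      have 3: "poly_below n (g - l)"
      proof (intro allI impI)
        fix i assume "n \<le> i"
        then show "pcoeff (g - l) i = 0"
          using Suc.prems(3) by (cases "i = n") (auto simp: l_def)
      qed
      from Suc.IH[OF 1 2 3] obtain m g' where g': "g' \<in> polys_over S" "g - l - g' \<in> polys_over I"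
          "poly_below (Suc m) g'" "pcoeff g' m \<notin> I"
        by blast
      have "g - g' \<in> polys_over I"
        using p.add_mem[OF g'(2) l] by (simp add: algebra_simps)
      then show ?thesis
        using g' by (intro exI[of _ m] bexI[of _ g']) auto
    qed
  qed
  obtain n where "poly_below n g"
    using ex_poly_below by blast
  from cut[OF assms this] show ?thesis .
qed

text \<open>The finite quotient of \<open>S[x]\<close> is obtained from a finite quotient \<open>S/Q\<close> by adjoining a root
  of \<open>f\<close>; the main point is that all relations satisfied by \<open>x\<close> modulo \<open>P\<close> follow from \<open>f\<close>
  after inverting the leading coefficient.\<close>

lemma (in subring_set) finite_quotient_adjoin:
  assumes Q: "ideal_set S Q" "finite_mod S Q" "1 \<notin> Q"
    and f: "f \<in> polys_over S" "poly_below (Suc d) f" "0 < d"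
    and v: "v \<in> S" "pcoeff f d * v - 1 \<in> Q"
    and P: "P \<subseteq> adjoin S x" "0 \<in> P"
    and rel: "\<And>p. p \<in> polys_over S \<Longrightarrow> poly p x \<in> P \<Longrightarrow> p \<in> ideal_set.poly_extension S Q f"
  shows "\<exists>R. ideal_set (adjoin S x) R \<and> P \<subseteq> R \<and> finite_mod (adjoin S x) R \<and> 1 \<notin> R
    \<and> Q \<subseteq> R \<and> poly f x \<in> R"
proof -
  interpret Q: ideal_set S Q by fact
  interpret T: subring_set "adjoin S x" by (rule adjoin_subring)
  interpret E: ideal_set "polys_over S" "Q.poly_extension f"
    by (rule Q.poly_extension_ideal[OF f(1)])
  define R where "R = (\<lambda>p. poly p x) ` Q.poly_extension f"
  have "ideal_set (adjoin S x) R"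
  proof
    show "R \<subseteq> adjoin S x"
      using E.subset by (auto simp: R_def adjoin_def)
    show "0 \<in> R"
      unfolding R_def by (intro image_eqI[of _ _ 0]) auto
    fix a b assume "a \<in> R" "b \<in> R"
    then obtain p q where "a = poly p x" "b = poly q x"
        "p \<in> Q.poly_extension f" "q \<in> Q.poly_extension f"
      unfolding R_def by blast
    then show "a + b \<in> R"
      unfolding R_def by (intro image_eqI[of _ _ "p + q"]) auto
  next
    fix s a assume "s \<in> adjoin S x" "a \<in> R"
    then obtain p q where "s = poly p x" "a = poly q x"
        "p \<in> polys_over S" "q \<in> Q.poly_extension f"
      unfolding R_def adjoin_def by blast
    then show "s * a \<in> R"
      unfolding R_def by (intro image_eqI[of _ _ "p * q"]) auto
  qed
  moreover have "P \<subseteq> R"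
    using P(1) rel unfolding R_def adjoin_def by blast
  moreover have "finite_mod (adjoin S x) R"
  proof -
    obtain F where F: "finite F" "\<And>p. p \<in> polys_over S \<Longrightarrow> \<exists>g\<in>F. p - g \<in> Q.poly_extension f"
      using Q.poly_extension_finite[OF f(1,2) v Q(2)] unfolding finite_mod_def by metis
    have "\<exists>b\<in>(\<lambda>g. poly g x) ` F. a - b \<in> R" if "a \<in> adjoin S x" for a
    proof -
      obtain p where p: "a = poly p x" "p \<in> polys_over S"
        using \<open>a \<in> adjoin S x\<close> unfolding adjoin_def by blast
      obtain g where g: "g \<in> F" "p - g \<in> Q.poly_extension f"
        using F(2)[OF p(2)] by blast
      then have "poly (p - g) x \<in> R"
        unfolding R_def by blast
      then show ?thesis
        using p(1) g(1) by (intro bexI[of _ "poly g x"]) auto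
    qed
    then show ?thesis
      unfolding finite_mod_def using F(1) by (intro exI[of _ "(\<lambda>g. poly g x) ` F"]) auto
  qed
  moreover have "1 \<notin> R"
  proof
    assume "1 \<in> R"
    then obtain p where p: "1 = poly p x" "p \<in> Q.poly_extension f"
      unfolding R_def by blast
    \<comment> \<open>The polynomial \<open>1 - p\<close> takes the value 0 at \<open>x\<close>, so
      it is a relation too. In this way \<open>rel\<close> also controls the ambiguity in writing
      elements of S[x] as polynomials.\<close>
    then have "1 - p \<in> Q.poly_extension f"
      using rel[of "1 - p"] P(2) by auto
    from E.add_mem[OF this p(2)] show False
      using Q.poly_extension_proper[OF f v Q(3)] by simp
  qed
  moreover have "Q \<subseteq> R"
  proof
    fix a assume "a \<in> Q"
    then have "[:a:] \<in> Q.poly_extension f"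
      by (intro Q.poly_extension_intros(1))
        (auto simp: polys_over_def coeff_pCons split: nat.split)
    then show "a \<in> R"
      unfolding R_def by (intro image_eqI[of _ _ "[:a:]"]) auto
  qed
  moreover have "poly f x \<in> R"
    unfolding R_def using Q.poly_extension_intros(2)[of 1 f] E.one_in by auto
  ultimately show ?thesis by blast
qed

lemma ideal_set_Int:
  assumes "ideal_set T P" "subring_set S" "S \<subseteq> T"
  shows "ideal_set S (P \<inter> S)"
proof -
  interpret P: ideal_set T P by fact
  interpret S: subring_set S by fact
  show ?thesis
    by unfold_locales (use assms(3) in auto)
qed

lemma prime_set_Int:
  assumes "prime_set T P" "subring_set S" "S \<subseteq> T"
  shows "prime_set S (P \<inter> S)"
proof -
  interpret P: prime_set T P by fact
  interpret I: ideal_set S "P \<inter> S"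
    by (rule ideal_set_Int[OF P.ideal_set_axioms assms(2,3)])
  show ?thesis
    by unfold_locales (use assms(3) P.prime_mem P.one_not_mem in auto)
qed

text \<open>If all relations of \<open>x\<close> modulo \<open>P\<close> are trivial, then \<open>x\<close> is made a root of \<open>1 + X g\<close>, which
  turns \<open>t = g(x)\<close> into a unit. Otherwise take for \<open>f\<close> a relation of minimal degree, with leading
  coefficient \<open>a\<close>. A polynomial \<open>h\<close> of minimal degree with \<open>h(x)\<close> in \<open>t S[x] + P\<close> but not in \<open>P\<close> must
  be a constant \<open>c\<close>, by division of \<open>h\<close> by \<open>f\<close> or of \<open>f\<close> by \<open>h\<close>, and it suffices to make \<open>a c\<close>
  invertible in a finite quotient of \<open>S\<close>.\<close>

lemma (in subring_set) jacobson_adjoin: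
  assumes jac: "jacobson_set S"
  shows "jacobson_set (adjoin S x)"
  unfolding jacobson_set_def
proof (intro allI impI)
  fix P t
  assume P: "prime_set (adjoin S x) P" and t: "t \<in> adjoin S x" "t \<notin> P"
  interpret P: prime_set "adjoin S x" P by fact
  define P0 where "P0 = P \<inter> S"
  have P0: "prime_set S P0"
    unfolding P0_def by (rule prime_set_Int[OF P subring_set_axioms subset_adjoin(1)])
  interpret P0: prime_set S P0 by fact
  interpret A: ideal_set "polys_over S" "polys_over P0"
    by (rule P0.polys_over_ideal)
  have in_S: "pcoeff p i \<in> S" if "p \<in> polys_over S" for p i
    using that by (simp add: polys_over_def)
  have ev: "poly p x \<in> adjoin S x" if "p \<in> polys_over S" for p
    using that unfolding adjoin_def by blast
  have ev_P: "poly p x \<in> P" if "p \<in> polys_over P0" for p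
    unfolding poly_altdef using that subset_adjoin(2)
    by (intro P.sum_mem P.mult_mem') (auto simp: polys_over_def P0_def)
  \<comment> \<open>A nontrivial relation of degree below \<open>n\<close> can thus be replaced by
    one whose leading coefficient is outside \<open>P0\<close>, since terms with coefficients in
    \<open>P0\<close> are relations themselves.\<close>
  have lead_P0: "p \<in> polys_over P0"
    if p: "p \<in> polys_over S" "poly p x \<in> P" and below: "poly_below n p"
      and no_lead: "\<And>m r. m < n \<Longrightarrow> r \<in> polys_over S \<Longrightarrow> poly r x \<in> P \<Longrightarrow> poly_below (Suc m) r
        \<Longrightarrow> pcoeff r m \<in> P0" for n p
    using p below no_lead
  proof (induction n arbitrary: p)
    case 0
    then show ?case using poly_below_0[of p] by auto
  next
    case (Suc n)
    define l where "l = pmonom (pcoeff p n) n"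
    have "pcoeff p n \<in> P0"
      using Suc.prems(4)[OF _ Suc.prems(1-3)] by simp
    then have l: "l \<in> polys_over P0"
      by (auto simp: l_def polys_over_def)
    have "p - l \<in> polys_over P0"
    proof (rule Suc.IH)
      show "p - l \<in> polys_over S"
        using l Suc.prems(1) by blast
      show "poly (p - l) x \<in> P"
        using ev_P[OF l] Suc.prems(2) by auto
      show "poly_below n (p - l)"
      proof (intro allI impI)
        fix i assume "n \<le> i"
        then show "pcoeff (p - l) i = 0"
          using Suc.prems(3) by (cases "i = n") (auto simp: l_def)
      qed
    qed (use Suc.prems(4) in auto)
    from A.add_mem[OF this l] show ?case by simp
  qed
  define lead where "lead d f \<longleftrightarrow> f \<in> polys_over S \<and> poly f x \<in> P \<and> poly_below (Suc d) f \<and> pcoeff f d \<notin> P0"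
    for d f
  obtain g where g: "t = poly g x" "g \<in> polys_over S"
    using t(1) unfolding adjoin_def by blast
  show "\<exists>R. \<exists>u\<in>adjoin S x. ideal_set (adjoin S x) R \<and> P \<subseteq> R \<and> finite_mod (adjoin S x) R
      \<and> 1 \<notin> R \<and> t * u - 1 \<in> R"
  proof (cases "\<exists>d f. lead d f")
    case False
    have trivial: "p \<in> polys_over P0" if p: "p \<in> polys_over S" "poly p x \<in> P" for p
    proof -
      obtain n where n: "poly_below n p"
        using ex_poly_below by blast
      show ?thesis
        using False unfolding lead_def by (intro lead_P0[OF p n]) blast
    qed
    have "g \<notin> polys_over P0"
      using ev_P[of g] t(2) g(1) by blast
    \<comment> \<open>Passing to \<open>g'\<close> keeps the value at \<open>x\<close> modulo
      \<open>P\<close> and secures a leading coefficient outside \<open>P0\<close>, to which the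
      hypothesis on \<open>S\<close> applies.\<close>
    from P0.poly_cut[OF g(2) this] obtain m g' where g': "g' \<in> polys_over S"
        "g - g' \<in> polys_over P0" "poly_below (Suc m) g'" "pcoeff g' m \<notin> P0"
      by blast
    have jacP: "\<exists>Q. \<exists>u\<in>S. ideal_set S Q \<and> P0 \<subseteq> Q \<and> finite_mod S Q \<and> 1 \<notin> Q \<and> pcoeff g' m * u - 1 \<in> Q"
      using jac P0 in_S[OF g'(1)] g'(4) unfolding jacobson_set_def by blast
    then obtain Q v where Q: "v \<in> S" "ideal_set S Q" "P0 \<subseteq> Q" "finite_mod S Q" "1 \<notin> Q"
        "pcoeff g' m * v - 1 \<in> Q" by blast
    define f where "f = pCons 1 g'"
    have 1: "f \<in> polys_over S"
      using g'(1) by (auto simp: f_def polys_over_def coeff_pCons split: nat.split)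
    have 2: "poly_below (Suc (Suc m)) f"
    proof (intro allI impI)
      fix i assume "Suc (Suc m) \<le> i"
      then show "pcoeff f i = 0"
        using g'(3) by (cases i) (auto simp: f_def coeff_pCons)
    qed
    have 3: "pcoeff f (Suc m) * v - 1 \<in> Q"
      using Q(6) by (simp add: f_def)
    interpret Q: ideal_set S Q by fact
    have 4: "p \<in> Q.poly_extension f" if "p \<in> polys_over S" "poly p x \<in> P" for p
      using trivial[OF that] Q(3) by (intro Q.poly_extension_intros) (auto simp: polys_over_def)
    obtain R where R: "ideal_set (adjoin S x) R" "P \<subseteq> R" "finite_mod (adjoin S x) R" "1 \<notin> R"
        "poly f x \<in> R"
      using finite_quotient_adjoin[OF Q(2,4,5) 1 2 _ Q(1) 3 P.subset P.zero_mem 4] by blast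
    interpret R: ideal_set "adjoin S x" R by fact
    have "poly g x - poly g' x \<in> R"
      using ev_P[OF g'(2)] R(2) by auto
    then have "(poly g x - poly g' x) * (- x) - poly f x \<in> R"
      using R(5) subset_adjoin(2) by blast
    moreover have "(poly g x - poly g' x) * (- x) - poly f x = t * (- x) - 1"
      by (simp add: f_def g(1) algebra_simps)
    ultimately show ?thesis
      using R(1-4) P.uminus_in[OF subset_adjoin(2)]
      by (intro exI[of _ R] bexI[of _ "- x"] conjI) simp_all
  next
    case True
    define d where "d = (LEAST d. \<exists>f. lead d f)"
    obtain f where f: "lead d f"
      using True LeastI_ex[of "\<lambda>d. \<exists>f. lead d f"] unfolding d_def by blast
    have small: "p \<in> polys_over P0" if p: "p \<in> polys_over S" "poly p x \<in> P" "poly_below d p" for p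
    proof (rule lead_P0[OF p])
      fix m r assume "m < d" and r: "r \<in> polys_over S" "poly r x \<in> P" "poly_below (Suc m) r"
      then have "\<not> lead m r"
        using not_less_Least[of m "\<lambda>d. \<exists>f. lead d f"] unfolding d_def by blast
      then show "pcoeff r m \<in> P0"
        using r unfolding lead_def by simp
    qed
    have fS: "f \<in> polys_over S" and fP: "poly f x \<in> P" and fb: "poly_below (Suc d) f"
        and fl: "pcoeff f d \<notin> P0"
      using f by (auto simp: lead_def)
    have "0 < d"
    proof (rule ccontr)
      assume "\<not> 0 < d"
      then have "d = 0" by simp
      then have "f = [:pcoeff f 0:]"
        using fb by (intro poly_eqI) (auto simp: coeff_pCons split: nat.split)
      then have "poly f x = poly [:pcoeff f 0:] x"
        by (rule arg_cong)
      then have "poly f x = pcoeff f 0"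
        by simp
      then show False
        using fP fl in_S[OF fS] \<open>d = 0\<close> by (simp add: P0_def)
    qed
    define a where "a = pcoeff f d"
    have a: "a \<in> S" "a \<notin> P0"
      using in_S[OF fS] fl by (auto simp: a_def)
    define good where "good e h \<longleftrightarrow> h \<in> polys_over S \<and> poly_below (Suc e) h \<and> poly h x \<notin> P
      \<and> (\<exists>u\<in>adjoin S x. poly h x - t * u \<in> P)" for e h
    have "\<exists>e h. good e h"
    proof -
      obtain n where "poly_below n g"
        using ex_poly_below by blast
      then have "good n g"
        unfolding good_def using g t P.one_in by (intro conjI bexI[of _ 1]) auto
      then show ?thesis by blast
    qed
    define e where "e = (LEAST e. \<exists>h. good e h)"
    obtain h where h: "good e h"
      using \<open>\<exists>e h. good e h\<close> LeastI_ex[of "\<lambda>e. \<exists>h. good e h"] unfolding e_def by blast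
    have min: "\<not> good e' h'" if "e' < e" for e' h'
      using not_less_Least[of e' "\<lambda>e. \<exists>h. good e h"] that unfolding e_def by blast
    obtain u where hS: "h \<in> polys_over S" and hb: "poly_below (Suc e) h" and hP: "poly h x \<notin> P"
        and u: "u \<in> adjoin S x" "poly h x - t * u \<in> P"
      using h unfolding good_def by blast
    have "e = 0"
    proof (rule ccontr)
      assume "e \<noteq> 0"
      define b where "b = pcoeff h e"
      have bS: "b \<in> S" using in_S[OF hS] by (simp add: b_def)
      have bT: "b \<in> adjoin S x" using bS subset_adjoin(1) by blast
      \<comment> \<open>Otherwise the top term of \<open>h\<close> could be dropped without changing
        the value modulo \<open>P\<close>, against the minimality of \<open>e\<close>.\<close>
      have b: "b \<notin> P0"
      proof
        assume "b \<in> P0"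
        define l where "l = pmonom b e"
        have l: "l \<in> polys_over P0"
          using \<open>b \<in> P0\<close> by (auto simp: l_def polys_over_def)
        have "good (e - 1) (h - l)"
          unfolding good_def
        proof (intro conjI bexI)
          show "h - l \<in> polys_over S"
            using hS l by blast
          show "poly_below (Suc (e - 1)) (h - l)"
          proof (intro allI impI)
            fix i assume "Suc (e - 1) \<le> i"
            then show "pcoeff (h - l) i = 0"
              using hb \<open>e \<noteq> 0\<close> by (cases "i = e") (auto simp: l_def b_def)
          qed
          show "poly (h - l) x \<notin> P"
            using hP P.mem_cong[of "poly h x" "poly (h - l) x"] ev_P[OF l] by simp
          have "(poly h x - t * u) - poly l x \<in> P"
            using u(2) ev_P[OF l] by blast
          then show "poly (h - l) x - t * u \<in> P"
            by (simp add: algebra_simps)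
        qed (rule u)
        then show False using min[of "e - 1"] \<open>e \<noteq> 0\<close> by auto
      qed
      have power_notin: "c ^ N \<notin> P" if "c \<in> S" "c \<notin> P0" for c N
        using P.power_mem[of c N] that subset_adjoin(1) unfolding P0_def by blast
      show False
      proof (cases "d \<le> e")
        case True
        from pseudo_division[OF fS fb hS hb] obtain N q r where
            q: "q \<in> polys_over S" and r: "r \<in> polys_over S" "poly_below d r"
            and eq: "[:a:] ^ N * h = q * f + r"
          unfolding a_def by blast
        have ev_eq: "a ^ N * poly h x = poly q x * poly f x + poly r x"
          using arg_cong[OF eq, of "\<lambda>p. poly p x"] by simp
        have "poly q x * poly f x \<in> P"
          using fP ev[OF q] by blast
        \<comment> \<open>At \<open>x\<close> the remainder agrees with \<open>a ^ N * h\<close>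
          modulo \<open>P\<close>, so it is again a multiple of \<open>t\<close>; it stays outside
          the prime \<open>P\<close> because powers of \<open>a\<close> do. Its degree contradicts
          the minimality of \<open>e\<close>.\<close>
        have "good (d - 1) r"
          unfolding good_def
        proof (intro conjI bexI)
          show "r \<in> polys_over S" by fact
          show "poly_below (Suc (d - 1)) r"
            using r(2) \<open>0 < d\<close> by simp
          show "poly r x \<notin> P"
          proof
            assume "poly r x \<in> P"
            then have "a ^ N * poly h x \<in> P"
              unfolding ev_eq using \<open>poly q x * poly f x \<in> P\<close> by blast
            then show False
              using P.prime_mem[of "a ^ N" "poly h x"] hP ev[OF hS] power_notin[OF a] a subset_adjoin(1)
                power_in by blast
          qed
          show "a ^ N * u \<in> adjoin S x"
            using a subset_adjoin(1) u(1) power_in by blast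
          have "a ^ N * (poly h x - t * u) - poly q x * poly f x \<in> P"
            using \<open>poly q x * poly f x \<in> P\<close> u(2) a subset_adjoin(1) power_in by blast
          then show "poly r x - t * (a ^ N * u) \<in> P"
            using ev_eq by (simp add: algebra_simps)
        qed
        then show False using min[of "d - 1"] \<open>0 < d\<close> True by auto
      next
        case False
        from pseudo_division[OF hS hb fS fb] obtain N q r where
            q: "q \<in> polys_over S" "\<And>i. Suc d \<le> i + e \<Longrightarrow> pcoeff q i = 0"
            and r: "r \<in> polys_over S" "poly_below e r"
            and eq: "[:b:] ^ N * f = q * h + r"
          unfolding b_def by blast
        have ev_eq: "b ^ N * poly f x = poly q x * poly h x + poly r x"
          using arg_cong[OF eq, of "\<lambda>p. poly p x"] by simp
        have fbP: "b ^ N * poly f x \<in> P"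
          using fP bT by blast
        \<comment> \<open>Modulo \<open>P\<close> the value of \<open>r\<close> is minus that of
          \<open>q * h\<close>, a multiple of \<open>t\<close>; outside \<open>P\<close> it would
          make \<open>r\<close> good in a degree below \<open>e\<close>.\<close>
        have "poly r x \<in> P"
        proof (rule ccontr)
          assume "poly r x \<notin> P"
          have "good (e - 1) r"
            unfolding good_def
          proof (intro conjI bexI)
            show "r \<in> polys_over S" by fact
            show "poly_below (Suc (e - 1)) r"
              using r(2) \<open>e \<noteq> 0\<close> by simp
            show "poly r x \<notin> P" by fact
            show "- (poly q x * u) \<in> adjoin S x"
              using ev[OF q(1)] u(1) by blast
            have "b ^ N * poly f x - poly q x * (poly h x - t * u) \<in> P"
              using fbP u(2) ev[OF q(1)] by blast
            then show "poly r x - t * (- (poly q x * u)) \<in> P"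
              unfolding ev_eq by (simp add: algebra_simps)
          qed
          then show False using min[of "e - 1"] \<open>e \<noteq> 0\<close> by auto
        qed
        \<comment> \<open>Both \<open>r\<close> and, because \<open>P\<close> is prime,
          \<open>q\<close> are relations of degree below \<open>d\<close>, so their coefficients lie
          in \<open>P0\<close>. Then so does the coefficient \<open>b ^ N * a\<close> of
          \<open>[:b:] ^ N * f\<close>, although the prime \<open>P0\<close> contains neither
          \<open>a\<close> nor \<open>b\<close>.\<close>
        have rP0: "r \<in> polys_over P0"
          using small[OF r(1) \<open>poly r x \<in> P\<close>] r(2) False by auto
        have "poly q x * poly h x \<in> P"
          using fbP \<open>poly r x \<in> P\<close> P.diff_mem[of "b ^ N * poly f x" "poly r x"] unfolding ev_eq by simp
        then have "poly q x \<in> P"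
          using P.prime_mem[OF ev[OF q(1)] ev[OF hS]] hP by blast
        then have "q \<in> polys_over P0"
          using small[OF q(1)] q(2) \<open>e \<noteq> 0\<close> by auto
        then have "[:b:] ^ N * f \<in> polys_over P0"
          unfolding eq using rP0 hS by blast
        then have "pcoeff ([:b:] ^ N * f) d \<in> P0"
          unfolding polys_over_def by blast
        then have "b ^ N * a \<in> P0"
          by (simp add: poly_const_pow a_def)
        then have "b ^ N \<in> P0"
          using P0.prime_mem[OF power_in[OF bS] a(1)] a(2) by blast
        then show False
          using P0.power_mem[OF bS] b by blast
      qed
    qed
    define c where "c = pcoeff h 0"
    have "h = [:c:]"
      using hb \<open>e = 0\<close> by (intro poly_eqI) (auto simp: c_def coeff_pCons split: nat.split)
    then have hc: "poly h x = c"
      by simp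
    have cS: "c \<in> S"
      using in_S[OF hS] by (simp add: c_def)
    have "c \<notin> P0"
      using hP hc by (auto simp: P0_def)
    then have "a * c \<notin> P0"
      using P0.prime_mem a cS by blast
    \<comment> \<open>Both factors serve a purpose: inverting \<open>a\<close> makes
      \<open>f\<close> monic up to a unit modulo \<open>Q\<close>, and inverting \<open>c\<close>
      inverts \<open>t\<close>, since \<open>c\<close> equals \<open>t * u\<close> modulo
      \<open>P\<close>.\<close>
    then have "\<exists>Q. \<exists>u\<in>S. ideal_set S Q \<and> P0 \<subseteq> Q \<and> finite_mod S Q \<and> 1 \<notin> Q \<and> (a * c) * u - 1 \<in> Q"
      using jac P0 a(1) cS mult_in[OF a(1) cS] unfolding jacobson_set_def by blast
    then obtain Q w where Q: "w \<in> S" "ideal_set S Q" "P0 \<subseteq> Q" "finite_mod S Q" "1 \<notin> Q"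
        "a * c * w - 1 \<in> Q" by blast
    interpret Q: ideal_set S Q by fact
    define v where "v = c * w"
    have v: "v \<in> S" "a * v - 1 \<in> Q"
      using Q(1,6) cS by (auto simp: v_def mult.assoc)
    interpret E: ideal_set "polys_over S" "Q.poly_extension f"
      by (rule Q.poly_extension_ideal[OF fS])
    have rel: "p \<in> Q.poly_extension f" if p: "p \<in> polys_over S" "poly p x \<in> P" for p
    proof -
      obtain n where n: "poly_below n p"
        using ex_poly_below by blast
      from pseudo_division[OF fS fb p(1) n] obtain N q r where
          q: "q \<in> polys_over S" and r: "r \<in> polys_over S" "poly_below d r"
          and eq: "[:a:] ^ N * p = q * f + r"
        unfolding a_def by blast
      have ev_eq: "a ^ N * poly p x = poly q x * poly f x + poly r x"
        using arg_cong[OF eq, of "\<lambda>p. poly p x"] by simp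
      have "a ^ N * poly p x - poly q x * poly f x \<in> P"
        using p(2) fP ev[OF q] a(1) subset_adjoin(1) power_in by blast
      then have "poly r x \<in> P"
        unfolding ev_eq by simp
      then have "r \<in> polys_over Q"
        using small[OF r(1) _ r(2)] Q(3) by (auto simp: polys_over_def)
      then have "q * f + r \<in> Q.poly_extension f"
        using q Q.poly_extension_intros by blast
      \<comment> \<open>As \<open>a * v\<close> is 1 modulo \<open>Q\<close>, the power of
        \<open>a\<close> introduced by pseudo-division can be undone: \<open>p\<close> is the sum of
        this multiple and of \<open>[:1 - (a * v) ^ N:] * p\<close>.\<close>
      then have 1: "[:v:] ^ N * ([:a:] ^ N * p) \<in> Q.poly_extension f"
        unfolding eq using v(1) by blast
      have "(a * v) ^ M - 1 \<in> Q" for M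
      proof (induction M)
        case (Suc M)
        have "(a * v) * ((a * v) ^ M - 1) + (a * v - 1) \<in> Q"
          using Suc a v by blast
        then show ?case by (simp add: algebra_simps)
      qed simp
      then have "1 - (a * v) ^ N \<in> Q"
        using Q.diff_mem_commute by blast
      then have "[:1 - (a * v) ^ N:] \<in> polys_over Q"
        by (auto simp: polys_over_def coeff_pCons split: nat.split)
      then have "[:1 - (a * v) ^ N:] * p \<in> Q.poly_extension f"
        using Q.poly_extension_intros(1) p(1) by blast
      from E.add_mem[OF 1 this] show ?thesis
        by (simp add: poly_const_pow algebra_simps power_mult_distrib smult_diff_left)
    qed
    obtain R where R: "ideal_set (adjoin S x) R" "P \<subseteq> R" "finite_mod (adjoin S x) R" "1 \<notin> R"
        "Q \<subseteq> R"
      using finite_quotient_adjoin[OF Q(2,4,5) fS fb \<open>0 < d\<close> v(1) _ P.subset P.zero_mem rel] v(2)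
      unfolding a_def by blast
    interpret R: ideal_set "adjoin S x" R by fact
    have aw: "a * w \<in> adjoin S x"
      using a Q(1) subset_adjoin(1) by blast
    have "(a * c * w - 1) - (c - t * u) * (a * w) \<in> R"
      using u(2) R(2,5) Q(6) aw unfolding hc by blast
    then have "t * (u * (a * w)) - 1 \<in> R"
      by (simp add: algebra_simps)
    moreover have "u * (a * w) \<in> adjoin S x"
      using aw u(1) by blast
    ultimately show ?thesis
      using R(1-4) by (intro exI[of _ R] bexI[of _ "u * (a * w)"] conjI)
  qed
qed

section \<open>The ring of integers\<close>

lemma of_int_subring: "subring_set (range of_int :: 'r::comm_ring_1 set)"
proof
  show "1 \<in> range (of_int :: int \<Rightarrow> 'r)"
    using of_int_1[symmetric, where ?'a = 'r] by blast
  fix a b :: 'r assume "a \<in> range of_int" "b \<in> range of_int"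
  then obtain i j where "a = of_int i" "b = of_int j" by blast
  then have "a - b = of_int (i - j)" "a * b = of_int (i * j)" by simp_all
  then show "a - b \<in> range of_int" "a * b \<in> range of_int" by blast+
qed

text \<open>What is generated by \<open>g\<close> is the preimage of \<open>I\<close> in the
  integers, because \<open>of_int\<close> need not be injective here; \<open>g = 0\<close> stands
  for the zero preimage.\<close>

lemma of_int_ideal_principal:
  assumes "ideal_set (range of_int :: 'r::comm_ring_1 set) I"
  obtains g :: nat where "of_nat g \<in> I" and "\<And>k. of_int k \<in> I \<Longrightarrow> int g dvd k"
proof (cases "\<exists>g. g > 0 \<and> of_nat g \<in> I")
  case True
  interpret I: ideal_set "range of_int :: 'r set" I by fact
  define g where "g = (LEAST g. g > 0 \<and> of_nat g \<in> I)"
  have g: "g > 0" "of_nat g \<in> I"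
    using LeastI_ex[OF True] by (simp_all add: g_def)
  have "int g dvd k" if "of_int k \<in> I" for k
  proof (rule ccontr)
    assume "\<not> int g dvd k"
    define r where "r = nat (k mod int g)"
    have r1: "int r = k mod int g"
      using g(1) by (simp add: r_def)
    have "k mod int g \<noteq> 0"
      using \<open>\<not> int g dvd k\<close> by (simp only: dvd_eq_mod_eq_0 not_False_eq_True)
    moreover have "k mod int g < int g"
      using g(1) by (intro pos_mod_bound) simp
    ultimately have r: "r < g" "r > 0"
      unfolding r1[symmetric] by linarith+
    have "of_int (k div int g) * of_nat g \<in> I"
      using g(2) by blast
    then have "of_int k - of_int (k div int g) * of_nat g \<in> I"
      using that by blast
    also have "of_int k - of_int (k div int g) * of_nat g = (of_int (k - k div int g * int g) :: 'r)"
      by simp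
    also have "k - k div int g * int g = int r"
      unfolding r1 by (rule minus_div_mult_eq_mod)
    finally have "of_nat r \<in> I" by simp
    then show False
      using not_less_Least[of r "\<lambda>g. g > 0 \<and> of_nat g \<in> I"] r unfolding g_def[symmetric] by blast
  qed
  with g that show thesis by blast
next
  case False
  interpret I: ideal_set "range of_int :: 'r set" I by fact
  have "k = 0" if "of_int k \<in> I" for k
  proof (rule ccontr)
    assume "k \<noteq> 0"
    have "of_nat (nat \<bar>k\<bar>) = (of_int k :: 'r) \<or> of_nat (nat \<bar>k\<bar>) = - (of_int k :: 'r)"
      by (cases "k \<ge> 0") simp_all
    then have "of_nat (nat \<bar>k\<bar>) \<in> I"
      using that I.uminus_mem by metis
    then show False
      using False \<open>k \<noteq> 0\<close> by (metis zero_less_nat_eq zero_less_abs_iff)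
  qed
  then show thesis
    by (intro that[of 0]) auto
qed

text \<open>The generator of the union of a chain already lies in one of its members, where the
  chain must stop.\<close>

lemma noetherian_of_int: "noetherian_set (range of_int :: 'r::comm_ring_1 set)"
  unfolding noetherian_set_def wf_iff_no_infinite_down_chain
proof
  assume "\<exists>f. \<forall>i. (f (Suc i), f i) \<in> {(J, I). ideal_set (range of_int :: 'r set) I \<and>
    ideal_set (range of_int) J \<and> I \<subset> J}"
  then obtain f where f: "\<And>i. ideal_set (range of_int :: 'r set) (f i)" "\<And>i. f i \<subset> f (Suc i)"
    by blast
  have fmono: "f i \<subseteq> f j" if "i \<le> j" for i j
    using lift_Suc_mono_le[of f, OF _ that] f(2) by blast
  have "ideal_set (range of_int :: 'r set) (\<Union>i. f i)"
  proof (rule ideal_set.intro[OF of_int_subring], unfold_locales)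
    interpret I: ideal_set "range of_int :: 'r set" "f i" for i by (rule f)
    show "(\<Union>i. f i) \<subseteq> range of_int" using I.subset by blast
    show "0 \<in> (\<Union>i. f i)" by blast
    show "s * a \<in> (\<Union>i. f i)" if "s \<in> range of_int" "a \<in> (\<Union>i. f i)" for s a
      using that by blast
    fix a b assume "a \<in> (\<Union>i. f i)" "b \<in> (\<Union>i. f i)"
    then obtain i j where "a \<in> f i" "b \<in> f j" by blast
    then have "a \<in> f (max i j)" "b \<in> f (max i j)"
      using fmono[of i "max i j"] fmono[of j "max i j"] by auto
    then show "a + b \<in> (\<Union>i. f i)" by blast
  qed
  then obtain g :: nat where g: "of_nat g \<in> (\<Union>i. f i)" "\<And>k. of_int k \<in> (\<Union>i. f i) \<Longrightarrow> int g dvd k"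
    using of_int_ideal_principal by blast
  then obtain i where i: "of_nat g \<in> f i" by blast
  interpret I: ideal_set "range of_int :: 'r set" "f i" by (rule f)
  interpret I': ideal_set "range of_int :: 'r set" "f (Suc i)" by (rule f)
  have "f (Suc i) \<subseteq> f i"
  proof
    fix a assume a: "a \<in> f (Suc i)"
    then obtain k where k: "a = of_int k" using I'.subset by blast
    with a g(2) obtain l where "k = int g * l" by (meson UNIV_I UN_I dvdE)
    then have "a = of_int l * of_nat g" using k by (simp add: mult.commute)
    then show "a \<in> f i" using i by blast
  qed
  then show False using f(2)[of i] by blast
qed

text \<open>Over the zero ideal of the integers, any prime larger than the absolute value of
  \<open>m\<close> serves. Otherwise a prime factor \<open>p\<close> of \<open>g\<close> lies in
  \<open>P\<close>, and \<open>t \<notin> P\<close> excludes \<open>int p dvd m\<close>. In both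
  cases \<open>p dvd g\<close> yields \<open>P \<subseteq> Q\<close>.\<close>

lemma jacobson_of_int: "jacobson_set (range of_int :: 'r::comm_ring_1 set)"
  unfolding jacobson_set_def
proof (intro allI impI)
  fix P and t :: 'r
  assume P: "prime_set (range of_int) P" and "t \<in> range of_int" and tP: "t \<notin> P"
  then obtain m where m: "t = of_int m" by blast
  interpret P: prime_set "range of_int" P by fact
  obtain g :: nat where g: "of_nat g \<in> P" "\<And>k. of_int k \<in> P \<Longrightarrow> int g dvd k"
    using of_int_ideal_principal[OF P.ideal_set_axioms] by blast
  have "\<exists>p. Factorial_Ring.prime p \<and> \<not> int p dvd m \<and> p dvd g"
  proof (cases "g = 0")
    case True
    obtain p where p: "Factorial_Ring.prime p" "p > nat \<bar>m\<bar>"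
      using bigger_prime by blast
    have "m \<noteq> 0"
      using m tP by auto
    then have "\<not> int p dvd m"
      using p(2) zdvd_imp_le[of "int p" "\<bar>m\<bar>"] by auto
    then show ?thesis using p(1) True by auto
  next
    case False
    have "g \<noteq> 1" using P.one_not_mem g(1) by auto
    then obtain p where p: "Factorial_Ring.prime p" "p dvd g" using prime_factor_nat by blast
    then obtain q where q: "g = p * q" by blast
    have "of_nat p * of_nat q \<in> P" using g(1) q by simp
    then have "of_nat p \<in> P \<or> of_nat q \<in> P" using P.prime_mem by blast
    moreover have "of_nat q \<notin> P"
    proof
      assume "of_nat q \<in> P"
      then have "int g dvd int q" using g(2)[of "int q"] by simp
      then have "g dvd q" by simp
      moreover have "q > 0" using q False by simp
      ultimately have "g \<le> q" by (rule dvd_imp_le)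
      moreover have "2 * q \<le> g" unfolding q using prime_ge_2_nat[OF p(1)] by (rule mult_le_mono1)
      ultimately show False using \<open>q > 0\<close> by simp
    qed
    ultimately have pP: "of_nat p \<in> P" by blast
    have "\<not> int p dvd m"
    proof
      assume "int p dvd m"
      then obtain l where "m = int p * l" by blast
      then have "t = of_int l * of_nat p" using m by (simp add: mult.commute)
      then show False using pP tP by blast
    qed
    then show ?thesis using p by blast
  qed
  then obtain p where p: "Factorial_Ring.prime p" "\<not> int p dvd m" "p dvd g" by blast
  define Q where "Q = range (\<lambda>k. of_int (int p * k) :: 'r)"
  have Qk: "of_int k \<in> Q" if "int p dvd k" for k
    using that unfolding Q_def by blast
  have PQ: "P \<subseteq> Q"
  proof
    fix a assume a: "a \<in> P"
    then obtain k where k: "a = of_int k" using P.subset by blast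
    then have "int g dvd k" using g(2) a by simp
    then have "int p dvd k" using p(3) by (meson int_dvd_int_iff dvd_trans)
    then show "a \<in> Q" using k Qk by simp
  qed
  have "ideal_set (range of_int) Q"
  proof (rule ideal_set.intro[OF of_int_subring], unfold_locales)
    show "Q \<subseteq> range of_int" unfolding Q_def by blast
    show "0 \<in> Q" using Qk[of 0] by simp
    fix a b assume "a \<in> Q" "b \<in> Q"
    then obtain k l where "a = of_int (int p * k)" "b = of_int (int p * l)" unfolding Q_def by blast
    then show "a + b \<in> Q" using Qk[of "int p * k + int p * l"] by simp
  next
    fix s a :: 'r assume "s \<in> range of_int" "a \<in> Q"
    then obtain k l where "s = of_int k" "a = of_int (int p * l)" unfolding Q_def by blast
    then show "s * a \<in> Q" using Qk[of "k * (int p * l)"] by simp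
  qed
  moreover have "finite_mod (range of_int) Q"
  proof -
    have "\<exists>b\<in>of_int ` {0..<int p}. of_int k - b \<in> Q" for k
    proof -
      have "int p > 0" using p(1) prime_gt_0_nat by simp
      then have "k mod int p \<in> {0..<int p}" by simp
      moreover have "of_int (k - k mod int p) \<in> Q" by (intro Qk) (rule dvd_minus_mod)
      ultimately show ?thesis by (intro bexI[of _ "of_int (k mod int p)"]) auto
    qed
    then show ?thesis
      unfolding finite_mod_def by (intro exI[of _ "of_int ` {0..<int p}"]) auto
  qed
  moreover have "1 \<notin> Q"
  proof
    assume "1 \<in> Q"
    then obtain k where "1 = (of_int (int p * k) :: 'r)" unfolding Q_def by blast
    \<comment> \<open>The characteristic may be positive, so this is no equation between integers;
      but 0 lies in \<open>P\<close>, whence the difference is divisible by \<open>g\<close> and by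
      \<open>p\<close>.\<close>
    then have "of_int (1 - int p * k) = (0 :: 'r)" by simp
    then have "int g dvd 1 - int p * k" using g(2) by simp
    then have "int p dvd 1 - int p * k" using p(3) by (meson int_dvd_int_iff dvd_trans)
    then have "int p dvd 1" using dvd_add[of "int p" "1 - int p * k" "int p * k"] by simp
    then show False using p(1) by simp
  qed
  moreover have "\<exists>u\<in>range of_int. t * u - 1 \<in> Q"
  proof -
    have "coprime (int p) m"
      using p(1,2) by (simp add: prime_imp_coprime)
    then have "gcd m (int p) = 1"
      by (simp add: coprime_iff_gcd_eq_1 gcd.commute)
    then obtain u v where uv: "u * m + v * int p = 1"
      using bezout_int[of m "int p"] by auto
    have eq: "m * u - 1 = int p * (- v)" using uv by (simp add: algebra_simps)
    have "of_int (m * u - 1) \<in> Q" by (intro Qk) (simp only: eq dvd_triv_left)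
    then show ?thesis using m by (intro bexI[of _ "of_int u"]) auto
  qed
  ultimately show "\<exists>Q. \<exists>u\<in>range of_int. ideal_set (range of_int) Q \<and> P \<subseteq> Q \<and>
      finite_mod (range of_int) Q \<and> 1 \<notin> Q \<and> t * u - 1 \<in> Q"
    using PQ by (elim bexE, intro exI[of _ Q] bexI conjI)
qed

section \<open>Residual finiteness\<close>

context ideal_set
begin

lemma colon_ideal:
  assumes "x \<in> S"
  shows "ideal_set S {a \<in> S. a * x \<in> I}"
  by unfold_locales (auto simp: distrib_right mult.assoc)

lemma extend_ideal:
  assumes "x \<in> S"
  shows "ideal_set S {k + s * x | k s. k \<in> I \<and> s \<in> S}" (is "ideal_set S ?J")
proof
  show "?J \<subseteq> S" using assms by auto
  show "0 \<in> ?J" by (intro CollectI exI[of _ 0]) auto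
  fix a b assume "a \<in> ?J" "b \<in> ?J"
  then obtain k s k' s' where "a = k + s * x" "b = k' + s' * x" "k \<in> I" "s \<in> S" "k' \<in> I" "s' \<in> S"
    by blast
  then show "a + b \<in> ?J"
    by (intro CollectI exI[of _ "k + k'"] exI[of _ "s + s'"]) (auto simp: algebra_simps)
next
  fix t a assume "t \<in> S" "a \<in> ?J"
  then obtain k s where "a = k + s * x" "k \<in> I" "s \<in> S" by blast
  then show "t * a \<in> ?J" using \<open>t \<in> S\<close>
    by (intro CollectI exI[of _ "t * k"] exI[of _ "t * s"]) (auto simp: algebra_simps)
qed

lemma extend_ideal_mem:
  assumes "x \<in> S"
  shows "x \<in> {k + s * x | k s. k \<in> I \<and> s \<in> S}" "I \<subseteq> {k + s * x | k s. k \<in> I \<and> s \<in> S}"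
proof -
  show "x \<in> {k + s * x | k s. k \<in> I \<and> s \<in> S}"
    by (intro CollectI exI[of _ 0] exI[of _ 1]) auto
  show "I \<subseteq> {k + s * x | k s. k \<in> I \<and> s \<in> S}"
  proof
    fix k assume "k \<in> I"
    then show "k \<in> {k + s * x | k s. k \<in> I \<and> s \<in> S}"
      by (intro CollectI exI[of _ k] exI[of _ 0]) auto
  qed
qed

lemma ideal_Int:
  assumes "ideal_set S J"
  shows "ideal_set S (I \<inter> J)"
proof -
  interpret J: ideal_set S J by fact
  show ?thesis by unfold_locales (use subset in auto)
qed

lemma ideal_sum:
  assumes "ideal_set S J"
  shows "ideal_set S {a + b | a b. a \<in> I \<and> b \<in> J}" (is "ideal_set S ?K")
proof -
  interpret J: ideal_set S J by fact
  show ?thesis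
  proof
    show "?K \<subseteq> S" using subset J.subset by auto
    show "0 \<in> ?K" by (intro CollectI exI[of _ 0]) auto
    fix a b assume "a \<in> ?K" "b \<in> ?K"
    then obtain k s k' s' where "a = k + s" "b = k' + s'" "k \<in> I" "s \<in> J" "k' \<in> I" "s' \<in> J"
      by blast
    then show "a + b \<in> ?K"
      by (intro CollectI exI[of _ "k + k'"] exI[of _ "s + s'"]) (auto simp: algebra_simps)
  next
    fix t a assume "t \<in> S" "a \<in> ?K"
    then obtain k s where "a = k + s" "k \<in> I" "s \<in> J" by blast
    then show "t * a \<in> ?K" using \<open>t \<in> S\<close>
      by (intro CollectI exI[of _ "t * k"] exI[of _ "t * s"]) (auto simp: algebra_simps)
  qed
qed

lemma finite_mod_self [simp]: "finite_mod I I"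
  unfolding finite_mod_def by (intro exI[of _ "{0}"]) auto

lemma finite_mod_Int:
  assumes "ideal_set S J" "finite_mod J I"
  shows "finite_mod J (J \<inter> I)"
proof -
  interpret J: ideal_set S J by fact
  obtain F where F: "F \<subseteq> J" "finite F" "\<And>s. s \<in> J \<Longrightarrow> \<exists>f\<in>F. s - f \<in> I"
    using finite_mod_representatives[OF assms(2) diff_mem] by blast
  have "\<exists>f\<in>F. s - f \<in> J \<inter> I" if "s \<in> J" for s
    using F(1) F(3)[OF that] that by blast
  then show ?thesis
    unfolding finite_mod_def using F(2) by blast
qed

end

lemma noetherian_maximal:
  assumes "noetherian_set S" "ideal_set S I" "Q I"
  shows "\<exists>K. ideal_set S K \<and> I \<subseteq> K \<and> Q K \<and> (\<forall>J. ideal_set S J \<longrightarrow> K \<subset> J \<longrightarrow> \<not> Q J)"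
proof -
  let ?A = "{K. ideal_set S K \<and> I \<subseteq> K \<and> Q K}"
  have "I \<in> ?A" using assms by blast
  from wfE_min[OF assms(1)[unfolded noetherian_set_def] this] obtain K where K: "K \<in> ?A"
      "\<And>J. (J, K) \<in> {(J, I). ideal_set S I \<and> ideal_set S J \<and> I \<subset> J} \<Longrightarrow> J \<notin> ?A"
    by blast
  have "\<not> Q J" if "ideal_set S J" "K \<subset> J" for J
    using K(1) K(2)[of J] that by blast
  then show ?thesis using K(1) by blast
qed

text \<open>If \<open>a * b\<close> lies in \<open>K\<close> but neither factor does, then both K +
  Sa and the colon ideal K : a, which contains \<open>b\<close>, are strictly larger than
  \<open>K\<close> and have finite index. Since (K + Sa)/K is isomorphic to S/(K : a), the index of
  \<open>K\<close> would be finite.\<close>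

lemma maximal_infinite_quotient_prime:
  assumes K: "ideal_set S K" "\<not> finite_mod S K"
    and max: "\<And>J. ideal_set S J \<Longrightarrow> K \<subset> J \<Longrightarrow> finite_mod S J"
  shows "prime_set S K"
proof -
  interpret K: ideal_set S K by fact
  show ?thesis
  proof
    show "1 \<notin> K"
    proof
      assume "1 \<in> K"
      then have "S \<subseteq> K" using K.mult_mem[of _ 1] by auto
      then have "finite_mod S K"
        unfolding finite_mod_def by (intro exI[of _ "{0}"]) auto
      then show False using K(2) by blast
    qed
    fix a b assume ab: "a \<in> S" "b \<in> S" "a * b \<in> K"
    show "a \<in> K \<or> b \<in> K"
    proof (rule ccontr)
      assume not: "\<not> ?thesis"
      let ?K1 = "{k + s * a | k s. k \<in> K \<and> s \<in> S}" and ?K2 = "{s \<in> S. s * a \<in> K}"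
      have 1: "finite_mod S ?K1"
        using K.extend_ideal[OF ab(1)] K.extend_ideal_mem[OF ab(1)] not by (intro max) blast+
      have "b \<in> ?K2" "K \<subseteq> ?K2"
        using ab by (auto simp: mult.commute)
      then have "finite_mod S ?K2"
        using K.colon_ideal[OF ab(1)] not by (intro max) blast+
      then obtain F where F: "finite F" "\<And>s. s \<in> S \<Longrightarrow> \<exists>f\<in>F. s - f \<in> ?K2"
        unfolding finite_mod_def by metis
      have "\<exists>g\<in>(\<lambda>f. f * a) ` F. c - g \<in> K" if c1: "c \<in> ?K1" for c
      proof -
        obtain k s where c: "c = k + s * a" "k \<in> K" "s \<in> S" using c1 by blast
        obtain f where f: "f \<in> F" "s - f \<in> ?K2" using F(2)[OF c(3)] by blast
        then have "k + (s - f) * a \<in> K" using c(2) by blast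
        then show ?thesis using f(1) c(1) by (intro bexI[of _ "f * a"]) (auto simp: algebra_simps)
      qed
      then have "finite_mod ?K1 K"
        unfolding finite_mod_def using F(1) by (intro exI[of _ "(\<lambda>f. f * a) ` F"]) blast
      with 1 have "finite_mod S K" by (rule finite_mod_trans)
      then show False using K(2) by blast
    qed
  qed
qed

text \<open>For \<open>K\<close> maximal among the ideals avoiding \<open>x\<close>, the annihilator \<open>M\<close> of \<open>x\<close> in \<open>S/K\<close>
  is a nil maximal ideal, so every prime ideal above \<open>K\<close> contains \<open>M\<close>.\<close>

lemma residually_finite:
  assumes noeth: "noetherian_set S" and jac: "jacobson_set S"
    and I: "ideal_set S I" and x: "x \<in> S" "x \<notin> I"
  obtains K where "ideal_set S K" "I \<subseteq> K" "finite_mod S K" "x \<notin> K"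
proof -
  obtain K where K: "ideal_set S K" "I \<subseteq> K" "x \<notin> K"
      and max: "\<forall>J. ideal_set S J \<longrightarrow> K \<subset> J \<longrightarrow> \<not> x \<notin> J"
    using noetherian_maximal[where Q = "\<lambda>K. x \<notin> K", OF noeth I x(2)] by (elim exE conjE) (rule that)
  interpret K: ideal_set S K by fact
  \<comment> \<open>By maximality every ideal strictly above \<open>K\<close> contains
    \<open>x\<close>, in particular the one generated by \<open>K\<close> and
    \<open>b\<close>.\<close>
  have generate: "\<exists>k\<in>K. \<exists>s\<in>S. x = k + s * b" if b: "b \<in> S" "b \<notin> K" for b
  proof -
    have "K \<subset> {k + s * b | k s. k \<in> K \<and> s \<in> S}"
      using K.extend_ideal_mem[OF b(1)] b(2) by blast
    with max K.extend_ideal[OF b(1)] have "\<not> x \<notin> {k + s * b | k s. k \<in> K \<and> s \<in> S}"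
      by (elim allE impE)
    then show ?thesis by blast
  qed
  define M where "M = {a \<in> S. a * x \<in> K}"
  have M: "ideal_set S M" unfolding M_def by (rule K.colon_ideal[OF x(1)])
  interpret M: ideal_set S M by fact
  have unit: "\<exists>u\<in>S. b * u - 1 \<in> M" if b: "b \<in> S" "b \<notin> M" for b
  proof -
    have "b * x \<in> S" "b * x \<notin> K" using b x(1) by (auto simp: M_def)
    from generate[OF this] obtain k s where ks: "k \<in> K" "s \<in> S" "x = k + s * (b * x)"
      by blast
    have "(b * s - 1) * x = - k"
      using ks(3) by (simp add: algebra_simps)
    then have "(b * s - 1) * x \<in> K" using ks(1) by auto
    then have "b * s - 1 \<in> M" using ks(2) b(1) by (auto simp: M_def)
    then show ?thesis using ks(2) by blast
  qed
  have M1: "1 \<notin> M" using K(3) by (simp add: M_def)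
  have "prime_set S M"
  proof
    fix a b assume ab: "a \<in> S" "b \<in> S" "a * b \<in> M"
    show "a \<in> M \<or> b \<in> M"
    proof (rule ccontr)
      assume not: "\<not> ?thesis"
      then obtain u where u: "u \<in> S" "b * u - 1 \<in> M" using unit ab(2) by blast
      have "(a * b) * u - a * (b * u - 1) \<in> M" using ab u by blast
      then have "a \<in> M" by (simp add: algebra_simps)
      then show False using not by blast
    qed
  qed (rule M1)
  \<comment> \<open>With \<open>t = 1\<close> this yields just a proper ideal of finite index above
    \<open>M\<close>. Everything outside \<open>M\<close> is a unit modulo \<open>M\<close>, so the
    ideal equals \<open>M\<close>, and S/M is a finite field.\<close>
  then have "\<exists>Q. \<exists>u\<in>S. ideal_set S Q \<and> M \<subseteq> Q \<and> finite_mod S Q \<and> 1 \<notin> Q \<and> 1 * u - 1 \<in> Q"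
    using jac M1 unfolding jacobson_set_def by blast
  then obtain Q where Q: "ideal_set S Q" "M \<subseteq> Q" "finite_mod S Q" "1 \<notin> Q" by blast
  interpret Q: ideal_set S Q by fact
  have "Q \<subseteq> M"
  proof
    fix b assume b: "b \<in> Q"
    show "b \<in> M"
    proof (rule ccontr)
      assume "b \<notin> M"
      then obtain u where u: "u \<in> S" "b * u - 1 \<in> M" using unit b by blast
      then have "b * u - (b * u - 1) \<in> Q" using b Q(2) by blast
      then show False using Q(4) by simp
    qed
  qed
  then have Mfin: "finite_mod S M" using Q(3) finite_mod_mono by blast
  \<comment> \<open>The colon ideals of the powers of \<open>a\<close> stabilise at some
    \<open>n\<close>. If \<open>a ^ n\<close> were outside \<open>K\<close>, then x = k + s a^n; as
    \<open>a * x\<close> lies in \<open>K\<close>, so does s a^(n+1), hence s a^n, and finally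
    \<open>x\<close> itself.\<close>
  have nil: "\<exists>n. a ^ n \<in> K" if a: "a \<in> M" for a
  proof -
    have aS: "a \<in> S" using a by blast
    have colon: "ideal_set S {y \<in> S. y * a ^ n \<in> K}" for n
      using K.colon_ideal aS by blast
    have "{y \<in> S. y * a ^ n \<in> K} \<subseteq> {y \<in> S. y * a ^ Suc n \<in> K}" for n
    proof
      fix y assume y: "y \<in> {y \<in> S. y * a ^ n \<in> K}"
      then have "a * (y * a ^ n) \<in> K" using aS by blast
      then show "y \<in> {y \<in> S. y * a ^ Suc n \<in> K}" using y by (simp add: algebra_simps)
    qed
    then obtain n where
        n: "\<And>k. k \<ge> n \<Longrightarrow> {y \<in> S. y * a ^ k \<in> K} = {y \<in> S. y * a ^ n \<in> K}"
      using noetherian_set_stable[of S "\<lambda>n. {y \<in> S. y * a ^ n \<in> K}"] noeth colon by blast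
    have "a ^ n \<in> K"
    proof (rule ccontr)
      assume "a ^ n \<notin> K"
      from generate[OF K.power_in[OF aS] this] obtain k s where
          ks: "k \<in> K" "s \<in> S" "x = k + s * a ^ n"
        by blast
      have "a * x - a * k \<in> K" using a ks(1) aS unfolding M_def by blast
      then have "s * a ^ Suc n \<in> K" unfolding ks(3) by (simp add: algebra_simps)
      then have "s \<in> {y \<in> S. y * a ^ Suc n \<in> K}" using ks(2) by simp
      also have "{y \<in> S. y * a ^ Suc n \<in> K} = {y \<in> S. y * a ^ n \<in> K}" by (rule n) simp
      finally have "s * a ^ n \<in> K" by blast
      then have "x \<in> K" unfolding ks(3) using ks(1) by blast
      then show False using K(3) by blast
    qed
    then show ?thesis by blast
  qed
  \<comment> \<open>Otherwise an ideal \<open>L\<close> above \<open>K\<close>, maximal with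
    infinite index, would be prime. It would contain the nil ideal \<open>M\<close> modulo
    \<open>K\<close>, whose index is finite.\<close>
  have "finite_mod S K"
  proof (rule ccontr)
    assume "\<not> finite_mod S K"
    then obtain L where L: "ideal_set S L" "K \<subseteq> L" "\<not> finite_mod S L"
        "\<forall>J. ideal_set S J \<longrightarrow> L \<subset> J \<longrightarrow> \<not> \<not> finite_mod S J"
      using noetherian_maximal[where Q = "\<lambda>K. \<not> finite_mod S K", OF noeth K(1)]
      by blast
    have "finite_mod S J" if "ideal_set S J" "L \<subset> J" for J
      using L(4)[rule_format, OF that] by blast
    from maximal_infinite_quotient_prime[OF L(1,3) this]
    interpret L: prime_set S L .
    have "M \<subseteq> L"
    proof
      fix a assume a: "a \<in> M"
      then obtain n where "a ^ n \<in> L" using nil L(2) by blast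
      then show "a \<in> L" using L.power_mem a by blast
    qed
    then show False using Mfin L(3) finite_mod_mono by blast
  qed
  with K show thesis by (intro that)
qed

lemma residually_finite_finite:
  assumes noeth: "noetherian_set S" and jac: "jacobson_set S" and I: "ideal_set S I"
    and F: "finite F" "F \<subseteq> S" "F \<inter> I = {}"
  shows "\<exists>K. ideal_set S K \<and> I \<subseteq> K \<and> finite_mod S K \<and> F \<inter> K = {}"
  using F
proof (induction F rule: finite_induct)
  case empty
  interpret I: ideal_set S I by fact
  have "ideal_set S S" by unfold_locales auto
  moreover have "finite_mod S S" 
    unfolding finite_mod_def by (intro exI[of _ "{0}"]) auto
  ultimately show ?case using I.subset by (intro exI[of _ S]) auto
next
  case (insert x F)
  then obtain K where K: "ideal_set S K" "I \<subseteq> K" "finite_mod S K" "F \<inter> K = {}" by blast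
  have "x \<in> S" "x \<notin> I"
    using insert.prems by auto
  then obtain L where L: "ideal_set S L" "I \<subseteq> L" "finite_mod S L" "x \<notin> L"
    by (rule residually_finite[OF noeth jac I])
  interpret K: ideal_set S K by fact
  interpret L: ideal_set S L by fact
  have "finite_mod K L" using L(3) K.subset finite_mod_mono by blast
  then have "finite_mod K (K \<inter> L)" by (rule L.finite_mod_Int[OF K(1)])
  then have "finite_mod S (K \<inter> L)" using K(3) finite_mod_trans by blast
  then show ?case using K L K.ideal_Int[OF L(1)] by (intro exI[of _ "K \<inter> L"]) auto
qed

section \<open>Infinite ideals and descending chains\<close>

text \<open>J/(J \<inter> K) embeds into S/K, so intersecting with an ideal of finite index removes
  only a finite part.\<close>

lemma infinite_quotient_Int:
  assumes "ideal_set S J" "ideal_set S K" "finite_mod S K" "\<not> finite_mod J I"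
  shows "\<not> finite_mod (J \<inter> K) I"
proof
  assume fin: "finite_mod (J \<inter> K) I"
  interpret J: ideal_set S J by fact
  interpret K: ideal_set S K by fact
  have "finite_mod J K" using assms(3) J.subset finite_mod_mono by blast
  then have "finite_mod J (J \<inter> K)" by (rule K.finite_mod_Int[OF assms(1)])
  then show False using fin assms(4) finite_mod_trans by blast
qed

text \<open>An ideal of finite index above \<open>I\<close> that avoids some \<open>x\<close> in
  \<open>L\<close> outside \<open>I\<close> cuts \<open>L\<close> down strictly and leaves it
  infinite over \<open>I\<close>, so the step can be repeated forever.\<close>

lemma infinite_quotient_chain:
  assumes noeth: "noetherian_set S" and jac: "jacobson_set S"
    and IJ: "ideal_set S I" "ideal_set S J" "I \<subseteq> J" "\<not> finite_mod J I"
  shows "\<exists>N :: nat \<Rightarrow> _. \<forall>k. ideal_set S (N k) \<and> I \<subseteq> N k \<and> N k \<subseteq> J \<and> N (Suc k) \<subset> N k"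
proof -
  define P where "P L \<longleftrightarrow> ideal_set S L \<and> I \<subseteq> L \<and> L \<subseteq> J \<and> \<not> finite_mod L I" for L
  have "\<exists>L'. P L' \<and> L' \<subset> L" if "P L" for L
  proof -
    interpret I: ideal_set S I by fact
    have L: "ideal_set S L" "I \<subseteq> L" "L \<subseteq> J" "\<not> finite_mod L I"
      using that by (simp_all add: P_def)
    interpret L: ideal_set S L by fact
    have "\<not> L \<subseteq> I"
      using L(4) finite_mod_mono[OF I.finite_mod_self] by blast
    then obtain x where x: "x \<in> L" "x \<notin> I" by blast
    from L.in_carrier[OF x(1)] x(2) obtain K where
        K: "ideal_set S K" "I \<subseteq> K" "finite_mod S K" "x \<notin> K"
      by (rule residually_finite[OF noeth jac IJ(1)])
    have "\<not> finite_mod (L \<inter> K) I"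
      by (rule infinite_quotient_Int[OF L(1) K(1,3) L(4)])
    then have "P (L \<inter> K)"
      unfolding P_def using L K(2) L.ideal_Int[OF K(1)] by auto
    moreover have "L \<inter> K \<subset> L"
      using x K(4) by auto
    ultimately show ?thesis by blast
  qed
  then obtain h where h: "\<And>L. P L \<Longrightarrow> P (h L) \<and> h L \<subset> L"
    by metis
  have PN: "P ((h ^^ k) J)" for k
  proof (induction k)
    case 0
    show ?case using IJ by (simp add: P_def)
  next
    case (Suc k)
    then show ?case using h by simp
  qed
  have "(h ^^ Suc k) J \<subset> (h ^^ k) J" for k
    using h[OF PN[of k]] by simp
  with PN show ?thesis
    unfolding P_def by (intro exI[of _ "\<lambda>k. (h ^^ k) J"]) blast
qed

section \<open>Finite generation\<close>

lemma ideal_set_Inter: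
  assumes "\<J> \<noteq> {}" "\<And>J. J \<in> \<J> \<Longrightarrow> ideal_set S J"
  shows "ideal_set S (\<Inter>\<J>)"
proof -
  obtain J0 where "J0 \<in> \<J>" using assms(1) by blast
  then interpret J0: ideal_set S J0 using assms(2) by blast
  show ?thesis
  proof
    show "\<Inter>\<J> \<subseteq> S" using \<open>J0 \<in> \<J>\<close> J0.subset by blast
    show "0 \<in> \<Inter>\<J>" using ideal_set.zero_mem[OF assms(2)] by blast
    show "a + b \<in> \<Inter>\<J>" if "a \<in> \<Inter>\<J>" "b \<in> \<Inter>\<J>" for a b
      using that ideal_set.add_mem[OF assms(2)] by auto
    show "s * a \<in> \<Inter>\<J>" if "s \<in> S" "a \<in> \<Inter>\<J>" for s a
      using that ideal_set.mult_mem[OF assms(2)] by auto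
  qed
qed

definition ideal_hull :: "'r::comm_ring_1 set \<Rightarrow> 'r set \<Rightarrow> 'r set"
  where "ideal_hull S G = \<Inter>{J. ideal_set S J \<and> G \<subseteq> J}"

lemma ideal_hull_ideal: "ideal_set S I \<Longrightarrow> G \<subseteq> I \<Longrightarrow> ideal_set S (ideal_hull S G)"
  unfolding ideal_hull_def by (rule ideal_set_Inter) auto

lemma ideal_hull_least: "ideal_set S I \<Longrightarrow> G \<subseteq> I \<Longrightarrow> ideal_hull S G \<subseteq> I"
  unfolding ideal_hull_def by blast

lemma ideal_hull_superset: "G \<subseteq> ideal_hull S G"
  unfolding ideal_hull_def by blast

lemma noetherian_finitely_generated:
  assumes noeth: "noetherian_set S" and I: "ideal_set S I"
  obtains G where "finite G" "G \<subseteq> I" "I = ideal_hull S G"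
proof -
  define Q where "Q K \<longleftrightarrow> (\<exists>G. finite G \<and> G \<subseteq> I \<and> K = ideal_hull S G)" for K
  have 1: "ideal_set S (ideal_hull S {})" using ideal_hull_ideal[OF I] by blast
  have 2: "Q (ideal_hull S {})" unfolding Q_def by blast
  obtain K where "ideal_set S K" "ideal_hull S {} \<subseteq> K"
      and K: "Q K" "\<forall>J. ideal_set S J \<longrightarrow> K \<subset> J \<longrightarrow> \<not> Q J"
    using noetherian_maximal[where Q = Q, OF noeth 1 2] by (elim exE conjE) (rule that)
  then obtain G where G: "finite G" "G \<subseteq> I" "K = ideal_hull S G" unfolding Q_def by blast
  have "I \<subseteq> K"
  proof (rule ccontr)
    assume "\<not> I \<subseteq> K"
    then obtain x where x: "x \<in> I" "x \<notin> K" by blast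
    have "K \<subseteq> ideal_hull S (insert x G)"
      unfolding G(3) ideal_hull_def by blast
    moreover have "x \<in> ideal_hull S (insert x G)"
      using ideal_hull_superset by blast
    ultimately have "K \<subset> ideal_hull S (insert x G)" using x by blast
    moreover have "ideal_set S (ideal_hull S (insert x G))"
      using ideal_hull_ideal[OF I] x(1) G(2) by blast
    moreover have "Q (ideal_hull S (insert x G))"
      unfolding Q_def using G x(1) by (intro exI[of _ "insert x G"]) auto
    ultimately show False using K(2) by blast
  qed
  then have "I = ideal_hull S G"
    using ideal_hull_least[OF I G(2)] G(3) by blast
  with G(1,2) show thesis by (rule that)
qed

text \<open>Guarantees that the supremum in \<open>ideal_length\<close> is over a countable set and
  hence an upper bound.\<close>

lemma countable_ideals:
  assumes "noetherian_set S" "countable S"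
  shows "countable {I. ideal_set S I}"
proof (rule countable_subset)
  show "{I. ideal_set S I} \<subseteq> ideal_hull S ` {G. finite G \<and> G \<subseteq> S}"
  proof
    fix I assume "I \<in> {I. ideal_set S I}"
    then have I: "ideal_set S I" by blast
    then obtain G where "finite G" "G \<subseteq> I" "I = ideal_hull S G"
      by (rule noetherian_finitely_generated[OF assms(1)])
    then show "I \<in> ideal_hull S ` {G. finite G \<and> G \<subseteq> S}"
      using ideal_set.subset[OF I] by blast
  qed
  show "countable (ideal_hull S ` {G. finite G \<and> G \<subseteq> S})"
    using assms(2) by (intro countable_image countable_Collect_finite_subset)
qed

text \<open>A maximal such ideal is the largest one: for \<open>J\<close> finite over
  \<open>I\<close>, the sum of \<open>M\<close> and \<open>J\<close> is finite over
  \<open>M\<close>, hence over \<open>I\<close>, and so equals \<open>M\<close>.\<close>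

lemma largest_finite_extension:
  assumes noeth: "noetherian_set S" and I: "ideal_set S I"
  obtains M where "ideal_set S M" "I \<subseteq> M" "finite_mod M I"
    "\<And>J. ideal_set S J \<Longrightarrow> finite_mod J I \<Longrightarrow> J \<subseteq> M"
proof -
  interpret I: ideal_set S I by fact
  obtain M where M: "ideal_set S M" "I \<subseteq> M" "finite_mod M I"
      "\<forall>J. ideal_set S J \<longrightarrow> M \<subset> J \<longrightarrow> \<not> finite_mod J I"
    using noetherian_maximal[where Q = "\<lambda>J. finite_mod J I", OF noeth I I.finite_mod_self]
    by (elim exE conjE) (rule that)
  interpret M: ideal_set S M by fact
  have "J \<subseteq> M" if J: "ideal_set S J" "finite_mod J I" for J
  proof -
    interpret J: ideal_set S J by fact
    let ?K = "{a + b | a b. a \<in> M \<and> b \<in> J}"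
    obtain F where F: "finite F" "\<And>s. s \<in> J \<Longrightarrow> \<exists>f\<in>F. s - f \<in> I"
      using J(2) unfolding finite_mod_def by metis
    have "\<exists>f\<in>F. s - f \<in> M" if sK: "s \<in> ?K" for s
    proof -
      obtain a b where ab: "s = a + b" "a \<in> M" "b \<in> J" using sK by blast
      obtain f where f: "f \<in> F" "b - f \<in> I" using F(2)[OF ab(3)] by blast
      then have "a + (b - f) \<in> M" using ab M(2) by blast
      then show ?thesis using f(1) ab(1) by (intro bexI[of _ f]) (simp_all add: algebra_simps)
    qed
    then have "finite_mod ?K M" unfolding finite_mod_def using F(1) by blast
    then have "finite_mod ?K I" using M(3) finite_mod_trans by blast
    moreover have "M \<subseteq> ?K"
    proof
      fix a assume "a \<in> M"
      then show "a \<in> ?K" by (intro CollectI exI[of _ a] exI[of _ 0]) auto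
    qed
    moreover have "J \<subseteq> ?K"
    proof
      fix a assume "a \<in> J"
      then show "a \<in> ?K" by (intro CollectI exI[of _ 0] exI[of _ a]) auto
    qed
    ultimately show ?thesis
      using M(4) M.ideal_sum[OF J(1)] by blast
  qed
  with M(1-3) show thesis by (intro that)
qed

section \<open>The reduced length of a quotient\<close>

definition infinite_quotient :: "'r::comm_ring_1 set \<Rightarrow> 'r set \<Rightarrow> 'r set \<Rightarrow> bool"
  where "infinite_quotient S I J \<longleftrightarrow>
    ideal_set S I \<and> ideal_set S J \<and> I \<subseteq> J \<and> \<not> finite_mod J I"

lemma infinite_quotient_psubset: "infinite_quotient S I J \<Longrightarrow> I \<subset> J"
  unfolding infinite_quotient_def using ideal_set.finite_mod_self[of S I] by auto

lemma wf_infinite_quotient: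
  "wf {((T, J), (S, I)). T = S \<and> noetherian_set S \<and> infinite_quotient S I J}" (is "wf ?R")
  unfolding wf_iff_no_infinite_down_chain
proof
  assume "\<exists>f. \<forall>i. (f (Suc i), f i) \<in> ?R"
  then obtain f where f: "\<And>i. (f (Suc i), f i) \<in> ?R" by blast
  have f': "fst (f (Suc i)) = fst (f i)" "noetherian_set (fst (f i))"
      "infinite_quotient (fst (f i)) (snd (f i)) (snd (f (Suc i)))" for i
    using f[of i] by (cases "f i"; cases "f (Suc i)"; simp)+
  have const: "fst (f i) = fst (f 0)" for i
    by (induction i) (simp_all only: f'(1))
  have chain: "noetherian_set (fst (f 0))"
      "infinite_quotient (fst (f 0)) (snd (f i)) (snd (f (Suc i)))" for i
    using f'(2)[of 0] f'(3)[of i] unfolding const[of i] by blast+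
  have down: "(snd (f (Suc i)), snd (f i)) \<in>
      {(J, I). ideal_set (fst (f 0)) I \<and> ideal_set (fst (f 0)) J \<and> I \<subset> J}" for i
    using infinite_quotient_psubset[OF chain(2)] chain(2) unfolding infinite_quotient_def by simp
  obtain k where "(snd (f (Suc k)), snd (f k)) \<notin>
      {(J, I). ideal_set (fst (f 0)) I \<and> ideal_set (fst (f 0)) J \<and> I \<subset> J}"
    by (rule wf_no_infinite_down_chainE[OF chain(1)[unfolded noetherian_set_def]])
  then show False
    by (rule notE) (rule down)
qed

text \<open>The reduced length of S/I with ideals above \<open>I\<close> in place of quotient rings,
  and infinite quotients J/I in place of non-artinian kernels.\<close>

function ideal_length :: "'r::comm_ring_1 set \<Rightarrow> 'r set \<Rightarrow> 'o :: wellorder" where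
  "ideal_length S I =
     (if noetherian_set S
      then ordinal_sup ((\<lambda>J. ordinal_succ (ideal_length S J)) ` {J. infinite_quotient S I J})
      else undefined)"
  by auto
termination
  by (relation "{((T, J), (S, I)). T = S \<and> noetherian_set S \<and> infinite_quotient S I J}")
    (rule wf_infinite_quotient, simp)

declare ideal_length.simps [simp del]

lemma ideal_length_less:
  assumes "noetherian_set S" "countable S" "infinite_quotient S I J"
  shows "ideal_length S J < (ideal_length S I :: 'o :: infinite ordinal)"
proof -
  have "countable {J. infinite_quotient S I J}"
    by (rule countable_subset[OF _ countable_ideals[OF assms(1,2)]]) (auto simp: infinite_quotient_def)
  then have "ordinal_succ (ideal_length S J) \<le> (ideal_length S I :: 'o ordinal)"
    unfolding ideal_length.simps[of S I] using assms(1,3)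
    by (auto intro!: ordinal_sup_upper)
  then show ?thesis
    using less_ordinal_succ[of "ideal_length S J :: 'o ordinal"] by (rule order_less_le_trans[rotated])
qed

text \<open>Together with \<open>ideal_length_less\<close> this provides the two inequalities behind
  the two assumptions of \<open>cb_rank_eq\<close>.\<close>

lemma ideal_length_lessD:
  assumes "noetherian_set S" "\<alpha> < (ideal_length S I :: 'o :: infinite ordinal)"
  obtains J where "infinite_quotient S I J" "\<alpha> \<le> ideal_length S J"
proof -
  have "\<exists>\<beta>\<in>(\<lambda>J. ordinal_succ (ideal_length S J)) ` {J. infinite_quotient S I J}. \<alpha> < \<beta>"
    using assms(2) unfolding ideal_length.simps[of S I] using assms(1)
    by (intro less_ordinal_supD) simp
  then show thesis
    using that by (auto simp: less_ordinal_succ_iff)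
qed

text \<open>An ideal that is infinite over the larger ideal \<open>J\<close> is also infinite over
  \<open>I\<close>.\<close>

lemma ideal_length_mono:
  assumes "noetherian_set S" "countable S" "ideal_set S I" "ideal_set S J" "I \<subseteq> J"
  shows "ideal_length S J \<le> (ideal_length S I :: 'o :: infinite ordinal)"
proof (rule leI, rule notI)
  assume "ideal_length S I < (ideal_length S J :: 'o ordinal)"
  then obtain K where K: "infinite_quotient S J K" "(ideal_length S I :: 'o ordinal) \<le> ideal_length S K"
    by (rule ideal_length_lessD[OF assms(1)])
  have "infinite_quotient S I K"
    using K(1) assms(3,5) finite_mod_mono[of K I K J] unfolding infinite_quotient_def by blast
  from ideal_length_less[OF assms(1,2) this] show False
    using K(2) by (meson leD)
qed

section \<open>Integer polynomials in finitely many variables\<close>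

definition mvar :: "nat \<Rightarrow> int_mpoly"
  where "mvar i = Poly_Mapping.single (Poly_Mapping.single i 1) 1"

lemma int_mpolys_subring: "subring_set (int_mpolys n)"
proof
  show "1 \<in> int_mpolys n"
    using keys_one by (auto simp: int_mpolys_def)
  fix P Q assume PQ: "P \<in> int_mpolys n" "Q \<in> int_mpolys n"
  show "P - Q \<in> int_mpolys n"
    using PQ keys_diff[of P Q] unfolding int_mpolys_def by blast
  show "P * Q \<in> int_mpolys n"
    unfolding int_mpolys_def
  proof (intro CollectI ballI)
    fix m assume "m \<in> Poly_Mapping.keys (P * Q)"
    then obtain k l where kl: "m = k + l" "k \<in> Poly_Mapping.keys P" "l \<in> Poly_Mapping.keys Q"
      using keys_mult[of P Q] by blast
    then have "Poly_Mapping.keys k \<subseteq> {..<n}" "Poly_Mapping.keys l \<subseteq> {..<n}"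
      using PQ by (simp_all add: int_mpolys_def)
    then show "Poly_Mapping.keys m \<subseteq> {..<n}"
      unfolding kl(1) using Poly_Mapping.keys_add[of k l] by blast
  qed
qed

lemma single_in_int_mpolys: "Poly_Mapping.keys m \<subseteq> {..<n} \<Longrightarrow> Poly_Mapping.single m c \<in> int_mpolys n"
  by (auto simp: int_mpolys_def)

lemma mvar_in_int_mpolys: "i < n \<Longrightarrow> mvar i \<in> int_mpolys n"
  unfolding mvar_def by (rule single_in_int_mpolys) simp

lemma mpoly_sum_singles:
  fixes P :: int_mpoly
  shows "P = (\<Sum>m\<in>Poly_Mapping.keys P. Poly_Mapping.single m (Poly_Mapping.lookup P m))"
proof (rule poly_mapping_eqI)
  fix k
  have "(\<Sum>m\<in>Poly_Mapping.keys P. Poly_Mapping.lookup (Poly_Mapping.single m (Poly_Mapping.lookup P m)) k)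
      = (\<Sum>m\<in>Poly_Mapping.keys P. if m = k then Poly_Mapping.lookup P k else 0)"
    by (intro sum.cong) (auto simp: lookup_single when_def)
  also have "\<dots> = Poly_Mapping.lookup P k"
    by (simp add: in_keys_iff)
  finally show "Poly_Mapping.lookup P k = Poly_Mapping.lookup
      (\<Sum>m\<in>Poly_Mapping.keys P. Poly_Mapping.single m (Poly_Mapping.lookup P m)) k"
    by (simp add: lookup_sum)
qed

lemma int_mpolys_0: "int_mpolys 0 = range of_int"
proof
  show "range of_int \<subseteq> int_mpolys 0"
    using subring_set.of_int_in[OF int_mpolys_subring] by blast
  show "int_mpolys 0 \<subseteq> range of_int"
  proof
    fix P assume "P \<in> int_mpolys 0"
    then have "Poly_Mapping.keys P \<subseteq> {0}"
      by (auto simp: int_mpolys_def)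
    then have "P = Poly_Mapping.single 0 (Poly_Mapping.lookup P 0)"
      by (intro poly_mapping_eqI) (auto simp: lookup_single when_def in_keys_iff)
    also have "\<dots> = of_int (Poly_Mapping.lookup P 0)"
      by (metis of_int_eq_id id_apply single_of_int)
    finally show "P \<in> range of_int" by blast
  qed
qed

lemma mvar_power: "mvar i ^ k = Poly_Mapping.single (Poly_Mapping.single i k) 1"
proof (induction k)
  case (Suc k)
  have "mvar i ^ Suc k = mvar i * mvar i ^ k" by simp
  then show ?case
    unfolding Suc by (simp add: mvar_def mult_single single_add[symmetric])
qed simp

text \<open>All polynomial rings sit inside the one type \<open>int_mpoly\<close>, so one more
  variable is an instance of \<open>adjoin\<close>. This carries the basis theorem and the
  Nullstellensatz from the integers to \<open>int_mpolys n\<close>.\<close>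

lemma int_mpolys_Suc: "int_mpolys (Suc n) = adjoin (int_mpolys n) (mvar n)"
proof
  interpret S: subring_set "int_mpolys n" by (rule int_mpolys_subring)
  interpret T: subring_set "int_mpolys (Suc n)" by (rule int_mpolys_subring)
  interpret U: subring_set "adjoin (int_mpolys n) (mvar n)" by (rule S.adjoin_subring)
  have sub: "int_mpolys n \<subseteq> int_mpolys (Suc n)"
    by (force simp: int_mpolys_def)
  show "adjoin (int_mpolys n) (mvar n) \<subseteq> int_mpolys (Suc n)"
    unfolding adjoin_def poly_altdef polys_over_def
    using sub mvar_in_int_mpolys[of n "Suc n"] by (auto intro!: T.sum_in T.mult_in T.power_in)
  show "int_mpolys (Suc n) \<subseteq> adjoin (int_mpolys n) (mvar n)"
  proof
    fix P assume P: "P \<in> int_mpolys (Suc n)"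
    have "Poly_Mapping.single m c \<in> adjoin (int_mpolys n) (mvar n)"
      if m: "m \<in> Poly_Mapping.keys P" for m c
    proof -
      \<comment> \<open>Setting the exponent of the last variable to 0 splits the monomial into one
        in the first \<open>n\<close> variables and a power of \<open>mvar n\<close>.\<close>
      define m' where "m' = Poly_Mapping.update n 0 m"
      have "m' + Poly_Mapping.single n (Poly_Mapping.lookup m n) = m"
        by (rule poly_mapping_eqI) (auto simp: m'_def lookup_add lookup_update lookup_single when_def)
      then have "Poly_Mapping.single m c
          = Poly_Mapping.single m' c * mvar n ^ Poly_Mapping.lookup m n"
        unfolding mvar_power by (simp add: mult_single)
      moreover have "Poly_Mapping.keys m \<subseteq> {..<Suc n}"
        using P m by (simp add: int_mpolys_def)
      then have "Poly_Mapping.keys m' \<subseteq> {..<n}"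
        by (auto simp: m'_def keys_update)
      then have "Poly_Mapping.single m' c \<in> adjoin (int_mpolys n) (mvar n)"
        using single_in_int_mpolys S.subset_adjoin(1) by blast
      ultimately show ?thesis
        using S.subset_adjoin(2) by (auto intro!: U.mult_in U.power_in)
    qed
    then show "P \<in> adjoin (int_mpolys n) (mvar n)"
      by (subst mpoly_sum_singles) (rule U.sum_in)
  qed
qed

lemma noetherian_int_mpolys: "noetherian_set (int_mpolys n)"
proof (induction n)
  case 0
  show ?case unfolding int_mpolys_0 by (rule noetherian_of_int)
next
  case (Suc n)
  then show ?case
    unfolding int_mpolys_Suc by (rule subring_set.noetherian_adjoin[OF int_mpolys_subring])
qed

lemma jacobson_int_mpolys: "jacobson_set (int_mpolys n)"
proof (induction n)
  case 0
  show ?case unfolding int_mpolys_0 by (rule jacobson_of_int)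
next
  case (Suc n)
  then show ?case
    unfolding int_mpolys_Suc by (rule subring_set.jacobson_adjoin[OF int_mpolys_subring])
qed

lemma countable_adjoin:
  assumes "countable S"
  shows "countable (adjoin S x)"
proof (rule countable_subset)
  show "adjoin S x \<subseteq> (\<lambda>cs. poly (Poly cs) x) ` lists S"
  proof
    fix a assume "a \<in> adjoin S x"
    then obtain p where p: "a = poly p x" "p \<in> polys_over S"
      unfolding adjoin_def by blast
    have "set (coeffs p) \<subseteq> S"
      using p(2) by (auto simp: polys_over_def coeffs_def split: if_splits)
    then show "a \<in> (\<lambda>cs. poly (Poly cs) x) ` lists S"
      using p(1) by (intro image_eqI[of _ _ "coeffs p"]) (auto simp: in_lists_conv_set)
  qed
  show "countable ((\<lambda>cs. poly (Poly cs) x) ` lists S)"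
    using assms by (intro countable_image countable_lists)
qed

lemma countable_int_mpolys: "countable (int_mpolys n)"
proof (induction n)
  case 0
  show ?case unfolding int_mpolys_0 by simp
next
  case (Suc n)
  then show ?case unfolding int_mpolys_Suc by (rule countable_adjoin)
qed

text \<open>Used as an induction principle: with \<open>U\<close> the set of polynomials satisfying
  an identity, it remains to check the variables and closure under the ring operations.\<close>

lemma int_mpolys_least:
  assumes "subring_set U" "\<And>i. i < n \<Longrightarrow> mvar i \<in> U"
  shows "int_mpolys n \<subseteq> U"
  using assms(2)
proof (induction n)
  interpret U: subring_set U by fact
  case 0
  show ?case unfolding int_mpolys_0 by auto
next
  interpret U: subring_set U by fact
  case (Suc n)
  then have "int_mpolys n \<subseteq> U" "mvar n \<in> U" by auto
  then show ?case
    unfolding int_mpolys_Suc adjoin_def poly_altdef polys_over_def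
    by (auto intro!: U.sum_in U.mult_in U.power_in)
qed

lemma int_mpolys_induct [consumes 1, case_names zero add]:
  assumes P: "P \<in> int_mpolys n" and "prop 0"
    and step: "\<And>m c Q. Poly_Mapping.keys m \<subseteq> {..<n} \<Longrightarrow> Q \<in> int_mpolys n \<Longrightarrow> prop Q
      \<Longrightarrow> prop (Poly_Mapping.single m c + Q)"
  shows "prop P"
proof -
  interpret S: subring_set "int_mpolys n" by (rule int_mpolys_subring)
  let ?s = "\<lambda>K. \<Sum>m\<in>K. Poly_Mapping.single m (Poly_Mapping.lookup P m)"
  have "?s K \<in> int_mpolys n \<and> prop (?s K)" if "finite K" "K \<subseteq> Poly_Mapping.keys P" for K
    using that
  proof (induction K rule: finite_induct)
    case (insert m K)
    have m: "Poly_Mapping.keys m \<subseteq> {..<n}"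
      using P insert.prems by (auto simp: int_mpolys_def)
    have "?s (insert m K) = Poly_Mapping.single m (Poly_Mapping.lookup P m) + ?s K"
      using insert.hyps by simp
    then show ?case
      using insert.IH insert.prems step[OF m] S.add_in[OF single_in_int_mpolys[OF m]] by simp
  qed (use assms(2) in simp)
  from this[of "Poly_Mapping.keys P"] show ?thesis
    using mpoly_sum_singles[of P] by simp
qed

section \<open>Evaluation\<close>

locale marked_cring = cring A for A :: "'a ring" +
  fixes n :: nat and xs :: "'a list"
  assumes length_xs: "length xs = n" and xs_carrier: "set xs \<subseteq> carrier A"
begin

lemma xs_closed [simp]: "i < n \<Longrightarrow> xs ! i \<in> carrier A"
  using length_xs xs_carrier by auto

lemma add_pow_0_int: "add_pow A (0 :: int) x = \<zero>\<^bsub>A\<^esub>"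
  by (simp add: add_pow_def int_pow_def nat_pow_def)

text \<open>The product runs over all \<open>n\<close> variables rather than the support of
  \<open>m\<close>, so that monomials multiply factor by factor.\<close>

definition eval_monom :: "(nat \<Rightarrow>\<^sub>0 nat) \<Rightarrow> 'a"
  where "eval_monom m = (\<Otimes>\<^bsub>A\<^esub>i\<in>{..<n}. xs ! i [^]\<^bsub>A\<^esub> Poly_Mapping.lookup m i)"

lemma eval_monom_closed [simp]: "eval_monom m \<in> carrier A"
  unfolding eval_monom_def by (rule finprod_closed) auto

lemma eval_monom_eq:
  assumes "Poly_Mapping.keys m \<subseteq> {..<n}"
  shows "(\<Otimes>\<^bsub>A\<^esub>i\<in>Poly_Mapping.keys m. xs ! i [^]\<^bsub>A\<^esub> Poly_Mapping.lookup m i) = eval_monom m"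
  unfolding eval_monom_def
  by (rule finprod_mono_neutral_cong_left) (use assms in \<open>auto simp: in_keys_iff\<close>)

lemma eval_monom_add: "eval_monom (k + l) = eval_monom k \<otimes>\<^bsub>A\<^esub> eval_monom l"
proof -
  have "eval_monom (k + l) = (\<Otimes>\<^bsub>A\<^esub>i\<in>{..<n}. xs ! i [^]\<^bsub>A\<^esub> Poly_Mapping.lookup k i
      \<otimes>\<^bsub>A\<^esub> xs ! i [^]\<^bsub>A\<^esub> Poly_Mapping.lookup l i)"
    unfolding eval_monom_def by (rule finprod_cong') (auto simp: lookup_add nat_pow_mult)
  also have "\<dots> = eval_monom k \<otimes>\<^bsub>A\<^esub> eval_monom l"
    unfolding eval_monom_def by (rule finprod_multf) auto
  finally show ?thesis .
qed

text \<open>Terms outside the support have coefficient 0; polynomials with different supports can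
  therefore be added over a common index set.\<close>

lemma eval_mpoly_superset:
  assumes "P \<in> int_mpolys n" "finite K" "Poly_Mapping.keys P \<subseteq> K"
  shows "eval_mpoly A xs P = (\<Oplus>\<^bsub>A\<^esub>m\<in>K. [Poly_Mapping.lookup P m] \<cdot>\<^bsub>A\<^esub> eval_monom m)"
proof -
  have "eval_mpoly A xs P = (\<Oplus>\<^bsub>A\<^esub>m\<in>Poly_Mapping.keys P. [Poly_Mapping.lookup P m] \<cdot>\<^bsub>A\<^esub> eval_monom m)"
    unfolding eval_mpoly_def using assms(1)
    by (intro add.finprod_cong') (auto simp: int_mpolys_def eval_monom_eq)
  also have "\<dots> = (\<Oplus>\<^bsub>A\<^esub>m\<in>K. [Poly_Mapping.lookup P m] \<cdot>\<^bsub>A\<^esub> eval_monom m)"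
    using assms(2,3)
    by (intro add.finprod_mono_neutral_cong_left) (auto simp: in_keys_iff add_pow_0_int)
  finally show ?thesis .
qed

lemma eval_mpoly_closed [simp]: "P \<in> int_mpolys n \<Longrightarrow> eval_mpoly A xs P \<in> carrier A"
  by (subst eval_mpoly_superset[where K = "Poly_Mapping.keys P"]) (auto intro!: finsum_closed)

lemma eval_mpoly_add:
  assumes "P \<in> int_mpolys n" "Q \<in> int_mpolys n"
  shows "eval_mpoly A xs (P + Q) = eval_mpoly A xs P \<oplus>\<^bsub>A\<^esub> eval_mpoly A xs Q"
proof -
  let ?K = "Poly_Mapping.keys P \<union> Poly_Mapping.keys Q"
  have "P + Q \<in> int_mpolys n"
    using subring_set.add_in[OF int_mpolys_subring assms] .
  then have "eval_mpoly A xs (P + Q)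
      = (\<Oplus>\<^bsub>A\<^esub>m\<in>?K. [Poly_Mapping.lookup (P + Q) m] \<cdot>\<^bsub>A\<^esub> eval_monom m)"
    by (rule eval_mpoly_superset) (use Poly_Mapping.keys_add[of P Q] in auto)
  also have "\<dots> = (\<Oplus>\<^bsub>A\<^esub>m\<in>?K. [Poly_Mapping.lookup P m] \<cdot>\<^bsub>A\<^esub> eval_monom m
      \<oplus>\<^bsub>A\<^esub> [Poly_Mapping.lookup Q m] \<cdot>\<^bsub>A\<^esub> eval_monom m)"
    by (rule add.finprod_cong') (auto simp: lookup_add add.int_pow_mult)
  also have "\<dots> = (\<Oplus>\<^bsub>A\<^esub>m\<in>?K. [Poly_Mapping.lookup P m] \<cdot>\<^bsub>A\<^esub> eval_monom m)
      \<oplus>\<^bsub>A\<^esub> (\<Oplus>\<^bsub>A\<^esub>m\<in>?K. [Poly_Mapping.lookup Q m] \<cdot>\<^bsub>A\<^esub> eval_monom m)"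
    by (rule add.finprod_multf) auto
  finally show ?thesis
    using eval_mpoly_superset[OF assms(1), of ?K] eval_mpoly_superset[OF assms(2), of ?K] by simp
qed

lemma eval_mpoly_single:
  assumes "Poly_Mapping.keys m \<subseteq> {..<n}"
  shows "eval_mpoly A xs (Poly_Mapping.single m c) = [c] \<cdot>\<^bsub>A\<^esub> eval_monom m"
  using eval_mpoly_superset[OF single_in_int_mpolys[OF assms], of "{m}" c] by simp

lemma eval_mpoly_0: "eval_mpoly A xs 0 = \<zero>\<^bsub>A\<^esub>"
  by (simp add: eval_mpoly_def)

lemma eval_mpoly_1: "eval_mpoly A xs 1 = \<one>\<^bsub>A\<^esub>"
proof -
  have "eval_monom 0 = \<one>\<^bsub>A\<^esub>"
    unfolding eval_monom_def by (simp add: finprod_one_eqI)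
  then show ?thesis
    using eval_mpoly_single[of 0 1] by simp
qed

lemma eval_mvar:
  assumes "i < n"
  shows "eval_mpoly A xs (mvar i) = xs ! i"
proof -
  have "eval_monom (Poly_Mapping.single i 1) = xs ! i"
    using eval_monom_eq[of "Poly_Mapping.single i 1"] assms by simp
  then show ?thesis
    using eval_mpoly_single[of "Poly_Mapping.single i 1" 1] assms by (simp add: mvar_def)
qed

lemma eval_mpoly_mult:
  assumes P: "P \<in> int_mpolys n" and Q: "Q \<in> int_mpolys n"
  shows "eval_mpoly A xs (P * Q) = eval_mpoly A xs P \<otimes>\<^bsub>A\<^esub> eval_mpoly A xs Q"
proof -
  interpret S: subring_set "int_mpolys n" by (rule int_mpolys_subring)
  have single: "eval_mpoly A xs (Poly_Mapping.single m c * Q)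
      = eval_mpoly A xs (Poly_Mapping.single m c) \<otimes>\<^bsub>A\<^esub> eval_mpoly A xs Q"
    if m: "Poly_Mapping.keys m \<subseteq> {..<n}" for m c
    using Q
  proof (induction Q rule: int_mpolys_induct)
    case zero
    then show ?case using single_in_int_mpolys[OF m] by (simp add: eval_mpoly_0)
  next
    case (add l d Q)
    have ml: "Poly_Mapping.keys (m + l) \<subseteq> {..<n}"
      using m add.hyps(1) Poly_Mapping.keys_add[of m l] by blast
    have "Poly_Mapping.single m c * (Poly_Mapping.single l d + Q)
        = Poly_Mapping.single (m + l) (c * d) + Poly_Mapping.single m c * Q"
      by (simp add: distrib_left mult_single)
    then have "eval_mpoly A xs (Poly_Mapping.single m c * (Poly_Mapping.single l d + Q))
        = eval_mpoly A xs (Poly_Mapping.single (m + l) (c * d))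
          \<oplus>\<^bsub>A\<^esub> eval_mpoly A xs (Poly_Mapping.single m c) \<otimes>\<^bsub>A\<^esub> eval_mpoly A xs Q"
      using add.hyps(2) add.IH single_in_int_mpolys[OF m] single_in_int_mpolys[OF ml]
      by (simp add: eval_mpoly_add)
    also have "eval_mpoly A xs (Poly_Mapping.single (m + l) (c * d))
        = eval_mpoly A xs (Poly_Mapping.single m c) \<otimes>\<^bsub>A\<^esub> eval_mpoly A xs (Poly_Mapping.single l d)"
      unfolding eval_mpoly_single[OF ml] eval_mpoly_single[OF m] eval_mpoly_single[OF add.hyps(1)]
      by (simp add: eval_monom_add add_pow_ldistr_int add_pow_rdistr_int add.int_pow_pow mult.commute)
    finally show ?case
      using add.hyps(1,2) single_in_int_mpolys[OF m] single_in_int_mpolys[OF add.hyps(1)]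
      by (simp add: eval_mpoly_add r_distr)
  qed
  show ?thesis
    using P
  proof (induction P rule: int_mpolys_induct)
    case zero
    then show ?case using Q by (simp add: eval_mpoly_0)
  next
    case (add m c P)
    then show ?case
      using Q single_in_int_mpolys[OF add.hyps(1)]
      by (simp add: distrib_right eval_mpoly_add single l_distr)
  qed
qed

end

section \<open>Marked rings and ideals\<close>

text \<open>The ideal of relations between the marks. It serves as the coordinate of a marked ring
  in the space.\<close>

definition marked_ker :: "nat \<Rightarrow> 'a ring \<Rightarrow> 'a list \<Rightarrow> int_mpoly set"
  where "marked_ker n A xs = {P \<in> int_mpolys n. eval_mpoly A xs P = \<zero>\<^bsub>A\<^esub>}"

context marked_cring
begin

lemma eval_mpoly_diff:
  assumes "P \<in> int_mpolys n" "Q \<in> int_mpolys n"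
  shows "eval_mpoly A xs (P - Q) = eval_mpoly A xs P \<ominus>\<^bsub>A\<^esub> eval_mpoly A xs Q"
proof -
  interpret S: subring_set "int_mpolys n" by (rule int_mpolys_subring)
  have PQ: "P - Q \<in> int_mpolys n" using assms by blast
  have "eval_mpoly A xs P = eval_mpoly A xs (P - Q) \<oplus>\<^bsub>A\<^esub> eval_mpoly A xs Q"
    using eval_mpoly_add[OF PQ assms(2)] by simp
  then show ?thesis
    using assms PQ by (simp add: a_minus_def a_assoc r_neg)
qed

lemma eval_mpoly_eq_iff:
  assumes "P \<in> int_mpolys n" "Q \<in> int_mpolys n"
  shows "eval_mpoly A xs P = eval_mpoly A xs Q \<longleftrightarrow> P - Q \<in> marked_ker n A xs"
proof -
  interpret S: subring_set "int_mpolys n" by (rule int_mpolys_subring)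
  have "P - Q \<in> int_mpolys n" using assms by blast
  then have "P - Q \<in> marked_ker n A xs \<longleftrightarrow> eval_mpoly A xs P \<ominus>\<^bsub>A\<^esub> eval_mpoly A xs Q = \<zero>\<^bsub>A\<^esub>"
    using assms by (simp add: marked_ker_def eval_mpoly_diff)
  then show ?thesis
    using assms by (metis eval_mpoly_closed r_right_minus_eq)
qed

lemma ideal_set_vimage:
  assumes "ideal K A"
  shows "ideal_set (int_mpolys n) {P \<in> int_mpolys n. eval_mpoly A xs P \<in> K}"
proof -
  interpret S: subring_set "int_mpolys n" by (rule int_mpolys_subring)
  interpret K: ideal K A by fact
  show ?thesis
    by unfold_locales (auto simp: eval_mpoly_0 eval_mpoly_add eval_mpoly_mult K.I_l_closed)
qed

lemma marked_ker_eq_vimage: "marked_ker n A xs = {P \<in> int_mpolys n. eval_mpoly A xs P \<in> {\<zero>\<^bsub>A\<^esub>}}"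
  by (simp add: marked_ker_def)

lemma marked_ker_ideal: "ideal_set (int_mpolys n) (marked_ker n A xs)"
  unfolding marked_ker_eq_vimage by (rule ideal_set_vimage[OF zeroideal])

lemma generate_ring_eq_image: "generate_ring A (set xs) = eval_mpoly A xs ` int_mpolys n"
proof
  interpret S: subring_set "int_mpolys n" by (rule int_mpolys_subring)
  have closed: "generate_ring A (set xs) \<subseteq> carrier A"
    using generate_ring_incl[OF xs_carrier] .
  let ?U = "{P \<in> int_mpolys n. eval_mpoly A xs P \<in> generate_ring A (set xs)}"
  have "subring_set ?U"
  proof
    show "1 \<in> ?U"
      by (auto simp: eval_mpoly_1 intro: generate_ring.one)
    fix P Q assume "P \<in> ?U" "Q \<in> ?U"
    then show "P - Q \<in> ?U" "P * Q \<in> ?U"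
      by (auto simp: eval_mpoly_diff eval_mpoly_mult a_minus_def
          intro: generate_ring.eng_add generate_ring.a_inv generate_ring.eng_mult)
  qed
  moreover have "mvar i \<in> ?U" if "i < n" for i
    using that length_xs by (auto simp: eval_mvar mvar_in_int_mpolys intro: generate_ring.incl)
  ultimately have "int_mpolys n \<subseteq> ?U"
    by (rule int_mpolys_least)
  then show "eval_mpoly A xs ` int_mpolys n \<subseteq> generate_ring A (set xs)"
    by blast
  show "generate_ring A (set xs) \<subseteq> eval_mpoly A xs ` int_mpolys n"
  proof
    fix a assume "a \<in> generate_ring A (set xs)"
    then show "a \<in> eval_mpoly A xs ` int_mpolys n"
    proof induction
      case one
      show ?case by (intro image_eqI[of _ _ 1]) (auto simp: eval_mpoly_1)
    next
      case (incl h)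
      then obtain i where "i < n" "h = xs ! i"
        using length_xs by (metis in_set_conv_nth)
      then show ?case
        by (intro image_eqI[of _ _ "mvar i"]) (auto simp: eval_mvar mvar_in_int_mpolys)
    next
      case (a_inv h)
      then obtain P where "h = eval_mpoly A xs P" "P \<in> int_mpolys n" by blast
      then show ?case
        using eval_mpoly_diff[of 0 P]
        by (intro image_eqI[of _ _ "0 - P"]) (auto simp: eval_mpoly_0 a_minus_def)
    next
      case (eng_add h k)
      then obtain P Q where "h = eval_mpoly A xs P" "P \<in> int_mpolys n"
        "k = eval_mpoly A xs Q" "Q \<in> int_mpolys n" by blast
      then show ?case
        by (intro image_eqI[of _ _ "P + Q"]) (auto simp: eval_mpoly_add)
    next
      case (eng_mult h k)
      then obtain P Q where "h = eval_mpoly A xs P" "P \<in> int_mpolys n"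
        "k = eval_mpoly A xs Q" "Q \<in> int_mpolys n" by blast
      then show ?case
        by (intro image_eqI[of _ _ "P * Q"]) (auto simp: eval_mpoly_mult)
    qed
  qed
qed

end

lemma marked_ring_iff:
  "marked_ring n A xs \<longleftrightarrow> marked_cring A n xs \<and> eval_mpoly A xs ` int_mpolys n = carrier A"
proof
  assume "marked_ring n A xs"
  then have *: "marked_cring A n xs" "generate_ring A (set xs) = carrier A"
    by (auto simp: marked_ring_def marked_cring_def marked_cring_axioms_def)
  then show "marked_cring A n xs \<and> eval_mpoly A xs ` int_mpolys n = carrier A"
    using marked_cring.generate_ring_eq_image[OF *(1)] by simp
next
  assume *: "marked_cring A n xs \<and> eval_mpoly A xs ` int_mpolys n = carrier A"
  then interpret marked_cring A n xs by blast
  show "marked_ring n A xs"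
    using * length_xs xs_carrier generate_ring_eq_image is_cring by (simp add: marked_ring_def)
qed

lemma cring_hom_image:
  assumes "cring A" "ring B" "h \<in> ring_hom A B" "h ` carrier A = carrier B"
  shows "cring B"
proof -
  interpret A: cring A by fact
  interpret B: ring B by fact
  show ?thesis
  proof unfold_locales
    fix x y assume "x \<in> carrier B" "y \<in> carrier B"
    then obtain a b where ab: "x = h a" "y = h b" "a \<in> carrier A" "b \<in> carrier A"
      unfolding assms(4)[symmetric] by blast
    then have "x \<otimes>\<^bsub>B\<^esub> y = h (a \<otimes>\<^bsub>A\<^esub> b)" "y \<otimes>\<^bsub>B\<^esub> x = h (b \<otimes>\<^bsub>A\<^esub> a)"
      using ring_hom_mult[OF assms(3)] by simp_all
    then show "x \<otimes>\<^bsub>B\<^esub> y = y \<otimes>\<^bsub>B\<^esub> x"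
      using A.m_comm[OF ab(3,4)] by simp
  qed
qed

lemma eval_mpoly_hom:
  assumes A: "marked_cring A n xs" and B: "cring B" and h: "h \<in> ring_hom A B"
  shows "marked_cring B n (map h xs)"
    and "P \<in> int_mpolys n \<Longrightarrow> eval_mpoly B (map h xs) P = h (eval_mpoly A xs P)"
proof -
  interpret A: marked_cring A n xs by fact
  interpret B: cring B by fact
  interpret h: ring_hom_cring A B h by unfold_locales (rule h)
  show B': "marked_cring B n (map h xs)"
    by unfold_locales (use A.length_xs A.xs_carrier in auto)
  interpret B': marked_cring B n "map h xs" by fact
  interpret S: subring_set "int_mpolys n" by (rule int_mpolys_subring)
  let ?U = "{P \<in> int_mpolys n. eval_mpoly B (map h xs) P = h (eval_mpoly A xs P)}"
  have "subring_set ?U"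
    by unfold_locales
      (auto simp: A.eval_mpoly_1 B'.eval_mpoly_1 A.eval_mpoly_diff B'.eval_mpoly_diff
        A.eval_mpoly_mult B'.eval_mpoly_mult a_minus_def)
  moreover have "mvar i \<in> ?U" if "i < n" for i
    using that A.length_xs by (auto simp: A.eval_mvar B'.eval_mvar mvar_in_int_mpolys)
  ultimately have "int_mpolys n \<subseteq> ?U"
    by (rule int_mpolys_least)
  then show "P \<in> int_mpolys n \<Longrightarrow> eval_mpoly B (map h xs) P = h (eval_mpoly A xs P)"
    by blast
qed

lemma marked_ring_hom_image:
  assumes A: "marked_ring n A xs" and B: "cring B"
    and h: "h \<in> ring_hom A B" "h ` carrier A = carrier B"
  shows "marked_ring n B (map h xs)"
    and "marked_ker n B (map h xs) = {P \<in> int_mpolys n. eval_mpoly A xs P \<in> a_kernel A B h}"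
proof -
  have A': "marked_cring A n xs" "eval_mpoly A xs ` int_mpolys n = carrier A"
    using A by (simp_all add: marked_ring_iff)
  note B' = eval_mpoly_hom[OF A'(1) B h(1)]
  have "eval_mpoly B (map h xs) ` int_mpolys n = h ` eval_mpoly A xs ` int_mpolys n"
    using B'(2) by (auto simp: image_image)
  then show "marked_ring n B (map h xs)"
    using B'(1) A'(2) h(2) by (simp add: marked_ring_iff)
  show "marked_ker n B (map h xs) = {P \<in> int_mpolys n. eval_mpoly A xs P \<in> a_kernel A B h}"
    using B'(2) marked_cring.eval_mpoly_closed[OF A'(1)]
    by (auto simp: marked_ker_def a_kernel_def')
qed

text \<open>The polynomial ring as a structure with a carrier, so that its quotients can be formed
  as marked rings.\<close>

definition mpoly_ring :: "nat \<Rightarrow> int_mpoly ring"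
  where "mpoly_ring n = \<lparr>carrier = int_mpolys n, monoid.mult = (\<lambda>P Q. P * Q), one = 1,
    ring.zero = 0, ring.add = (\<lambda>P Q. P + Q)\<rparr>"

lemma mpoly_ring_cring: "cring (mpoly_ring n)"
proof -
  interpret S: subring_set "int_mpolys n" by (rule int_mpolys_subring)
  show ?thesis
  proof (rule cringI)
    show "abelian_group (mpoly_ring n)"
    proof (rule abelian_groupI)
      fix P assume "P \<in> carrier (mpoly_ring n)"
      then show "\<exists>Q\<in>carrier (mpoly_ring n). Q \<oplus>\<^bsub>mpoly_ring n\<^esub> P = \<zero>\<^bsub>mpoly_ring n\<^esub>"
        by (intro bexI[of _ "- P"]) (auto simp: mpoly_ring_def)
    qed (auto simp: mpoly_ring_def algebra_simps)
    show "comm_monoid (mpoly_ring n)"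
      by (rule comm_monoidI) (auto simp: mpoly_ring_def algebra_simps)
  qed (auto simp: mpoly_ring_def algebra_simps)
qed

lemma mpoly_ring_marked:
  shows "marked_ring n (mpoly_ring n) (map mvar [0..<n])"
    and "P \<in> int_mpolys n \<Longrightarrow> eval_mpoly (mpoly_ring n) (map mvar [0..<n]) P = P"
proof -
  interpret S: subring_set "int_mpolys n" by (rule int_mpolys_subring)
  interpret R: cring "mpoly_ring n" by (rule mpoly_ring_cring)
  interpret M: marked_cring "mpoly_ring n" n "map mvar [0..<n]"
    by unfold_locales (auto simp: mpoly_ring_def mvar_in_int_mpolys)
  have minus: "P \<ominus>\<^bsub>mpoly_ring n\<^esub> Q = P - Q" if "P \<in> int_mpolys n" "Q \<in> int_mpolys n" for P Q
  proof -
    have "\<ominus>\<^bsub>mpoly_ring n\<^esub> Q = - Q"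
      using that by (intro R.minus_equality) (auto simp: mpoly_ring_def)
    then show ?thesis by (simp add: a_minus_def mpoly_ring_def)
  qed
  let ?U = "{P \<in> int_mpolys n. eval_mpoly (mpoly_ring n) (map mvar [0..<n]) P = P}"
  have "subring_set ?U"
  proof
    show "1 \<in> ?U" using M.eval_mpoly_1 by (simp add: mpoly_ring_def)
    fix P Q assume "P \<in> ?U" "Q \<in> ?U"
    then show "P - Q \<in> ?U" "P * Q \<in> ?U"
      using M.eval_mpoly_diff[of P Q] M.eval_mpoly_mult[of P Q] minus[of P Q]
      by (simp_all add: mpoly_ring_def)
  qed
  moreover have "mvar i \<in> ?U" if "i < n" for i
    using that by (auto simp: M.eval_mvar mvar_in_int_mpolys)
  ultimately have "int_mpolys n \<subseteq> ?U"
    by (rule int_mpolys_least)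
  then have ev: "eval_mpoly (mpoly_ring n) (map mvar [0..<n]) P = P" if "P \<in> int_mpolys n" for P
    using that by blast
  then show "P \<in> int_mpolys n \<Longrightarrow> eval_mpoly (mpoly_ring n) (map mvar [0..<n]) P = P" .
  have "eval_mpoly (mpoly_ring n) (map mvar [0..<n]) ` int_mpolys n = (\<lambda>P. P) ` int_mpolys n"
    by (rule image_cong[OF refl ev])
  then show "marked_ring n (mpoly_ring n) (map mvar [0..<n])"
    using M.marked_cring_axioms by (simp add: marked_ring_iff mpoly_ring_def)
qed

lemma ideal_image_eval:
  assumes A: "marked_ring n A xs" and J: "ideal_set (int_mpolys n) J"
  shows "ideal (eval_mpoly A xs ` J) A"
proof -
  interpret A: marked_cring A n xs using A by (simp add: marked_ring_iff)
  interpret J: ideal_set "int_mpolys n" J by fact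
  have surj: "eval_mpoly A xs ` int_mpolys n = carrier A"
    using A by (simp add: marked_ring_iff)
  show ?thesis
  proof (rule idealI)
    show "ring A" by (rule A.ring_axioms)
    show "subgroup (eval_mpoly A xs ` J) (add_monoid A)"
    proof (rule A.add.subgroupI)
      show "eval_mpoly A xs ` J \<subseteq> carrier A" using surj J.subset by blast
      show "eval_mpoly A xs ` J \<noteq> {}" using J.zero_mem by blast
      fix a assume "a \<in> eval_mpoly A xs ` J"
      then obtain P where P: "a = eval_mpoly A xs P" "P \<in> J" by blast
      then have "\<ominus>\<^bsub>A\<^esub> a = eval_mpoly A xs (0 - P)"
        using A.eval_mpoly_diff[of 0 P] J.in_carrier[OF P(2)]
        by (simp add: A.eval_mpoly_0 a_minus_def J.zero_in)
      then show "\<ominus>\<^bsub>A\<^esub> a \<in> eval_mpoly A xs ` J" using P(2) J.diff_mem[OF J.zero_mem] by blast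
      fix b assume "b \<in> eval_mpoly A xs ` J"
      then obtain Q where Q: "b = eval_mpoly A xs Q" "Q \<in> J" by blast
      then have "a \<oplus>\<^bsub>A\<^esub> b = eval_mpoly A xs (P + Q)"
        using P Q J.in_carrier[OF P(2)] J.in_carrier[OF Q(2)] by (simp add: A.eval_mpoly_add)
      then show "a \<oplus>\<^bsub>A\<^esub> b \<in> eval_mpoly A xs ` J" using J.add_mem[OF P(2) Q(2)] by blast
    qed
    fix a x assume "a \<in> eval_mpoly A xs ` J" "x \<in> carrier A"
    then obtain P Q where PQ: "a = eval_mpoly A xs P" "P \<in> J" "x = eval_mpoly A xs Q" "Q \<in> int_mpolys n"
      unfolding surj[symmetric] by blast
    then have "x \<otimes>\<^bsub>A\<^esub> a = eval_mpoly A xs (Q * P)" "a \<otimes>\<^bsub>A\<^esub> x = eval_mpoly A xs (P * Q)"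
      using J.in_carrier[OF PQ(2)] by (simp_all add: A.eval_mpoly_mult)
    then show "x \<otimes>\<^bsub>A\<^esub> a \<in> eval_mpoly A xs ` J" "a \<otimes>\<^bsub>A\<^esub> x \<in> eval_mpoly A xs ` J"
      using J.mult_mem[OF PQ(4,2)] J.mult_mem'[OF PQ(4,2)] by simp_all
  qed
qed

text \<open>The correspondence theorem: an ideal above the kernel is recovered from its image, so
  strict inclusions survive in \<open>A\<close>.\<close>

lemma vimage_image_eval:
  assumes A: "marked_cring A n xs" and J: "ideal_set (int_mpolys n) J" "marked_ker n A xs \<subseteq> J"
  shows "{P \<in> int_mpolys n. eval_mpoly A xs P \<in> eval_mpoly A xs ` J} = J"
proof -
  interpret A: marked_cring A n xs by fact
  interpret J: ideal_set "int_mpolys n" J by fact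
  show ?thesis
  proof (intro equalityI subsetI)
    fix P assume "P \<in> {P \<in> int_mpolys n. eval_mpoly A xs P \<in> eval_mpoly A xs ` J}"
    then obtain Q where Q: "P \<in> int_mpolys n" "Q \<in> J" "eval_mpoly A xs P = eval_mpoly A xs Q"
      by blast
    then have "P - Q \<in> J"
      using A.eval_mpoly_eq_iff[of P Q] J(2) by blast
    then show "P \<in> J" using J.mem_cong Q(2) by blast
  qed auto
qed

lemma noetherian_marked_ring:
  assumes A: "marked_ring n A xs"
  shows "noetherian_ring A"
proof -
  interpret A: marked_cring A n xs using A by (simp add: marked_ring_iff)
  have surj: "eval_mpoly A xs ` int_mpolys n = carrier A"
    using A by (simp add: marked_ring_iff)
  show ?thesis
  proof (rule A.noetherian_ringI)
    fix K assume K: "ideal K A"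
    let ?pre = "\<lambda>K. {P \<in> int_mpolys n. eval_mpoly A xs P \<in> K}"
    obtain G where G: "finite G" "G \<subseteq> ?pre K" "?pre K = ideal_hull (int_mpolys n) G"
      by (rule noetherian_finitely_generated[OF noetherian_int_mpolys A.ideal_set_vimage[OF K]])
    let ?G = "eval_mpoly A xs ` G"
    have Gc: "?G \<subseteq> carrier A" "?G \<subseteq> K"
      using G(2) surj by blast+
    have "ideal (genideal A ?G) A"
      by (rule A.genideal_ideal[OF Gc(1)])
    moreover have "G \<subseteq> ?pre (genideal A ?G)"
      using A.genideal_self[OF Gc(1)] G(2) by blast
    ultimately have "?pre K \<subseteq> ?pre (genideal A ?G)"
      unfolding G(3) by (intro ideal_hull_least A.ideal_set_vimage)
    moreover have "K \<subseteq> carrier A"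
      using K by (simp add: ideal_def additive_subgroup.a_subset)
    ultimately have "eval_mpoly A xs ` ?pre K \<subseteq> genideal A ?G" and "K = eval_mpoly A xs ` ?pre K"
      unfolding surj[symmetric] by blast+
    then have "K \<subseteq> genideal A ?G"
      by simp
    moreover have "genideal A ?G \<subseteq> K"
      by (rule A.genideal_minimal[OF K Gc(2)])
    ultimately show "\<exists>B\<subseteq>carrier A. finite B \<and> K = genideal A B"
      using Gc(1) G(1) by (intro exI[of _ ?G]) auto
  qed
qed

section \<open>Non-artinian kernels\<close>

lemma submodule_ideal_module:
  assumes "cring A" "ideal K A" "ideal L A" "L \<subseteq> K"
  shows "submodule L A (ideal_module A K)"
proof -
  interpret A: cring A by fact
  interpret K: ideal K A by fact
  interpret L: ideal L A by fact
  have "subgroup L ((add_monoid A)\<lparr>carrier := K\<rparr>)"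
    by (rule A.add.subgroup_incl[OF L.a_subgroup K.a_subgroup assms(4)])
  then have "subgroup L (add_monoid (ideal_module A K))"
    by (simp add: subgroup_def m_inv_def ideal_module_def)
  then show ?thesis
    unfolding submodule_def submodule_axioms_def
    by (auto simp: ideal_module_def L.I_l_closed)
qed

text \<open>The descending chain of ideals above the kernel stays strict in \<open>A\<close> by
  \<open>vimage_image_eval\<close>. Conversely, a finite quotient makes \<open>K\<close> a finite
  set, and the cardinalities in a strictly descending chain of submodules would fall
  forever.\<close>

lemma nonartinian_iff_infinite_quotient:
  assumes A: "marked_ring n A xs" and K: "ideal K A"
  shows "\<not> artinian_module A (ideal_module A K) \<longleftrightarrow>
    infinite_quotient (int_mpolys n) (marked_ker n A xs) {P \<in> int_mpolys n. eval_mpoly A xs P \<in> K}"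
proof -
  interpret A: marked_cring A n xs using A by (simp add: marked_ring_iff)
  have surj: "eval_mpoly A xs ` int_mpolys n = carrier A"
    using A by (simp add: marked_ring_iff)
  let ?T = "int_mpolys n" and ?I = "marked_ker n A xs"
  let ?J = "{P \<in> int_mpolys n. eval_mpoly A xs P \<in> K}"
  have Kc: "K \<subseteq> carrier A"
    using K by (simp add: ideal_def additive_subgroup.a_subset)
  have KJ: "K = eval_mpoly A xs ` ?J"
    using Kc unfolding surj[symmetric] by blast
  have IJ: "?I \<subseteq> ?J"
    using additive_subgroup.zero_closed[OF ideal.axioms(1)[OF K]] by (auto simp: marked_ker_def)
  interpret I: ideal_set ?T ?I by (rule A.marked_ker_ideal)
  interpret J: ideal_set ?T ?J by (rule A.ideal_set_vimage[OF K])
  have "infinite_quotient ?T ?I ?J \<longleftrightarrow> \<not> finite_mod ?J ?I"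
    unfolding infinite_quotient_def using I.ideal_set_axioms J.ideal_set_axioms IJ by blast
  also have "\<dots> \<longleftrightarrow> \<not> artinian_module A (ideal_module A K)"
  proof
    assume "\<not> finite_mod ?J ?I"
    then obtain N where N: "\<And>k :: nat. ideal_set ?T (N k) \<and> ?I \<subseteq> N k \<and> N k \<subseteq> ?J \<and> N (Suc k) \<subset> N k"
      using infinite_quotient_chain[OF noetherian_int_mpolys jacobson_int_mpolys
          I.ideal_set_axioms J.ideal_set_axioms IJ] by blast
    have 1: "submodule (eval_mpoly A xs ` N k) A (ideal_module A K)" for k
    proof (rule submodule_ideal_module[OF A.is_cring K])
      show "ideal (eval_mpoly A xs ` N k) A"
        using N[of k] by (intro ideal_image_eval[OF A]) blast
      show "eval_mpoly A xs ` N k \<subseteq> K"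
        using N[of k] by blast
    qed
    have 2: "eval_mpoly A xs ` N (Suc k) \<subset> eval_mpoly A xs ` N k" for k
    proof -
      have "eval_mpoly A xs ` N (Suc k) \<noteq> eval_mpoly A xs ` N k"
        using vimage_image_eval[OF A.marked_cring_axioms, of "N k"]
          vimage_image_eval[OF A.marked_cring_axioms, of "N (Suc k)"] N[of k] N[of "Suc k"] by auto
      then show ?thesis using N[of k] by blast
    qed
    show "\<not> artinian_module A (ideal_module A K)"
      unfolding artinian_module_def not_not using 1 2
      by (intro exI[of _ "\<lambda>k. eval_mpoly A xs ` N k"] allI conjI)
  next
    assume "\<not> artinian_module A (ideal_module A K)"
    then obtain N where "\<forall>k :: nat. submodule (N k) A (ideal_module A K) \<and> N (Suc k) \<subset> N k"
      unfolding artinian_module_def not_not by (elim exE) (rule that)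
    then have N: "submodule (N k) A (ideal_module A K)" "N (Suc k) \<subset> N k" for k
      by simp_all
    show "\<not> finite_mod ?J ?I"
    proof
      assume "finite_mod ?J ?I"
      then have "\<exists>F\<subseteq>?J. finite F \<and> (\<forall>P\<in>?J. \<exists>f\<in>F. P - f \<in> ?I)"
        by (rule finite_mod_representatives) (rule I.diff_mem)
      then obtain F where F: "F \<subseteq> ?J" "finite F" "\<forall>P\<in>?J. \<exists>f\<in>F. P - f \<in> ?I"
        by (elim exE conjE) (rule that)
      have "K \<subseteq> eval_mpoly A xs ` F"
      proof
        fix a assume "a \<in> K"
        then obtain P where P: "a = eval_mpoly A xs P" "P \<in> ?J" using KJ by blast
        then obtain f where f: "f \<in> F" "P - f \<in> ?I" using F(3) by blast
        then have "eval_mpoly A xs P = eval_mpoly A xs f"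
          using A.eval_mpoly_eq_iff[of P f] P(2) F(1) by blast
        then show "a \<in> eval_mpoly A xs ` F" using P(1) f(1) by blast
      qed
      then have finK: "finite K"
        using F(2) finite_subset by blast
      have "N k \<subseteq> K" for k
        using subgroup.subset[OF submodule.axioms(1)[OF N(1)[of k]]] by (simp add: ideal_module_def)
      then have fin: "finite (N k)" for k
        using finK finite_subset by blast
      have "card (N k) + k \<le> card (N 0)" for k
      proof (induction k)
        case (Suc k)
        then show ?case
          using psubset_card_mono[OF fin N(2)[of k]] by simp
      qed simp
      from this[of "Suc (card (N 0))"] show False by simp
    qed
  qed
  finally show ?thesis by simp
qed

section \<open>Quotient rings\<close>

text \<open>A quotient is presented by any function whose fibres on the carrier are the cosets of
  \<open>K\<close>. The target type is free: values in \<open>A\<close> give quotients over the same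
  type, and natural numbers as values give points of the space.\<close>

lemma quotient_image_ring:
  assumes A: "marked_ring n A xs" and K: "ideal K A"
    and f: "\<And>a b. a \<in> carrier A \<Longrightarrow> b \<in> carrier A \<Longrightarrow> f a = f b \<longleftrightarrow> a \<ominus>\<^bsub>A\<^esub> b \<in> K"
  shows "cring (image_ring f A)" "f \<in> ring_hom A (image_ring f A)"
    "f ` carrier A = carrier (image_ring f A)" "a_kernel A (image_ring f A) f = K"
proof -
  interpret A: marked_cring A n xs using A by (simp add: marked_ring_iff)
  have w: "weak_ring_morphism f K A"
    by (rule weak_ring_morphismI[OF K f])
  show h: "f \<in> ring_hom A (image_ring f A)"
    by (rule A.weak_ring_morphism_is_hom[OF w])
  show s: "f ` carrier A = carrier (image_ring f A)"
    by (simp add: image_ring_carrier)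
  show "cring (image_ring f A)"
    by (rule cring_hom_image[OF A.is_cring A.image_ring_is_ring[OF w] h s])
  show "a_kernel A (image_ring f A) f = K"
    by (rule A.weak_ring_morphism_ker[OF w])
qed

text \<open>For congruent \<open>a\<close> and \<open>b\<close> the two predicates under
  \<open>SOME\<close> coincide, so the choice depends on the coset alone. This supplies the function
  for \<open>quotient_image_ring\<close>.\<close>

lemma (in cring) ideal_representatives:
  assumes K: "ideal K R" and ab: "a \<in> carrier R" "b \<in> carrier R"
  shows "(SOME y. y \<in> carrier R \<and> a \<ominus> y \<in> K) = (SOME y. y \<in> carrier R \<and> b \<ominus> y \<in> K)
    \<longleftrightarrow> a \<ominus> b \<in> K"
proof
  interpret K: ideal K R by fact
  have swap: "b \<ominus> y \<in> K" if "a \<ominus> b \<in> K" "a \<ominus> y \<in> K" "a \<in> carrier R" "b \<in> carrier R" "y \<in> carrier R"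
    for a b y
  proof -
    have "(a \<ominus> y) \<oplus> \<ominus> (a \<ominus> b) \<in> K"
      using that by (simp add: K.a_closed K.a_inv_closed)
    also have "(a \<ominus> y) \<oplus> \<ominus> (a \<ominus> b) = b \<ominus> y"
      using that(3-) by algebra
    finally show ?thesis .
  qed
  have refl: "a \<ominus> a \<in> K" if "a \<in> carrier R" for a
    using that by (simp add: r_neg a_minus_def K.zero_closed)
  have comm: "b \<ominus> a \<in> K" if "a \<ominus> b \<in> K" "a \<in> carrier R" "b \<in> carrier R" for a b
    using swap[OF that(1) refl] that by blast
  {
    assume eq: "(SOME y. y \<in> carrier R \<and> a \<ominus> y \<in> K) = (SOME y. y \<in> carrier R \<and> b \<ominus> y \<in> K)"
    define y where "y = (SOME y. y \<in> carrier R \<and> a \<ominus> y \<in> K)"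
    have "y \<in> carrier R \<and> a \<ominus> y \<in> K"
      unfolding y_def by (rule someI[of _ a]) (use ab refl in blast)
    moreover have "y \<in> carrier R \<and> b \<ominus> y \<in> K"
      unfolding y_def eq by (rule someI[of _ b]) (use ab refl in blast)
    ultimately have y: "y \<in> carrier R" "a \<ominus> y \<in> K" "b \<ominus> y \<in> K" by blast+
    have "y \<ominus> a \<in> K" "y \<ominus> b \<in> K"
      using comm y ab by blast+
    then show "a \<ominus> b \<in> K"
      using swap[of y a b] y(1) ab by blast
  }
  assume K1: "a \<ominus> b \<in> K"
  have "y \<in> carrier R \<and> a \<ominus> y \<in> K \<longleftrightarrow> y \<in> carrier R \<and> b \<ominus> y \<in> K" for y
    using swap[OF K1 _ ab] swap[OF comm[OF K1 ab] _ ab(2,1)] by blast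
  then show "(SOME y. y \<in> carrier R \<and> a \<ominus> y \<in> K) = (SOME y. y \<in> carrier R \<and> b \<ominus> y \<in> K)"
    by simp
qed

text \<open>Noetherian induction on the kernel in the fixed polynomial ring, with ring and marks
  varying. Many rings \<open>B\<close> share one kernel, but by the induction hypothesis their
  lengths agree, so both suprema are over the same set of ordinals.\<close>

lemma reduced_length_marked:
  assumes "marked_ring n A xs"
  shows "reduced_length A = (ideal_length (int_mpolys n) (marked_ker n A xs) :: 'o :: wellorder)"
proof -
  have "reduced_length A = (ideal_length (int_mpolys n) I :: 'o)"
    if "marked_ring n A xs" "marked_ker n A xs = I" for I and A :: "'a ring" and xs
    using that
  proof (induction I arbitrary: A xs rule: wf_induct_rule[OF noetherian_int_mpolys[of n, unfolded noetherian_set_def]])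
    case (1 I)
    note A = "1.prems"(1) and I = "1.prems"(2)
    interpret A: marked_cring A n xs using A by (simp add: marked_ring_iff)
    have surj: "eval_mpoly A xs ` int_mpolys n = carrier A"
      using A by (simp add: marked_ring_iff)
    have step: "reduced_length B = (ideal_length (int_mpolys n) J :: 'o)"
      if "marked_ring n B ys" "marked_ker n B ys = J" "infinite_quotient (int_mpolys n) I J"
      for B :: "'a ring" and ys J
      using "1.IH"[OF _ that(1,2)] that(3) infinite_quotient_psubset[OF that(3)]
      by (simp add: infinite_quotient_def)
    have "(\<lambda>B. ordinal_succ (reduced_length B :: 'o)) ` {B. nonartinian_quotient A B}
        = (\<lambda>J. ordinal_succ (ideal_length (int_mpolys n) J)) ` {J. infinite_quotient (int_mpolys n) I J}"
    proof (intro equalityI subsetI)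
      fix \<alpha> assume "\<alpha> \<in> (\<lambda>B. ordinal_succ (reduced_length B :: 'o)) ` {B. nonartinian_quotient A B}"
      then obtain B where \<alpha>: "\<alpha> = ordinal_succ (reduced_length B)" and "nonartinian_quotient A B"
        by blast
      then obtain h where B: "cring B" and h: "h \<in> ring_hom A B" "h ` carrier A = carrier B"
          and na: "\<not> artinian_module A (ideal_module A (a_kernel A B h))"
        unfolding nonartinian_quotient_def by blast
      interpret h: ring_hom_ring A B h
        by (rule ring_hom_ringI2[OF A.ring_axioms cring.axioms(1)[OF B] h(1)])
      note B' = marked_ring_hom_image[OF A B h]
      have inf: "infinite_quotient (int_mpolys n) I (marked_ker n B (map h xs))"
        using na unfolding nonartinian_iff_infinite_quotient[OF A h.kernel_is_ideal] B'(2) I .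
      have "\<alpha> = ordinal_succ (ideal_length (int_mpolys n) (marked_ker n B (map h xs)))"
        unfolding \<alpha> step[OF B'(1) refl inf] ..
      then show "\<alpha> \<in> (\<lambda>J. ordinal_succ (ideal_length (int_mpolys n) J))
          ` {J. infinite_quotient (int_mpolys n) I J}"
        using inf by blast
    next
      fix \<alpha> :: 'o assume "\<alpha> \<in> (\<lambda>J. ordinal_succ (ideal_length (int_mpolys n) J))
          ` {J. infinite_quotient (int_mpolys n) I J}"
      then obtain J where \<alpha>: "\<alpha> = ordinal_succ (ideal_length (int_mpolys n) J)"
          and inf: "infinite_quotient (int_mpolys n) I J"
        by blast
      have J: "ideal_set (int_mpolys n) J" "marked_ker n A xs \<subseteq> J"
        using inf I unfolding infinite_quotient_def by simp_all
      define K where "K = eval_mpoly A xs ` J"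
      have K: "ideal K A"
        unfolding K_def by (rule ideal_image_eval[OF A J(1)])
      have pre: "{P \<in> int_mpolys n. eval_mpoly A xs P \<in> K} = J"
        unfolding K_def by (rule vimage_image_eval[OF A.marked_cring_axioms J])
      \<comment> \<open>Representatives are chosen inside \<open>A\<close>, so that the quotient has
        the type over which \<open>nonartinian_quotient\<close> ranges.\<close>
      define f where "f a = (SOME y. y \<in> carrier A \<and> a \<ominus>\<^bsub>A\<^esub> y \<in> K)" for a
      have f: "f a = f b \<longleftrightarrow> a \<ominus>\<^bsub>A\<^esub> b \<in> K" if "a \<in> carrier A" "b \<in> carrier A" for a b
        unfolding f_def by (rule A.ideal_representatives[OF K that])
      define B where "B = image_ring f A"
      have B: "cring B" "f \<in> ring_hom A B" "f ` carrier A = carrier B" "a_kernel A B f = K"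
        unfolding B_def by (rule quotient_image_ring[OF A K], rule f, assumption+)+
      have "\<not> artinian_module A (ideal_module A (a_kernel A B f))"
        unfolding B(4) nonartinian_iff_infinite_quotient[OF A K] pre I using inf .
      then have na: "nonartinian_quotient A B"
        unfolding nonartinian_quotient_def using B(1,2,3) by blast
      have "marked_ker n B (map f xs) = J"
        unfolding marked_ring_hom_image(2)[OF A B(1-3)] B(4) pre ..
      then have "reduced_length B = (ideal_length (int_mpolys n) J :: 'o)"
        using step[OF marked_ring_hom_image(1)[OF A B(1-3)] _ inf] by simp
      then have "\<alpha> = ordinal_succ (reduced_length B)"
        unfolding \<alpha> by simp
      then show "\<alpha> \<in> (\<lambda>B. ordinal_succ (reduced_length B :: 'o)) ` {B. nonartinian_quotient A B}"
        using na by blast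
    qed
    then show ?case
      unfolding reduced_length.simps[of A] ideal_length.simps[of "int_mpolys n" I]
      using A.is_cring noetherian_marked_ring[OF A] noetherian_int_mpolys by simp
  qed
  then show ?thesis using assms by blast
qed

section \<open>The points of the space of marked rings\<close>

text \<open>Two polynomials agree at the marks exactly if their difference is in the kernel. For
  equal kernels, values of the same polynomial can thus be matched, which gives the
  isomorphism.\<close>

lemma marked_isomorphic_iff:
  assumes A: "marked_ring n A xs" and B: "marked_ring n B ys"
  shows "marked_isomorphic A xs B ys \<longleftrightarrow> marked_ker n A xs = marked_ker n B ys"
proof
  interpret A: marked_cring A n xs using A by (simp add: marked_ring_iff)
  interpret B: marked_cring B n ys using B by (simp add: marked_ring_iff)
  have surjA: "eval_mpoly A xs ` int_mpolys n = carrier A"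
    and surjB: "eval_mpoly B ys ` int_mpolys n = carrier B"
    using A B by (simp_all add: marked_ring_iff)
  interpret S: subring_set "int_mpolys n" by (rule int_mpolys_subring)
  {
    assume "marked_isomorphic A xs B ys"
    then obtain h where h: "h \<in> ring_hom A B" "bij_betw h (carrier A) (carrier B)" "map h xs = ys"
      unfolding marked_isomorphic_def ring_iso_def by blast
    interpret h: ring_hom_cring A B h by unfold_locales (rule h)
    have "eval_mpoly B ys P = \<zero>\<^bsub>B\<^esub> \<longleftrightarrow> eval_mpoly A xs P = \<zero>\<^bsub>A\<^esub>" if "P \<in> int_mpolys n" for P
    proof -
      have "eval_mpoly B ys P = h (eval_mpoly A xs P)"
        using eval_mpoly_hom(2)[OF A.marked_cring_axioms B.is_cring h(1) that] h(3) by simp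
      moreover have "h (eval_mpoly A xs P) = h \<zero>\<^bsub>A\<^esub> \<longleftrightarrow> eval_mpoly A xs P = \<zero>\<^bsub>A\<^esub>"
        by (rule inj_on_eq_iff[OF bij_betw_imp_inj_on[OF h(2)]]) (use that in simp_all)
      ultimately show ?thesis by simp
    qed
    then show "marked_ker n A xs = marked_ker n B ys"
      by (auto simp: marked_ker_def)
  }
  assume eq: "marked_ker n A xs = marked_ker n B ys"
  have same: "eval_mpoly A xs P = eval_mpoly A xs Q \<longleftrightarrow> eval_mpoly B ys P = eval_mpoly B ys Q"
    if "P \<in> int_mpolys n" "Q \<in> int_mpolys n" for P Q
    unfolding A.eval_mpoly_eq_iff[OF that] B.eval_mpoly_eq_iff[OF that] eq ..
  define h where "h a = eval_mpoly B ys (inv_into (int_mpolys n) (eval_mpoly A xs) a)" for a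
  have h: "h (eval_mpoly A xs P) = eval_mpoly B ys P" if P: "P \<in> int_mpolys n" for P
  proof -
    let ?Q = "inv_into (int_mpolys n) (eval_mpoly A xs) (eval_mpoly A xs P)"
    have "?Q \<in> int_mpolys n" "eval_mpoly A xs ?Q = eval_mpoly A xs P"
      using P by (auto intro: inv_into_into f_inv_into_f)
    then show ?thesis
      unfolding h_def using same[of ?Q P] P by simp
  qed
  have "h \<in> ring_iso A B"
  proof (rule ring_iso_memI)
    fix a b assume "a \<in> carrier A" "b \<in> carrier A"
    then obtain P Q where "a = eval_mpoly A xs P" "P \<in> int_mpolys n"
        "b = eval_mpoly A xs Q" "Q \<in> int_mpolys n"
      unfolding surjA[symmetric] by blast
    then show "h (a \<otimes>\<^bsub>A\<^esub> b) = h a \<otimes>\<^bsub>B\<^esub> h b" "h (a \<oplus>\<^bsub>A\<^esub> b) = h a \<oplus>\<^bsub>B\<^esub> h b"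
      using h[of "P * Q"] h[of "P + Q"]
      by (simp_all add: h A.eval_mpoly_mult B.eval_mpoly_mult A.eval_mpoly_add B.eval_mpoly_add)
  next
    show "h \<one>\<^bsub>A\<^esub> = \<one>\<^bsub>B\<^esub>"
      using h[of 1] by (simp add: A.eval_mpoly_1 B.eval_mpoly_1)
    show "h a \<in> carrier B" if "a \<in> carrier A" for a
      using that h unfolding surjA[symmetric] by auto
    show "bij_betw h (carrier A) (carrier B)"
    proof (rule bij_betw_imageI)
      show "inj_on h (carrier A)"
        unfolding surjA[symmetric] by (rule inj_onI) (use same in \<open>auto simp: h\<close>)
      have "h ` eval_mpoly A xs ` int_mpolys n = eval_mpoly B ys ` int_mpolys n"
        unfolding image_image by (rule image_cong[OF refl h])
      then show "h ` carrier A = carrier B"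
        unfolding surjA surjB .
    qed
  qed
  moreover have "map h xs = ys"
  proof (rule nth_equalityI)
    show "length (map h xs) = length ys"
      by (simp add: A.length_xs B.length_xs)
    fix i assume "i < length (map h xs)"
    then have i: "i < n" by (simp add: A.length_xs)
    then have "h (xs ! i) = ys ! i"
      using h[OF mvar_in_int_mpolys[OF i]] by (simp add: A.eval_mvar B.eval_mvar)
    then show "map h xs ! i = ys ! i"
      using i by (simp add: A.length_xs)
  qed
  ultimately show "marked_isomorphic A xs B ys"
    unfolding marked_isomorphic_def by blast
qed

text \<open>By \<open>marked_class_eq\<close> this is the class of every marked ring with kernel
  \<open>I\<close>, including rings whose carrier is not a set of natural numbers.\<close>

definition marked_point :: "nat \<Rightarrow> int_mpoly set \<Rightarrow> (nat ring \<times> nat list) set"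
  where "marked_point n I = {(B, ys). marked_ring n B ys \<and> marked_ker n B ys = I}"

lemma marked_class_eq:
  "marked_ring n A xs \<Longrightarrow> marked_class n A xs = marked_point n (marked_ker n A xs)"
  unfolding marked_class_def marked_point_def using marked_isomorphic_iff by blast

text \<open>The quotient by \<open>I\<close> is realised on natural numbers by numbering coset
  representatives, which is possible because there are only countably many polynomials.\<close>

lemma marked_point_nonempty:
  assumes I: "ideal_set (int_mpolys n) I"
  shows "\<exists>B ys. (B, ys) \<in> marked_point n I"
proof -
  let ?R = "mpoly_ring n" and ?x = "map mvar [0..<n]"
  have car: "carrier ?R = int_mpolys n"
    by (simp add: mpoly_ring_def)
  interpret R: cring ?R by (rule mpoly_ring_cring)
  interpret I: ideal_set "int_mpolys n" I by fact
  have "eval_mpoly ?R ?x ` I = (\<lambda>P. P) ` I"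
    by (rule image_cong[OF refl mpoly_ring_marked(2)]) (rule I.in_carrier)
  then have K: "ideal I ?R"
    using ideal_image_eval[OF mpoly_ring_marked(1) I] by simp
  define s where "s P = (SOME y. y \<in> carrier ?R \<and> P \<ominus>\<^bsub>?R\<^esub> y \<in> I)" for P
  have s: "s P = s Q \<longleftrightarrow> P \<ominus>\<^bsub>?R\<^esub> Q \<in> I" if "P \<in> carrier ?R" "Q \<in> carrier ?R" for P Q
    unfolding s_def by (rule R.ideal_representatives[OF K that])
  have sT: "s P \<in> int_mpolys n" if "P \<in> carrier ?R" for P
  proof -
    have "P \<ominus>\<^bsub>?R\<^esub> P = \<zero>\<^bsub>?R\<^esub>"
      using that by (simp add: R.r_right_minus_eq)
    then have "P \<ominus>\<^bsub>?R\<^esub> P \<in> I"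
      by (simp add: mpoly_ring_def)
    with that have "P \<in> carrier ?R \<and> P \<ominus>\<^bsub>?R\<^esub> P \<in> I"
      by (rule conjI)
    then have "s P \<in> carrier ?R \<and> P \<ominus>\<^bsub>?R\<^esub> s P \<in> I"
      unfolding s_def by (rule someI[of "\<lambda>y. y \<in> carrier ?R \<and> P \<ominus>\<^bsub>?R\<^esub> y \<in> I"])
    then show ?thesis by (simp add: car)
  qed
  define f where "f P = to_nat_on (int_mpolys n) (s P)" for P
  have f: "f P = f Q \<longleftrightarrow> P \<ominus>\<^bsub>?R\<^esub> Q \<in> I" if "P \<in> carrier ?R" "Q \<in> carrier ?R" for P Q
    unfolding f_def s[OF that, symmetric]
    by (rule inj_on_eq_iff[OF inj_on_to_nat_on[OF countable_int_mpolys]]) (use sT that in simp_all)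
  define B where "B = image_ring f ?R"
  have B: "cring B" "f \<in> ring_hom ?R B" "f ` carrier ?R = carrier B" "a_kernel ?R B f = I"
    unfolding B_def by (rule quotient_image_ring[OF mpoly_ring_marked(1) K], rule f, assumption+)+
  note M = marked_ring_hom_image[OF mpoly_ring_marked(1) B(1-3)]
  have "marked_ker n B (map f ?x) = {P \<in> int_mpolys n. P \<in> I}"
    unfolding M(2) B(4)
    by (intro Collect_cong conj_cong refl arg_cong[where f = "\<lambda>P. P \<in> I"] mpoly_ring_marked(2))
  also have "\<dots> = I" using I.subset by blast
  finally show ?thesis
    unfolding marked_point_def using M(1) by blast
qed

section \<open>The space as the set of ideals\<close>

lemma marked_rings_eq: "marked_rings n = marked_point n ` {I. ideal_set (int_mpolys n) I}"
proof (intro equalityI subsetI)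
  fix c assume "c \<in> marked_rings n"
  then obtain A :: "nat ring" and xs where A: "marked_ring n A xs" "c = marked_class n A xs"
    unfolding marked_rings_def by blast
  then show "c \<in> marked_point n ` {I. ideal_set (int_mpolys n) I}"
    using marked_class_eq[OF A(1)] marked_cring.marked_ker_ideal[of A n xs]
    by (auto simp: marked_ring_iff)
next
  fix c assume "c \<in> marked_point n ` {I. ideal_set (int_mpolys n) I}"
  then obtain I where I: "ideal_set (int_mpolys n) I" "c = marked_point n I" by blast
  then obtain B :: "nat ring" and ys where B: "marked_ring n B ys" "marked_ker n B ys = I"
    using marked_point_nonempty[OF I(1)] unfolding marked_point_def by blast
  then have "c = marked_class n B ys"
    using marked_class_eq[OF B(1)] I(2) by simp
  then show "c \<in> marked_rings n"
    unfolding marked_rings_def using B(1) by blast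
qed

lemma inj_on_marked_point: "inj_on (marked_point n) {I. ideal_set (int_mpolys n) I}"
proof (rule inj_onI)
  fix I J assume "I \<in> {I. ideal_set (int_mpolys n) I}" and eq: "marked_point n I = marked_point n J"
  then obtain B ys where "(B, ys) \<in> marked_point n I"
    using marked_point_nonempty by blast
  moreover from this have "(B, ys) \<in> marked_point n J"
    using eq by simp
  ultimately show "I = J"
    by (simp add: marked_point_def)
qed

text \<open>Whether \<open>P\<close> vanishes is the same for all members of the class, and
  nonemptiness keeps the universal quantifiers from being vacuous.\<close>

lemma vanishing_marked_point:
  assumes P: "P \<in> int_mpolys n" and I: "ideal_set (int_mpolys n) I"
  shows "(\<forall>(A, xs) \<in> marked_point n I. eval_mpoly A xs P = \<zero>\<^bsub>A\<^esub>) \<longleftrightarrow> P \<in> I"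
    and "(\<forall>(A, xs) \<in> marked_point n I. eval_mpoly A xs P \<noteq> \<zero>\<^bsub>A\<^esub>) \<longleftrightarrow> P \<notin> I"
proof -
  have "eval_mpoly A xs P = \<zero>\<^bsub>A\<^esub> \<longleftrightarrow> P \<in> I" if "(A, xs) \<in> marked_point n I" for A xs
    using that P by (auto simp: marked_point_def marked_ker_def)
  then show "(\<forall>(A, xs) \<in> marked_point n I. eval_mpoly A xs P = \<zero>\<^bsub>A\<^esub>) \<longleftrightarrow> P \<in> I"
    and "(\<forall>(A, xs) \<in> marked_point n I. eval_mpoly A xs P \<noteq> \<zero>\<^bsub>A\<^esub>) \<longleftrightarrow> P \<notin> I"
    using marked_point_nonempty[OF I] by fast+
qed

lemma vanishing_locus_eq:
  assumes "P \<in> int_mpolys n"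
  shows "vanishing_locus n P = marked_point n ` {I. ideal_set (int_mpolys n) I \<and> P \<in> I}"
    and "nonvanishing_locus n P = marked_point n ` {I. ideal_set (int_mpolys n) I \<and> P \<notin> I}"
proof -
  have *: "{c \<in> marked_point n ` {I. ideal_set (int_mpolys n) I}. R c}
      = marked_point n ` {I. ideal_set (int_mpolys n) I \<and> R (marked_point n I)}" for R
    by blast
  show "vanishing_locus n P = marked_point n ` {I. ideal_set (int_mpolys n) I \<and> P \<in> I}"
    unfolding vanishing_locus_def marked_rings_eq *
    by (intro arg_cong[where f = "image (marked_point n)"] Collect_cong conj_cong refl
        vanishing_marked_point assms)
  show "nonvanishing_locus n P = marked_point n ` {I. ideal_set (int_mpolys n) I \<and> P \<notin> I}"
    unfolding nonvanishing_locus_def marked_rings_eq *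
    by (intro arg_cong[where f = "image (marked_point n)"] Collect_cong conj_cong refl
        vanishing_marked_point assms)
qed

section \<open>The topology\<close>

lemma topspace_marked_ring_space:
  "topspace (marked_ring_space n) = marked_point n ` {I. ideal_set (int_mpolys n) I}"
proof -
  interpret S: subring_set "int_mpolys n" by (rule int_mpolys_subring)
  have top: "vanishing_locus n 0 = marked_rings n"
    unfolding vanishing_locus_eq(1)[OF S.zero_in] marked_rings_eq using ideal_set.zero_mem by blast
  have "vanishing_locus n P \<subseteq> marked_rings n" "nonvanishing_locus n P \<subseteq> marked_rings n" for P
    by (auto simp: vanishing_locus_def nonvanishing_locus_def)
  then have "\<Union>(vanishing_locus n ` int_mpolys n \<union> nonvanishing_locus n ` int_mpolys n) \<subseteq> marked_rings n"
    by (intro Union_least) auto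
  moreover have "marked_rings n \<subseteq> \<Union>(vanishing_locus n ` int_mpolys n \<union> nonvanishing_locus n ` int_mpolys n)"
    by (rule Union_upper) (use top S.zero_in in blast)
  ultimately show ?thesis
    unfolding marked_ring_space_def topology_generated_by_topspace marked_rings_eq[symmetric]
    by (rule subset_antisym)
qed

lemma openin_marked_ring_space:
  assumes "finite G" "G \<subseteq> int_mpolys n" "finite F" "F \<subseteq> int_mpolys n"
  shows "openin (marked_ring_space n)
    (marked_point n ` {J. ideal_set (int_mpolys n) J \<and> G \<subseteq> J \<and> F \<inter> J = {}})"
proof -
  let ?I = "{J. ideal_set (int_mpolys n) J}"
  have basis: "openin (marked_ring_space n) (marked_point n ` {J. ideal_set (int_mpolys n) J \<and> P \<in> J})"
    "openin (marked_ring_space n) (marked_point n ` {J. ideal_set (int_mpolys n) J \<and> P \<notin> J})"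
    if "P \<in> int_mpolys n" for P
    unfolding marked_ring_space_def vanishing_locus_eq[OF that, symmetric]
    using that by (auto intro!: topology_generated_by_Basis)
  have Int: "marked_point n ` (C \<inter> D) = marked_point n ` C \<inter> marked_point n ` D"
    if "C \<subseteq> ?I" "D \<subseteq> ?I" for C D
    by (rule inj_on_image_Int[OF inj_on_marked_point that])
  have 1: "openin (marked_ring_space n) (marked_point n ` {J. ideal_set (int_mpolys n) J \<and> G \<subseteq> J})"
    using assms(1,2)
  proof (induction G rule: finite_induct)
    case empty
    then show ?case
      using openin_topspace[of "marked_ring_space n"] by (simp add: topspace_marked_ring_space)
  next
    case (insert P G)
    have "{J. ideal_set (int_mpolys n) J \<and> insert P G \<subseteq> J}
        = {J. ideal_set (int_mpolys n) J \<and> P \<in> J} \<inter> {J. ideal_set (int_mpolys n) J \<and> G \<subseteq> J}"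
      by blast
    then have "marked_point n ` {J. ideal_set (int_mpolys n) J \<and> insert P G \<subseteq> J}
        = marked_point n ` {J. ideal_set (int_mpolys n) J \<and> P \<in> J}
          \<inter> marked_point n ` {J. ideal_set (int_mpolys n) J \<and> G \<subseteq> J}"
      using Int[of "{J. ideal_set (int_mpolys n) J \<and> P \<in> J}" "{J. ideal_set (int_mpolys n) J \<and> G \<subseteq> J}"]
      by auto
    then show ?case
      using insert basis(1)[of P] openin_Int by simp
  qed
  show ?thesis
    using assms(3,4)
  proof (induction F rule: finite_induct)
    case empty
    then show ?case using 1 by simp
  next
    case (insert P F)
    have "{J. ideal_set (int_mpolys n) J \<and> G \<subseteq> J \<and> insert P F \<inter> J = {}}
        = {J. ideal_set (int_mpolys n) J \<and> P \<notin> J}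
          \<inter> {J. ideal_set (int_mpolys n) J \<and> G \<subseteq> J \<and> F \<inter> J = {}}"
      by blast
    then have "marked_point n ` {J. ideal_set (int_mpolys n) J \<and> G \<subseteq> J \<and> insert P F \<inter> J = {}}
        = marked_point n ` {J. ideal_set (int_mpolys n) J \<and> P \<notin> J}
          \<inter> marked_point n ` {J. ideal_set (int_mpolys n) J \<and> G \<subseteq> J \<and> F \<inter> J = {}}"
      using Int[of "{J. ideal_set (int_mpolys n) J \<and> P \<notin> J}"
          "{J. ideal_set (int_mpolys n) J \<and> G \<subseteq> J \<and> F \<inter> J = {}}"]
      by auto
    then show ?case
      using insert basis(2)[of P] openin_Int by simp
  qed
qed

text \<open>For ideals above \<open>I\<close>, vanishing conditions satisfied at \<open>I\<close>
  persist, so that only the finitely many conditions of avoidance remain.\<close>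

lemma openin_marked_ring_spaceD:
  assumes "openin (marked_ring_space n) U" and I: "ideal_set (int_mpolys n) I" "marked_point n I \<in> U"
  obtains F where "finite F" "F \<subseteq> int_mpolys n" "F \<inter> I = {}"
    "\<And>J. ideal_set (int_mpolys n) J \<Longrightarrow> I \<subseteq> J \<Longrightarrow> F \<inter> J = {} \<Longrightarrow> marked_point n J \<in> U"
proof -
  have "generate_topology_on (vanishing_locus n ` int_mpolys n \<union> nonvanishing_locus n ` int_mpolys n) U"
    using assms(1) unfolding marked_ring_space_def by (rule openin_topology_generated_by)
  then have "\<exists>F. finite F \<and> F \<subseteq> int_mpolys n \<and> F \<inter> I = {} \<and>
      (\<forall>J. ideal_set (int_mpolys n) J \<longrightarrow> I \<subseteq> J \<longrightarrow> F \<inter> J = {} \<longrightarrow> marked_point n J \<in> U)"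
    using I(2)
  proof (induction U rule: generate_topology_on.induct)
    case Empty
    then show ?case by simp
  next
    case (Int U V)
    then obtain F G where
      "finite F" "F \<subseteq> int_mpolys n" "F \<inter> I = {}"
      "\<forall>J. ideal_set (int_mpolys n) J \<longrightarrow> I \<subseteq> J \<longrightarrow> F \<inter> J = {} \<longrightarrow> marked_point n J \<in> U"
      "finite G" "G \<subseteq> int_mpolys n" "G \<inter> I = {}"
      "\<forall>J. ideal_set (int_mpolys n) J \<longrightarrow> I \<subseteq> J \<longrightarrow> G \<inter> J = {} \<longrightarrow> marked_point n J \<in> V"
      by auto
    then show ?case
      by (intro exI[of _ "F \<union> G"]) (simp add: Int_Un_distrib2)
  next
    case (UN \<U>)
    then obtain U where U: "U \<in> \<U>" "marked_point n I \<in> U" by blast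
    from UN.IH[OF U] show ?case
    proof (elim exE conjE)
      fix F assume F: "finite F" "F \<subseteq> int_mpolys n" "F \<inter> I = {}"
        "\<forall>J. ideal_set (int_mpolys n) J \<longrightarrow> I \<subseteq> J \<longrightarrow> F \<inter> J = {} \<longrightarrow> marked_point n J \<in> U"
      have "marked_point n J \<in> \<Union>\<U>"
        if "ideal_set (int_mpolys n) J" "I \<subseteq> J" "F \<inter> J = {}" for J
        by (rule UnionI[OF U(1)]) (use F(4) that in blast)
      then show ?case
        using F(1-3) by (intro exI[of _ F]) simp
    qed
  next
    case (Basis U)
    then consider P where "P \<in> int_mpolys n" "U = vanishing_locus n P"
      | P where "P \<in> int_mpolys n" "U = nonvanishing_locus n P" by blast
    then show ?case
    proof cases
      case 1
      then have "P \<in> I"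
        using Basis.prems I(1) inj_on_marked_point[of n]
        by (auto simp: vanishing_locus_eq inj_on_def)
      then show ?thesis
        using 1 by (intro exI[of _ "{}"]) (auto simp: vanishing_locus_eq)
    next
      case 2
      then have "P \<notin> I"
        using Basis.prems I(1) inj_on_marked_point[of n]
        by (auto simp: vanishing_locus_eq inj_on_def)
      then show ?thesis
        using 2 by (intro exI[of _ "{P}"]) (auto simp: vanishing_locus_eq)
    qed
  qed
  then show thesis
    by (elim exE conjE) (rule that, auto)
qed

section \<open>The rank of a point\<close>

lemma cb_rank_marked_point:
  assumes I: "ideal_set (int_mpolys n) I"
  shows "cb_rank (marked_ring_space n) (marked_point n I)
    = Some (ideal_length (int_mpolys n) I :: 'o :: infinite ordinal)"
proof -
  let ?T = "int_mpolys n"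
  define \<rho> where "\<rho> c = (ideal_length ?T (inv_into {I. ideal_set ?T I} (marked_point n) c) :: 'o ordinal)" for c
  have \<rho>: "\<rho> (marked_point n J) = ideal_length ?T J" if "ideal_set ?T J" for J
    unfolding \<rho>_def using inv_into_f_f[OF inj_on_marked_point] that by simp
  have "cb_rank (marked_ring_space n) (marked_point n I) = Some (\<rho> (marked_point n I))"
  proof (rule cb_rank_eq)
    show "marked_point n I \<in> topspace (marked_ring_space n)"
      unfolding topspace_marked_ring_space using I by blast
  next
    fix c assume "c \<in> topspace (marked_ring_space n)"
    then obtain I where I: "ideal_set ?T I" and c: "c = marked_point n I"
      unfolding topspace_marked_ring_space by blast
    interpret I: ideal_set ?T I by fact
    \<comment> \<open>Lying above \<open>I\<close> is an open condition, because containing the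
      finite set \<open>G\<close> already implies it.\<close>
    obtain G where G: "finite G" "G \<subseteq> I" "I = ideal_hull ?T G"
      by (rule noetherian_finitely_generated[OF noetherian_int_mpolys I])
    obtain M where M: "ideal_set ?T M" "I \<subseteq> M" "finite_mod M I"
        "\<And>J. ideal_set ?T J \<Longrightarrow> finite_mod J I \<Longrightarrow> J \<subseteq> M"
      by (rule largest_finite_extension[OF noetherian_int_mpolys I]) blast
    have "\<exists>F\<subseteq>M. finite F \<and> (\<forall>P\<in>M. \<exists>f\<in>F. P - f \<in> I)"
      by (rule finite_mod_representatives[OF M(3)]) (rule I.diff_mem)
    then obtain F where F: "F \<subseteq> M" "finite F" "\<forall>P\<in>M. \<exists>f\<in>F. P - f \<in> I"
      by (elim exE conjE) (rule that)
    define U where "U = marked_point n ` {J. ideal_set ?T J \<and> G \<subseteq> J \<and> (F - I) \<inter> J = {}}"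
    have "openin (marked_ring_space n) U"
      unfolding U_def
    proof (rule openin_marked_ring_space)
      show "G \<subseteq> ?T" using G(2) I.subset by blast
      show "F - I \<subseteq> ?T" using F(1) ideal_set.subset[OF M(1)] by blast
    qed (use G F in simp_all)
    moreover have "c \<in> U"
      unfolding U_def c using I G(2) by blast
    moreover have "\<rho> d < \<rho> c" if d: "d \<in> U" "d \<noteq> c" for d
    proof -
      obtain J where J: "ideal_set ?T J" "G \<subseteq> J" "(F - I) \<inter> J = {}" and dJ: "d = marked_point n J"
        using d(1) unfolding U_def by blast
      interpret J: ideal_set ?T J by fact
      have IJ: "I \<subseteq> J"
        using ideal_hull_least[OF J(1,2)] G(3) by simp
      \<comment> \<open>If \<open>J\<close> were finite over \<open>I\<close>, it would lie in
        \<open>M\<close>. An element of \<open>J\<close> outside \<open>I\<close> is congruent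
        modulo \<open>I\<close> to some \<open>f\<close> in \<open>F\<close>, which would then be in
        \<open>J\<close> but not in \<open>I\<close>.\<close>
      have "\<not> finite_mod J I"
      proof
        assume "finite_mod J I"
        then have JM: "J \<subseteq> M" by (rule M(4)[OF J(1)])
        have "J \<noteq> I" using d(2) c dJ by blast
        then obtain P where P: "P \<in> J" "P \<notin> I" using IJ by blast
        then obtain f where f: "f \<in> F" "P - f \<in> I" using F(3) JM by blast
        have "f \<in> J" using J.mem_cong[of P f] f(2) IJ P(1) by blast
        moreover have "f \<notin> I" using I.mem_cong[OF f(2)] P(2) by blast
        ultimately show False using f(1) J(3) by blast
      qed
      then have "infinite_quotient ?T I J"
        unfolding infinite_quotient_def using I J(1) IJ by blast
      then show ?thesis
        unfolding c dJ \<rho>[OF I] \<rho>[OF J(1)]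
        by (rule ideal_length_less[OF noetherian_int_mpolys countable_int_mpolys])
    qed
    ultimately show "\<exists>U. openin (marked_ring_space n) U \<and> c \<in> U \<and> (\<forall>d\<in>U. d \<noteq> c \<longrightarrow> \<rho> d < \<rho> c)"
      by blast
  next
    fix c U and \<alpha> :: "'o ordinal"
    assume U: "openin (marked_ring_space n) U" and "c \<in> U" and \<alpha>: "\<alpha> < \<rho> c"
    then have "c \<in> topspace (marked_ring_space n)"
      using openin_subset by blast
    then obtain I where I: "ideal_set ?T I" and c: "c = marked_point n I"
      unfolding topspace_marked_ring_space by blast
    have "\<alpha> < ideal_length ?T I"
      using \<alpha> unfolding c \<rho>[OF I] .
    then obtain J where J: "infinite_quotient ?T I J" "\<alpha> \<le> ideal_length ?T J"
      by (rule ideal_length_lessD[OF noetherian_int_mpolys])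
    then have J': "ideal_set ?T J" "I \<subseteq> J" "\<not> finite_mod J I"
      unfolding infinite_quotient_def by simp_all
    obtain F where F: "finite F" "F \<subseteq> ?T" "F \<inter> I = {}"
        "\<And>J. ideal_set ?T J \<Longrightarrow> I \<subseteq> J \<Longrightarrow> F \<inter> J = {} \<Longrightarrow> marked_point n J \<in> U"
      using openin_marked_ring_spaceD[OF U I] \<open>c \<in> U\<close> unfolding c by metis
    obtain K where K: "ideal_set ?T K" "I \<subseteq> K" "finite_mod ?T K" "F \<inter> K = {}"
      using residually_finite_finite[OF noetherian_int_mpolys jacobson_int_mpolys I F(1-3)]
      by (elim exE conjE) (rule that)
    have JK: "ideal_set ?T (J \<inter> K)"
      by (rule ideal_set.ideal_Int[OF J'(1) K(1)])
    have "\<not> finite_mod (J \<inter> K) I"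
      by (rule infinite_quotient_Int[OF J'(1) K(1,3) J'(3)])
    then have "J \<inter> K \<noteq> I"
      using ideal_set.finite_mod_self[OF I] by auto
    then have "marked_point n (J \<inter> K) \<noteq> c"
      unfolding c using inj_onD[OF inj_on_marked_point] JK I by blast
    moreover have "marked_point n (J \<inter> K) \<in> U"
      using F(4)[OF JK] J'(2) K(2,4) by blast
    moreover have "ideal_length ?T J \<le> (ideal_length ?T (J \<inter> K) :: 'o ordinal)"
      by (rule ideal_length_mono[OF noetherian_int_mpolys countable_int_mpolys JK J'(1)]) blast
    then have "\<alpha> \<le> \<rho> (marked_point n (J \<inter> K))"
      unfolding \<rho>[OF JK] using J(2) by (rule order_trans[rotated])
    ultimately show "\<exists>d\<in>U. d \<noteq> c \<and> \<alpha> \<le> \<rho> d" by blast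
  qed
  then show ?thesis
    unfolding \<rho>[OF I] .
qed

theorem theorem1:
  fixes A :: "'a ring"
  assumes "cring A"
    and "\<exists>S. finite S \<and> S \<subseteq> carrier A \<and> generate_ring A S = carrier A"
  shows "\<forall>n xs. marked_ring n A xs \<longrightarrow>
    cb_rank (marked_ring_space n) (marked_class n A xs)
      = Some (reduced_length A :: 'o :: infinite ordinal)"
proof (intro allI impI)
  fix n xs assume A: "marked_ring n A xs"
  then have "ideal_set (int_mpolys n) (marked_ker n A xs)"
    by (simp add: marked_ring_iff marked_cring.marked_ker_ideal)
  then show "cb_rank (marked_ring_space n) (marked_class n A xs)
      = Some (reduced_length A :: 'o ordinal)"
    unfolding marked_class_eq[OF A] reduced_length_marked[OF A] by (rule cb_rank_marked_point)
qed

end
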